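(* Let $\lambda\in\{1,-1\}$, let $\omega>0$ and $\tau=\frac{2\pi}{\omega}$, and let $\{g_{0N}^b(t), g_{1N}^b(t)\}_{N=1}^\infty$ be smooth periodic functions of period $\tau$. Suppose $\{u_N(x,t)\}_{N=1}^\infty$ is a perturbative solution of the NLS equation $iu_t+u_{xx}-2\lambda|u|^2u=0$ in the quarter plane such that, for each $N\ge 1$, $$u_N(0,t)-g_{0N}^b(t)=O(t^{-7/2}),\qquad u_{Nx}(0,t)-g_{1N}^b(t)=O(t^{-7/2}),\qquad t\to\infty .$$ Suppose also that the set $\{u_N(\cdot,t)\mid t\ge 0\}$ is bounded in $L^1([0,\infty))$ for each $N\ge 1$. Then the asymptotic Neumann values $\{g_{1N}^b(t)\}_{N=1}^\infty$ can be constructed explicitly from the asymptotic Dirichlet values $\{g_{0N}^b(t)\}_{N=1}^\infty$ as follows. Let $\{a_{N,n}\}_{n\in\mathbb{Z}}$ and $\{c_{N,n}\}_{n\in\mathbb{Z}}$ denote the Fourier coefficients $$g_{0N}^b(t)=\sum_{n=-\infty}^\infty a_{N,n}e^{in\omega t},\qquad g_{1N}^b(t)=\sum_{n=-\infty}^\infty c_{N,n}e^{in\omega t},\qquad N\ge 1 .$$ Then, for all $N\ge1$ and $n\in\mathbb{Z}$, $$c_{N,n}=\bigg\{\bigg(-2i\lambda k\sum_{l,m=-\infty}^\infty \bar a_l\, d_m(k)d_{n+l-m}(k)-\lambda\sum_{l,m=-\infty}^\infty \bar c_l\, d_m(k)d_{n+l-m}(k)+2\lambda\sum_{l,m=-\infty}^\infty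 \bar a_l a_m d_{n+l-m}(k)+2ik\,a_n\bigg)\bigg|_{k=k_1(n)}\bigg\}_N,$$ where $a_n=\sum_{N=1}^\infty a_{N,n}\epsilon^N$, $c_n=\sum_{N=1}^\infty c_{N,n}\epsilon^N$, $d_n(k)=\sum_{N=1}^\infty d_{N,n}(k)\epsilon^N$ are formal power series in $\epsilon$, and the coefficients $d_{N,n}(k)$, which are continuous functions of $k\in\partial D_1^0$, satisfy $$d_{N,n}(k)=\frac{1}{4ik^2+in\omega}\bigg\{-2\lambda k\sum_{l,m=-\infty}^\infty \bar a_l\, d_m(k)d_{n+l-m}(k)+\lambda i\sum_{l,m=-\infty}^\infty\bar c_l\, d_m(k)d_{n+l-m}(k)-2i\lambda\sum_{l,m=-\infty}^\infty\bar a_l a_m d_{n+l-m}(k)+2k\,a_n+i\,c_n\bigg\}_N$$ for $n\in\mathbb{Z}$, $N\ge1$, $k\in\partial D_1^0$ (the value at the removable singularity $k=k_1(n)$ being given by continuity).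
   Context: A perturbative solution of the NLS equation $iu_t+u_{xx}-2\lambda|u|^2u=0$ in the quarter plane is a sequence of smooth functions $\{u_N(x,t)\}_{N=1}^\infty$, complex valued and defined for $x>0$, $t>0$, such that: (i) the formal power series $u=\epsilon u_1+\epsilon^2u_2+\epsilon^3u_3+\cdots$ satisfies the NLS equation in $\{x>0,t>0\}$ to all orders in $\epsilon$, that is, for every $N\ge1$, $iu_{Nt}+u_{Nxx}-2\lambda\{|u|^2u\}_N=0$ (explicitly, $\{|u|^2u\}_N=\sum_{p+q+r=N,\ p,q,r\ge1}u_pu_q\bar u_r$, which is $0$ for $N=1,2$); (ii) for each $N$, $u_N$ and all its partial derivatives have continuous extensions to $\{x\ge0,t\ge0\}$; (iii) for each $N$ and each $t\ge0$, $u_N(\cdot,t)\in\mathcal S([0,\infty))$, where $\mathcal S([0,\infty))=\{v\in C^\infty([0,\infty))\mid x^nv^{(m)}(x)\in L^\infty([0,\infty))\text{ for all }n,m\ge0\}$. Notation: $\{\cdots\}_N$ denotes the coefficient of $\epsilon^N$ of the enclosed formal power series in $\epsilon$; $\epsilon$ is treated as real, so $\bar a_n=\sum_N\bar a_{N,n}\epsilon^N$ and $\bar c_n=\sum_N\bar c_{N,n}\epsilon^N$. $D_1^0=\{\mathrm{Re}\,k>0\}\cap\{\mathrm{Im}\,k>0\}\subset\mathbb C$, so $\partial D_1^0=[0,\infty)\cup i[0,\infty)$. $k_1(n)$ denotes the unique root of $4k^2+n\omega=0$ in $\partial D_1^0$: $k_1(n)=\frac{i\sqrt{n\omega}}{2}$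 for $n\ge0$ and $k_1(n)=\frac{\sqrt{-n\omega}}{2}$ for $n<0$. All the quadratic and cubic sums above contribute to order $\epsilon^N$ only through coefficients of $a,c,d$ of order less than $N$, so the two formulas are used recursively in $N$: first for $c_{N,n}$, then for $d_{N,n}(k)$. *)

theory Defs
  imports
    "HOL-Analysis.Analysis"
    "HOL-Library.Landau_Symbols"
    "HOL-Computational_Algebra.Formal_Power_Series"
begin

section \<open>Smooth functions on the line, the half-line and the quarter plane\<close>

definition derivs_on :: "real set \<Rightarrow> (real \<Rightarrow> complex) \<Rightarrow> (nat \<Rightarrow> real \<Rightarrow> complex) \<Rightarrow> bool"
  where "derivs_on S f D \<longleftrightarrow>
    (\<forall>x\<in>S. D 0 x = f x) \<and>
    (\<forall>m. \<forall>x\<in>S. (D m has_vector_derivative D (Suc m) x) (at x within S))"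

definition smooth_periodic :: "real \<Rightarrow> (real \<Rightarrow> complex) \<Rightarrow> bool"
  where "smooth_periodic \<tau> g \<longleftrightarrow> (\<exists>D. derivs_on UNIV g D) \<and> (\<forall>t. g (t + \<tau>) = g t)"

text \<open>The derivatives at the end point 0 are one-sided; a continuous function lies in
  \<open>L\<^sup>\<infinity>\<close> iff it is bounded.\<close>

definition schwartz_half :: "(real \<Rightarrow> complex) set"
  where "schwartz_half = {v. \<exists>D. derivs_on {0..} v D \<and>
    (\<forall>n m. bounded ((\<lambda>x. x ^ n *\<^sub>R D m x) ` {0..}))}"

text \<open>Points of the plane are pairs \<open>(x, t)\<close>.\<close>

definition quarter :: "(real \<times> real) set"
  where "quarter = {0<..} \<times> {0<..}"

definition closed_quarter :: "(real \<times> real) set"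
  where "closed_quarter = {0..} \<times> {0..}"

definition Dx :: "(real \<times> real \<Rightarrow> complex) \<Rightarrow> real \<times> real \<Rightarrow> complex"
  where "Dx f p = vector_derivative (\<lambda>x. f (x, snd p)) (at (fst p))"

definition Dt :: "(real \<times> real \<Rightarrow> complex) \<Rightarrow> real \<times> real \<Rightarrow> complex"
  where "Dt f p = vector_derivative (\<lambda>t. f (fst p, t)) (at (snd p))"

text \<open>The function itself together with its iterated partial derivatives of all orders.\<close>

inductive_set partials :: "(real \<times> real \<Rightarrow> complex) \<Rightarrow> (real \<times> real \<Rightarrow> complex) set"
  for u where
  self: "u \<in> partials u"
| dx: "v \<in> partials u \<Longrightarrow> Dx v \<in> partials u"
| dt: "v \<in> partials u \<Longrightarrow> Dt v \<in> partials u"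

definition smooth_on_quarter :: "(real \<times> real \<Rightarrow> complex) \<Rightarrow> bool"
  where "smooth_on_quarter u \<longleftrightarrow> (\<forall>v\<in>partials u. v differentiable_on quarter)"

definition extends_continuously :: "(real \<times> real \<Rightarrow> complex) \<Rightarrow> bool"
  where "extends_continuously v \<longleftrightarrow>
    (\<exists>F. continuous_on closed_quarter F \<and> (\<forall>p\<in>quarter. F p = v p))"

text \<open>The value of the (unique) continuous extension at a point of the closed quarter plane.
  Only the values of \<open>v\<close> on the open quarter plane matter.\<close>

definition ext :: "(real \<times> real \<Rightarrow> complex) \<Rightarrow> real \<times> real \<Rightarrow> complex"
  where "ext v p = Lim (at p within quarter) v"


section \<open>Formal power series in the real parameter \<open>\<epsilon>\<close>\<close>

text \<open>All sequences indexed by the order \<open>N\<close> start at \<open>N = 1\<close>; the entry at \<open>N = 0\<close> is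
  irrelevant.\<close>

definition eps_series :: "(nat \<Rightarrow> complex) \<Rightarrow> complex fps"
  where "eps_series f = Abs_fps (\<lambda>N. if N = 0 then 0 else f N)"

definition fps_cnj :: "complex fps \<Rightarrow> complex fps"
  where "fps_cnj F = Abs_fps (\<lambda>N. cnj (fps_nth F N))"

text \<open>\<open>\<Sum>\<^sub>l\<^sub>,\<^sub>m (cnj A\<^sub>l) B\<^sub>m C\<^sub>n\<^sub>+\<^sub>l\<^sub>-\<^sub>m\<close>, where the convergence is coefficientwise in
  the usual topology of the complex numbers, not in the \<open>\<epsilon>\<close>-adic topology of type \<open>fps\<close>.\<close>

definition cubic_summable ::
    "(int \<Rightarrow> complex fps) \<Rightarrow> (int \<Rightarrow> complex fps) \<Rightarrow> (int \<Rightarrow> complex fps) \<Rightarrow> int \<Rightarrow> bool"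
  where "cubic_summable A B C n \<longleftrightarrow>
    (\<forall>N. (\<lambda>(l, m). fps_nth (fps_cnj (A l) * B m * C (n + l - m)) N) summable_on UNIV)"

definition cubic_sum ::
    "(int \<Rightarrow> complex fps) \<Rightarrow> (int \<Rightarrow> complex fps) \<Rightarrow> (int \<Rightarrow> complex fps) \<Rightarrow> int \<Rightarrow> complex fps"
  where "cubic_sum A B C n =
    Abs_fps (\<lambda>N. \<Sum>\<^sub>\<infinity>(l, m)\<in>UNIV. fps_nth (fps_cnj (A l) * B m * C (n + l - m)) N)"


section \<open>Perturbative solutions\<close>

definition perturbative_solution :: "real \<Rightarrow> (nat \<Rightarrow> real \<times> real \<Rightarrow> complex) \<Rightarrow> bool"
  where "perturbative_solution lam u \<longleftrightarrow> (\<forall>N\<ge>1.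
    smooth_on_quarter (u N) \<and>
    (\<forall>p\<in>quarter.
      \<i> * Dt (u N) p + Dx (Dx (u N)) p
        - 2 * of_real lam *
          fps_nth (let U = eps_series (\<lambda>M. u M p) in U * U * fps_cnj U) N = 0) \<and>
    (\<forall>v\<in>partials (u N). extends_continuously v) \<and>
    (\<forall>t\<ge>0. (\<lambda>x. ext (u N) (x, t)) \<in> schwartz_half))"

definition bounded_in_L1 :: "(real \<times> real \<Rightarrow> complex) \<Rightarrow> bool"
  where "bounded_in_L1 v \<longleftrightarrow> (\<exists>C. \<forall>t\<ge>0.
    set_integrable lborel {0..} (\<lambda>x. ext v (x, t)) \<and>
    (LINT x:{0..}|lborel. norm (ext v (x, t))) \<le> C)"

definition fourier_coefficients :: "real \<Rightarrow> (real \<Rightarrow> complex) \<Rightarrow> (int \<Rightarrow> complex) \<Rightarrow> bool"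
  where "fourier_coefficients \<omega> g a \<longleftrightarrow>
    (\<forall>t. ((\<lambda>n. a n * exp (\<i> * of_int n * of_real \<omega> * of_real t)) has_sum g t) UNIV)"


section \<open>The construction of the Neumann values\<close>

definition D1 :: "complex set"
  where "D1 = {k. Re k > 0} \<inter> {k. Im k > 0}"

definition k1 :: "real \<Rightarrow> int \<Rightarrow> complex"
  where "k1 \<omega> n = (if n \<ge> 0 then \<i> * of_real (sqrt (of_int n * \<omega>)) / 2
                   else of_real (sqrt (- of_int n * \<omega>)) / 2)"

text \<open>Here \<open>a n\<close>, \<open>c n\<close>, \<open>d n\<close> are the power series \<open>a\<^sub>n\<close>, \<open>c\<^sub>n\<close>, \<open>d\<^sub>n(k)\<close> at a fixed \<open>k\<close>.\<close>

definition c_rhs ::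
    "real \<Rightarrow> complex \<Rightarrow> (int \<Rightarrow> complex fps) \<Rightarrow> (int \<Rightarrow> complex fps) \<Rightarrow> (int \<Rightarrow> complex fps) \<Rightarrow>
     int \<Rightarrow> complex fps"
  where "c_rhs lam k a c d n =
      fps_const (- 2 * \<i> * of_real lam * k) * cubic_sum a d d n
    - fps_const (of_real lam) * cubic_sum c d d n
    + fps_const (2 * of_real lam) * cubic_sum a a d n
    + fps_const (2 * \<i> * k) * a n"

definition d_rhs ::
    "real \<Rightarrow> complex \<Rightarrow> (int \<Rightarrow> complex fps) \<Rightarrow> (int \<Rightarrow> complex fps) \<Rightarrow> (int \<Rightarrow> complex fps) \<Rightarrow>
     int \<Rightarrow> complex fps"
  where "d_rhs lam k a c d n =
      fps_const (- 2 * of_real lam * k) * cubic_sum a d d n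
    + fps_const (of_real lam * \<i>) * cubic_sum c d d n
    - fps_const (2 * \<i> * of_real lam) * cubic_sum a a d n
    + fps_const (2 * k) * a n
    + fps_const \<i> * c n"

text \<open>The coefficient families are indexed as \<open>a N n\<close>, \<open>c N n\<close> and \<open>d N n k\<close>. The formula for
  \<open>d N n k\<close> is imposed away from the zero \<open>k1 \<omega> n\<close> of the denominator; there the value is fixed
  by continuity along the boundary of \<open>D1\<close>.\<close>

definition neumann_recursion ::
    "real \<Rightarrow> real \<Rightarrow> (nat \<Rightarrow> int \<Rightarrow> complex) \<Rightarrow> (nat \<Rightarrow> int \<Rightarrow> complex) \<Rightarrow>
     (nat \<Rightarrow> int \<Rightarrow> complex \<Rightarrow> complex) \<Rightarrow> bool"
  where "neumann_recursion lam \<omega> a c d \<longleftrightarrow>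
    (let A = (\<lambda>n. eps_series (\<lambda>N. a N n));
         C = (\<lambda>n. eps_series (\<lambda>N. c N n));
         D = (\<lambda>k n. eps_series (\<lambda>N. d N n k))
     in (\<forall>n. \<forall>k\<in>frontier D1.
           cubic_summable A (D k) (D k) n \<and>
           cubic_summable C (D k) (D k) n \<and>
           cubic_summable A A (D k) n) \<and>
        (\<forall>N\<ge>1. \<forall>n.
           continuous_on (frontier D1) (d N n) \<and>
           c N n = fps_nth (c_rhs lam (k1 \<omega> n) A C (D (k1 \<omega> n)) n) N \<and>
           (\<forall>k\<in>frontier D1 - {k1 \<omega> n}.
              d N n k = 1 / (4 * \<i> * k\<^sup>2 + \<i> * of_int n * of_real \<omega>)
                        * fps_nth (d_rhs lam k A C (D k) n) N)))"

end

theory Submission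
  imports Defs "HOL-Complex_Analysis.Complex_Analysis"
begin

text \<open>
  For \<open>Im k > 0\<close> let \<open>f\<close> be the formal solution of the Riccati equation
  \<open>f\<^sub>x = -2ikf + u - \<lambda> (cnj u) f\<^sup>2\<close> that decays as \<open>x \<rightarrow> \<infinity>\<close>. Its coefficients are bounded in terms
  of the \<open>L\<^sup>1\<close> norms of the \<open>u\<^sub>N\<close> only, uniformly in \<open>t\<close> and \<open>k\<close>. The Lax pair makes the boundary value
  \<open>\<Phi>(k, t) = f(0, t, k)\<close> a solution of a Riccati equation in \<open>t\<close> driven by the Dirichlet and
  Neumann data. To justify this, \<open>f\<close> is cut off at \<open>x = R\<close>; the resulting error at \<open>x = 0\<close> is
  controlled by \<open>u\<close> and \<open>u\<^sub>x\<close> at \<open>R\<close> times an exponentially small factor, and an energy estimate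
  for smoothed solutions bounds \<open>u\<^sub>x\<close> in \<open>L\<^sup>2\<close>.

  For \<open>k\<close> in the open first quadrant the solutions of \<open>\<phi>' = -4ik\<^sup>2\<phi>\<close> grow, so the bounded \<open>\<Phi>\<close>
  is asymptotic, order by order, to the periodic function with Fourier coefficients
  \<open>d\<^sub>n(k) = F\<^sub>n(k) / (4ik\<^sup>2 + in\<omega>)\<close>, where \<open>F\<^sub>n\<close> is the Fourier coefficient of the
  remaining right-hand side, and these coefficients are bounded in \<open>k\<close>. Hence \<open>F\<^sub>n\<close>, which by
  induction is holomorphic across the boundary of the quadrant, vanishes at \<open>k\<^sub>1(n)\<close>. This is the formula for
  \<open>c\<^sub>n\<close>, and it makes \<open>d\<^sub>n\<close> holomorphic across the boundary as well. Uniqueness is immediate from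
  the recursion and the continuity of \<open>d\<^sub>n\<close>.
\<close>

unbundle no vec_syntax

section \<open>Formal power series with values depending on a parameter\<close>

text \<open>The Schwartz condition holds at each fixed time, with constants that may vary freely
  with t; the bound uniform in t is the one in L1. Differentiating the half-line solution in t would
  need locally uniform decay, so the equation in time is proved for the cut-off solution and passed
  to the limit in integrated form. The defect at x = R contains \<open>u_x\<close>, which L1 does
  not control. Averaging in x trades derivatives for difference quotients: for a fixed averaging
  length this dominates the boundary terms of the energy identity, and the resulting estimate does
  not depend on that length.

  The open first quadrant has Im k > 0, hence decay in x, and Re (-4ik^2) = 8 Re k Im k > 0, hence
  growth in t. The zeros \<open>k1 n\<close> of the denominators lie on its boundary, where this
  growth is lost, so vanishing there comes as a limit from inside. Conjugates fall on
  \<open>a\<close> and \<open>c\<close> and never on \<open>d\<close>; this is why \<open>d\<close>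
  can be holomorphic in k.\<close>

definition triples :: "nat \<Rightarrow> (nat \<times> nat \<times> nat) set"
  where "triples N = {(p, q, r). p + q + r = N \<and> 1 \<le> p \<and> 1 \<le> q \<and> 1 \<le> r}"

lemma finite_triples [simp]: "finite (triples N)"
proof (rule finite_subset)
  show "triples N \<subseteq> {..N} \<times> {..N} \<times> {..N}"
    by (auto simp: triples_def)
qed auto

text \<open>In a product of three series without constant term, the coefficient of order N involves
  each factor only below order N. Every recursion and induction on the order rests on this.\<close>

lemma triples_less:
  assumes "(p, q, r) \<in> triples N"
  shows "1 \<le> p" "1 \<le> q" "1 \<le> r" "p < N" "q < N" "r < N"
  using assms by (auto simp: triples_def)

lemma eps_series_nth: "eps_series f $ N = (if N = 0 then 0 else f N)"
  by (simp add: eps_series_def)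

lemma fps_cnj_nth [simp]: "fps_cnj F $ N = cnj (F $ N)"
  by (simp add: fps_cnj_def)

lemma fps_triple_mult_nth:
  fixes A B C :: "'a::comm_ring_1 fps"
  assumes "A $ 0 = 0" "B $ 0 = 0" "C $ 0 = 0"
  shows "(A * B * C) $ N = (\<Sum>(p, q, r)\<in>triples N. A $ p * B $ q * C $ r)"
proof -
  have "(A * B * C) $ N = (\<Sum>i=0..N. \<Sum>p=0..i. A $ p * B $ (i - p) * C $ (N - i))"
    by (simp add: fps_mult_nth sum_distrib_right)
  also have "\<dots> = (\<Sum>(i, p)\<in>(SIGMA i:{0..N}. {0..i}). A $ p * B $ (i - p) * C $ (N - i))"
    by (simp add: sum.Sigma)
  also have "\<dots> = (\<Sum>(i, p)\<in>{(i, p). 1 \<le> p \<and> p < i \<and> i < N}. A $ p * B $ (i - p) * C $ (N - i))"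
  proof (rule sum.mono_neutral_right)
    have "A $ p * B $ (i - p) * C $ (N - i) = 0"
      if "i \<in> {0..N}" "p \<in> {0..i}" "(i, p) \<notin> {(i, p). 1 \<le> p \<and> p < i \<and> i < N}" for i p
    proof -
      have "p = 0 \<or> i - p = 0 \<or> N - i = 0" using that by auto
      then show ?thesis using assms by auto
    qed
    then show "\<forall>x\<in>(SIGMA i:{0..N}. {0..i}) - {(i, p). 1 \<le> p \<and> p < i \<and> i < N}.
        (case x of (i, p) \<Rightarrow> A $ p * B $ (i - p) * C $ (N - i)) = 0"
      by fastforce
  qed auto
  also have "\<dots> = (\<Sum>(p, q, r)\<in>triples N. A $ p * B $ q * C $ r)"
    by (rule sum.reindex_bij_witness[where i = "\<lambda>(p, q, r). (p + q, p)" and j = "\<lambda>(i, p). (p, i - p, N - i)"])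
      (auto simp: triples_def)
  finally show ?thesis .
qed

text \<open>The derivative is taken coefficient by coefficient in the topology of the complex
  numbers. One statement then carries all orders, and the Riccati and zero-curvature equations can
  be handled as identities in a ring.\<close>

definition fps_deriv_at :: "(real \<Rightarrow> complex fps) \<Rightarrow> complex fps \<Rightarrow> real \<Rightarrow> bool"
  where "fps_deriv_at f f' x \<longleftrightarrow> (\<forall>N. ((\<lambda>y. f y $ N) has_vector_derivative f' $ N) (at x))"

lemma fps_deriv_at_const: "fps_deriv_at (\<lambda>x. c) 0 x"
  by (simp add: fps_deriv_at_def)

lemma fps_deriv_at_add:
  "fps_deriv_at f f' x \<Longrightarrow> fps_deriv_at g g' x \<Longrightarrow> fps_deriv_at (\<lambda>x. f x + g x) (f' + g') x"
  by (auto simp: fps_deriv_at_def intro!: derivative_intros)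

lemma fps_deriv_at_diff:
  "fps_deriv_at f f' x \<Longrightarrow> fps_deriv_at g g' x \<Longrightarrow> fps_deriv_at (\<lambda>x. f x - g x) (f' - g') x"
  by (auto simp: fps_deriv_at_def intro!: derivative_intros)

lemma fps_deriv_at_mult:
  assumes "fps_deriv_at f f' x" "fps_deriv_at g g' x"
  shows "fps_deriv_at (\<lambda>x. f x * g x) (f' * g x + f x * g') x"
  unfolding fps_deriv_at_def
proof
  fix N
  have "((\<lambda>y. \<Sum>i=0..N. f y $ i * g y $ (N - i)) has_vector_derivative
      (\<Sum>i=0..N. f x $ i * g' $ (N - i) + f' $ i * g x $ (N - i))) (at x)"
    using assms by (intro derivative_intros) (auto simp: fps_deriv_at_def)
  then show "((\<lambda>y. (f y * g y) $ N) has_vector_derivative (f' * g x + f x * g') $ N) (at x)"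
    by (simp add: fps_mult_nth sum.distrib add.commute)
qed

lemma fps_deriv_at_cmult:
  assumes "fps_deriv_at f f' x"
  shows "fps_deriv_at (\<lambda>x. c * f x) (c * f') x"
  using fps_deriv_at_mult[OF fps_deriv_at_const[of c x] assms] by simp

lemma fps_deriv_at_cnj:
  assumes "fps_deriv_at f f' x"
  shows "fps_deriv_at (\<lambda>x. fps_cnj (f x)) (fps_cnj f') x"
  using assms by (auto simp: fps_deriv_at_def intro: has_vector_derivative_cnj)

definition fps_continuous_on :: "'a::topological_space set \<Rightarrow> ('a \<Rightarrow> complex fps) \<Rightarrow> bool"
  where "fps_continuous_on S f \<longleftrightarrow> (\<forall>N. continuous_on S (\<lambda>x. f x $ N))"

lemma fps_continuous_on_const: "fps_continuous_on S (\<lambda>x. c)"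
  by (simp add: fps_continuous_on_def)

lemma fps_continuous_on_add:
  "fps_continuous_on S f \<Longrightarrow> fps_continuous_on S g \<Longrightarrow> fps_continuous_on S (\<lambda>x. f x + g x)"
  by (auto simp: fps_continuous_on_def intro!: continuous_intros)

lemma fps_continuous_on_diff:
  "fps_continuous_on S f \<Longrightarrow> fps_continuous_on S g \<Longrightarrow> fps_continuous_on S (\<lambda>x. f x - g x)"
  by (auto simp: fps_continuous_on_def intro!: continuous_intros)

lemma fps_continuous_on_mult:
  "fps_continuous_on S f \<Longrightarrow> fps_continuous_on S g \<Longrightarrow> fps_continuous_on S (\<lambda>x. f x * g x)"
  by (auto simp: fps_continuous_on_def fps_mult_nth intro!: continuous_intros)

lemma fps_continuous_on_cnj:
  "fps_continuous_on S f \<Longrightarrow> fps_continuous_on S (\<lambda>x. fps_cnj (f x))"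
  by (auto simp: fps_continuous_on_def intro!: continuous_intros)

lemmas fps_continuous_intros = fps_continuous_on_const fps_continuous_on_add
  fps_continuous_on_diff fps_continuous_on_mult fps_continuous_on_cnj

section \<open>Calculus on the open quarter plane\<close>

text \<open>Continuity of function and derivative on the open quarter plane is bundled in: every
  such fact then also yields integrability along slices and the hypotheses of the Leibniz
  rule.\<close>

definition has_x_deriv :: "(real \<times> real \<Rightarrow> complex) \<Rightarrow> (real \<times> real \<Rightarrow> complex) \<Rightarrow> bool"
  where "has_x_deriv g g' \<longleftrightarrow> continuous_on quarter g \<and> continuous_on quarter g' \<and>
    (\<forall>x>0. \<forall>t>0. ((\<lambda>y. g (y, t)) has_vector_derivative g' (x, t)) (at x))"

definition has_t_deriv :: "(real \<times> real \<Rightarrow> complex) \<Rightarrow> (real \<times> real \<Rightarrow> complex) \<Rightarrow> bool"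
  where "has_t_deriv g g' \<longleftrightarrow> continuous_on quarter g \<and> continuous_on quarter g' \<and>
    (\<forall>x>0. \<forall>t>0. ((\<lambda>s. g (x, s)) has_vector_derivative g' (x, t)) (at t))"

lemma quarter_iff: "(x, t) \<in> quarter \<longleftrightarrow> 0 < x \<and> 0 < t"
  by (simp add: quarter_def)

lemma open_quarter: "open quarter"
  unfolding quarter_def by (intro open_Times) auto

lemma continuous_on_slice_x:
  "continuous_on quarter g \<Longrightarrow> 0 < t \<Longrightarrow> S \<subseteq> {0<..} \<Longrightarrow> continuous_on S (\<lambda>x. g (x, t))"
  by (rule continuous_on_compose2[of quarter g]) (auto intro!: continuous_intros simp: quarter_def)

lemma continuous_on_slice_t:
  "continuous_on quarter g \<Longrightarrow> 0 < x \<Longrightarrow> S \<subseteq> {0<..} \<Longrightarrow> continuous_on S (\<lambda>t. g (x, t))"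
  by (rule continuous_on_compose2[of quarter g]) (auto intro!: continuous_intros simp: quarter_def)

lemma has_x_derivD:
  assumes "has_x_deriv g g'"
  shows "continuous_on quarter g" "continuous_on quarter g'"
    "\<lbrakk>0 < x; 0 < t\<rbrakk> \<Longrightarrow> ((\<lambda>y. g (y, t)) has_vector_derivative g' (x, t)) (at x within A)"
  using assms by (auto simp: has_x_deriv_def intro: has_vector_derivative_at_within)

lemma has_t_derivD:
  assumes "has_t_deriv g g'"
  shows "continuous_on quarter g" "continuous_on quarter g'"
    "\<lbrakk>0 < x; 0 < t\<rbrakk> \<Longrightarrow> ((\<lambda>s. g (x, s)) has_vector_derivative g' (x, t)) (at t within A)"
  using assms by (auto simp: has_t_deriv_def intro: has_vector_derivative_at_within)

text \<open>Parameter integrals along a map \<open>\<xi>\<close> that is affine in \<open>x\<close>; this covers both averages and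
  indefinite integrals with a fixed end point.\<close>

lemma continuous_on_affine_integral:
  fixes g :: "real \<times> real \<Rightarrow> complex"
  assumes g: "continuous_on quarter g"
    and xi: "continuous_on ({0<..} \<times> {0..1}) (\<lambda>(x, s). \<xi> x s)"
    and pos: "\<And>x s. 0 < x \<Longrightarrow> s \<in> {0..1} \<Longrightarrow> 0 < \<xi> x (s::real)"
  shows "continuous_on quarter (\<lambda>p. integral {0..1} (\<lambda>s. g (\<xi> (fst p) s, snd p)))"
proof -
  have xi': "continuous_on (quarter \<times> {0..1}) (\<lambda>z. \<xi> (fst (fst z)) (snd z))"
  proof -
    have "continuous_on (quarter \<times> {0..1}) (\<lambda>z. (\<lambda>(x, s). \<xi> x s) (fst (fst z), snd z))"
    proof (rule continuous_on_compose2[OF xi])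
      show "continuous_on (quarter \<times> {0..1}) (\<lambda>z. (fst (fst z), snd z))"
        by (intro continuous_intros)
    qed (auto simp: quarter_def)
    then show ?thesis by (simp only: prod.case)
  qed
  have "continuous_on (quarter \<times> {0..1}) (\<lambda>z. g (\<xi> (fst (fst z)) (snd z), snd (fst z)))"
    by (rule continuous_on_compose2[OF g]) (auto intro!: continuous_intros xi' simp: quarter_iff pos)
  then show ?thesis
    using integral_continuous_on_param[of quarter 0 1 "\<lambda>p s. g (\<xi> (fst p) s, snd p)"]
    by (simp add: case_prod_unfold)
qed

lemma has_t_deriv_affine_integral:
  assumes g: "has_t_deriv g g'"
    and xi: "continuous_on ({0<..} \<times> {0..1}) (\<lambda>(x, s). \<xi> x s)"
    and pos: "\<And>x s. 0 < x \<Longrightarrow> s \<in> {0..1} \<Longrightarrow> 0 < \<xi> x (s::real)"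
  shows "has_t_deriv (\<lambda>p. integral {0..1} (\<lambda>s. g (\<xi> (fst p) s, snd p)))
                     (\<lambda>p. integral {0..1} (\<lambda>s. g' (\<xi> (fst p) s, snd p)))"
  unfolding has_t_deriv_def
proof (intro conjI allI impI)
  note gD = has_t_derivD[OF g]
  show "continuous_on quarter (\<lambda>p. integral {0..1} (\<lambda>s. g (\<xi> (fst p) s, snd p)))"
    by (rule continuous_on_affine_integral[OF gD(1) xi pos])
  show "continuous_on quarter (\<lambda>p. integral {0..1} (\<lambda>s. g' (\<xi> (fst p) s, snd p)))"
    by (rule continuous_on_affine_integral[OF gD(2) xi pos])
  fix x t :: real assume x: "x > 0" and t: "t > 0"
  have xc: "continuous_on {0..1} (\<xi> x)"
    by (rule continuous_on_compose2[OF xi, of _ "\<lambda>s. (x, s)", simplified])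
      (use x in \<open>auto intro!: continuous_intros\<close>)
  have "((\<lambda>t. integral (cbox 0 1) (\<lambda>s. g (\<xi> x s, t))) has_vector_derivative
      integral (cbox 0 1) (\<lambda>s. g' (\<xi> x s, t))) (at t within {0<..})"
  proof (rule leibniz_rule_vector_derivative)
    show "((\<lambda>t. g (\<xi> x s, t)) has_vector_derivative g' (\<xi> x s, t)) (at t within {0<..})"
      if "t \<in> {0<..}" "s \<in> cbox 0 1" for t s
      using that gD(3)[of "\<xi> x s" t] pos[OF x] by auto
    show "(\<lambda>s. g (\<xi> x s, t)) integrable_on cbox 0 1" if "t \<in> {0<..}" for t
      by (rule integrable_continuous, rule continuous_on_compose2[OF gD(1)])
        (use that in \<open>auto intro!: continuous_intros xc simp: quarter_def pos[OF x]\<close>)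
    have "continuous_on ({0<..} \<times> cbox 0 1) (\<lambda>z. g' (\<xi> x (snd z), fst z))"
      by (rule continuous_on_compose2[OF gD(2)])
        (use x in \<open>auto intro!: continuous_intros continuous_on_compose2[OF xc] simp: quarter_def pos[OF x]\<close>)
    then show "continuous_on ({0<..} \<times> cbox 0 1) (\<lambda>(t, s). g' (\<xi> x s, t))"
      by (simp add: case_prod_unfold)
  qed (use t in auto)
  then show "((\<lambda>s. integral {0..1} (\<lambda>r. g (\<xi> (fst (x, s)) r, snd (x, s)))) has_vector_derivative
      integral {0..1} (\<lambda>s. g' (\<xi> (fst (x, t)) s, snd (x, t)))) (at t)"
    using t by (simp add: at_within_open[of t "{0<..}"])
qed

section \<open>Averages, difference quotients and primitives in x\<close>

definition avg :: "real \<Rightarrow> (real \<times> real \<Rightarrow> complex) \<Rightarrow> real \<times> real \<Rightarrow> complex"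
  where "avg h g p = integral {0..1} (\<lambda>s. g (fst p + h * s, snd p))"

definition dquot :: "real \<Rightarrow> (real \<times> real \<Rightarrow> complex) \<Rightarrow> real \<times> real \<Rightarrow> complex"
  where "dquot h g p = (g (fst p + h, snd p) - g p) / of_real h"

text \<open>The integral over y from x to R, rescaled to the unit interval. In this form it keeps
  its meaning, with the right sign, for x > R, so it is differentiable in x at R as well.\<close>

definition prim :: "real \<Rightarrow> (real \<times> real \<Rightarrow> complex) \<Rightarrow> real \<times> real \<Rightarrow> complex"
  where "prim R g p = of_real (R - fst p) * integral {0..1} (\<lambda>s. g (fst p + (R - fst p) * s, snd p))"

lemma has_t_deriv_avg: "has_t_deriv g g' \<Longrightarrow> h > 0 \<Longrightarrow> has_t_deriv (avg h g) (avg h g')"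
  unfolding avg_def[abs_def]
  by (rule has_t_deriv_affine_integral[where \<xi> = "\<lambda>x s. x + h * s"])
    (auto intro!: continuous_intros add_pos_nonneg simp: case_prod_unfold)

lemma continuous_avg: "continuous_on quarter g \<Longrightarrow> h > 0 \<Longrightarrow> continuous_on quarter (avg h g)"
  unfolding avg_def[abs_def]
  by (rule continuous_on_affine_integral[where \<xi> = "\<lambda>x s. x + h * s"])
    (auto intro!: continuous_intros add_pos_nonneg simp: case_prod_unfold)

lemma between_pos: "0 < x \<Longrightarrow> 0 < R \<Longrightarrow> s \<in> {0..1} \<Longrightarrow> 0 < x + (R - x) * (s::real)"
  using convex_bound_lt[of "- x" 0 "- R" "1 - s" s] by (auto simp: algebra_simps)

lemma continuous_prim:
  assumes "continuous_on quarter g" "R > 0"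
  shows "continuous_on quarter (prim R g)"
  unfolding prim_def[abs_def]
  by (intro continuous_intros continuous_on_affine_integral[where \<xi> = "\<lambda>x s. x + (R - x) * s"])
    (use assms in \<open>auto intro!: continuous_intros between_pos simp: case_prod_unfold\<close>)

lemma has_t_deriv_prim:
  assumes "has_t_deriv g g'" "R > 0"
  shows "has_t_deriv (prim R g) (prim R g')"
proof -
  have "has_t_deriv (\<lambda>p. integral {0..1} (\<lambda>s. g (fst p + (R - fst p) * s, snd p)))
      (\<lambda>p. integral {0..1} (\<lambda>s. g' (fst p + (R - fst p) * s, snd p)))"
    by (rule has_t_deriv_affine_integral[where \<xi> = "\<lambda>x s. x + (R - x) * s"])
      (use assms in \<open>auto intro!: continuous_intros between_pos simp: case_prod_unfold\<close>)
  moreover have "continuous_on quarter (prim R g)" "continuous_on quarter (prim R g')"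
    using continuous_prim has_t_derivD(1,2)[OF assms(1)] assms(2) by blast+
  ultimately show ?thesis
    unfolding has_t_deriv_def by (auto simp: prim_def intro!: derivative_intros)
qed

text \<open>Formulated with \<open>closed_segment\<close> because \<open>prim\<close> is evaluated
  on both sides of R, so the end points come in either order.\<close>

lemma integral_affine_FTC:
  fixes V v :: "real \<Rightarrow> complex"
  assumes "\<And>y. y \<in> closed_segment x z \<Longrightarrow> (V has_vector_derivative v y) (at y within closed_segment x z)"
  shows "of_real (z - x) * integral {0..1} (\<lambda>s. v (x + (z - x) * s)) = V z - V x"
proof -
  have seg: "x + (z - x) * s \<in> closed_segment x z" if "s \<in> {0..1}" for s
    using that unfolding closed_segment_def by (auto intro!: exI[of _ s] simp: algebra_simps)
  have "((\<lambda>s. (z - x) *\<^sub>R v (x + (z - x) * s)) has_integral V (x + (z - x) * 1) - V (x + (z - x) * 0)) {0..1}"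
  proof (rule fundamental_theorem_of_calculus)
    fix s :: real assume s: "s \<in> {0..1}"
    have "((\<lambda>s. x + (z - x) * s) has_vector_derivative (z - x)) (at s within {0..1})"
      by (auto intro!: derivative_eq_intros simp: has_real_derivative_iff_has_vector_derivative[symmetric])
    moreover have "(V has_vector_derivative v (x + (z - x) * s))
        (at (x + (z - x) * s) within (\<lambda>s. x + (z - x) * s) ` {0..1})"
      using assms[OF seg[OF s]] by (rule has_vector_derivative_within_subset) (use seg in auto)
    ultimately show "((\<lambda>s. V (x + (z - x) * s)) has_vector_derivative (z - x) *\<^sub>R v (x + (z - x) * s))
        (at s within {0..1})"
      using vector_diff_chain_within[of "\<lambda>s. x + (z - x) * s" "z - x" s "{0..1}" V] by (simp add: o_def)
  qed simp
  then have "integral {0..1} (\<lambda>s. (z - x) *\<^sub>R v (x + (z - x) * s)) = V z - V x"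
    by (simp only: integral_unique mult_1_right mult_zero_right add_0_right) simp
  then have "(z - x) *\<^sub>R integral {0..1} (\<lambda>s. v (x + (z - x) * s)) = V z - V x"
    by (simp only: integral_cmul)
  then show ?thesis by (simp only: scaleR_conv_of_real)
qed

lemma has_x_deriv_prim:
  assumes g: "continuous_on quarter g" and R: "R > 0"
  shows "has_x_deriv (prim R g) (\<lambda>p. - g p)"
  unfolding has_x_deriv_def
proof (intro conjI allI impI)
  show "continuous_on quarter (prim R g)" by (rule continuous_prim[OF assms])
  show "continuous_on quarter (\<lambda>p. - g p)" using g by (intro continuous_intros)
  fix x t :: real assume x: "x > 0" and t: "t > 0"
  \<comment> \<open>An interval inside the positive axis with x and R in its interior; it carries
    one antiderivative for both points.\<close>
  define a where "a = min x R / 2"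
  define b where "b = max x R + 1"
  have ab: "0 < a" "a < x" "x < b" "a < R" "R < b" using x R by (auto simp: a_def b_def min_def max_def)
  have "continuous_on {a..b} (\<lambda>y. g (y, t))"
    by (rule continuous_on_slice_x[OF g t]) (use ab in auto)
  then obtain V where V: "\<And>y. y \<in> {a..b} \<Longrightarrow> (V has_vector_derivative g (y, t)) (at y within {a..b})"
    by (blast intro: antiderivative_continuous)
  have eq: "prim R g (y, t) = V R - V y" if "y \<in> {a..b}" for y
  proof -
    have sub: "closed_segment y R \<subseteq> {a..b}"
      using that ab by (auto simp: closed_segment_eq_real_ivl)
    show ?thesis
      unfolding prim_def fst_conv snd_conv
      by (rule integral_affine_FTC[where v = "\<lambda>y. g (y, t)"])
        (meson V sub has_vector_derivative_within_subset subsetD)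
  qed
  have "((\<lambda>y. V R - V y) has_vector_derivative 0 - g (x, t)) (at x)"
  proof -
    have "(V has_vector_derivative g (x, t)) (at x within {a..b})" using V ab by auto
    then have "(V has_vector_derivative g (x, t)) (at x)"
      using ab by (simp add: at_within_Icc_at)
    then show ?thesis by (intro derivative_intros)
  qed
  then show "((\<lambda>y. prim R g (y, t)) has_vector_derivative - g (x, t)) (at x)"
    using has_vector_derivative_transform_within_open[of "\<lambda>y. V R - V y" "- g (x, t)" x "{a<..<b}" "\<lambda>y. prim R g (y, t)"]
      ab eq by auto
qed

lemma prim_eq_integral:
  assumes g: "continuous_on quarter g" and "0 < x" "x \<le> R" "0 < t"
  shows "prim R g (x, t) = integral {x..R} (\<lambda>y. g (y, t))"
proof -
  have "continuous_on {x..R} (\<lambda>y. g (y, t))"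
    by (rule continuous_on_slice_x[OF g]) (use assms in auto)
  then obtain V where V: "\<And>y. y \<in> {x..R} \<Longrightarrow> (V has_vector_derivative g (y, t)) (at y within {x..R})"
    by (blast intro: antiderivative_continuous)
  have "prim R g (x, t) = V R - V x"
    unfolding prim_def fst_conv snd_conv
    by (rule integral_affine_FTC[where v = "\<lambda>y. g (y, t)"])
      (use V assms in \<open>auto simp: closed_segment_eq_real_ivl\<close>)
  then show ?thesis
    using fundamental_theorem_of_calculus[OF assms(3) V] by (simp add: integral_unique)
qed

lemma prim_at [simp]: "prim R g (R, t) = 0"
  by (simp add: prim_def)

lemma has_x_deriv_cong:
  assumes "has_x_deriv g g'" "\<And>p. p \<in> quarter \<Longrightarrow> f p = g p" "\<And>p. p \<in> quarter \<Longrightarrow> f' p = g' p"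
  shows "has_x_deriv f f'"
  unfolding has_x_deriv_def
proof (intro conjI allI impI)
  show "continuous_on quarter f" "continuous_on quarter f'"
    using has_x_derivD(1,2)[OF assms(1)] assms(2,3) by (simp_all cong: continuous_on_cong)
  fix x t :: real assume xt: "x > 0" "t > 0"
  show "((\<lambda>y. f (y, t)) has_vector_derivative f' (x, t)) (at x)"
    using has_vector_derivative_transform_within_open[of "\<lambda>y. g (y, t)" "g' (x, t)" x "{0<..}" "\<lambda>y. f (y, t)"]
      has_x_derivD(3)[OF assms(1) xt] xt assms(2,3) by (auto simp: quarter_iff)
qed

lemma has_t_deriv_cong:
  assumes "has_t_deriv g g'" "\<And>p. p \<in> quarter \<Longrightarrow> f p = g p" "\<And>p. p \<in> quarter \<Longrightarrow> f' p = g' p"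
  shows "has_t_deriv f f'"
  unfolding has_t_deriv_def
proof (intro conjI allI impI)
  show "continuous_on quarter f" "continuous_on quarter f'"
    using has_t_derivD(1,2)[OF assms(1)] assms(2,3) by (simp_all cong: continuous_on_cong)
  fix x t :: real assume xt: "x > 0" "t > 0"
  show "((\<lambda>s. f (x, s)) has_vector_derivative f' (x, t)) (at t)"
    using has_vector_derivative_transform_within_open[of "\<lambda>s. g (x, s)" "g' (x, t)" t "{0<..}" "\<lambda>s. f (x, s)"]
      has_t_derivD(3)[OF assms(1) xt] xt assms(2,3) by (auto simp: quarter_iff)
qed

text \<open>The fundamental theorem of calculus: an average pays for one derivative at the cost of a
  factor 1 / h.\<close>

lemma dquot_eq_avg:
  assumes "has_x_deriv g g'" "0 < h" "p \<in> quarter"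
  shows "dquot h g p = avg h g' p"
proof -
  obtain x t where p: "p = (x, t)" "0 < x" "0 < t" using assms(3) by (cases p) (auto simp: quarter_iff)
  have "of_real (x + h - x) * integral {0..1} (\<lambda>s. g' (x + (x + h - x) * s, t)) = g (x + h, t) - g (x, t)"
    by (rule integral_affine_FTC[where v = "\<lambda>y. g' (y, t)"])
      (use p assms(2) in \<open>auto intro!: has_x_derivD(3)[OF assms(1)] simp: closed_segment_eq_real_ivl\<close>)
  then show ?thesis using assms(2) by (simp add: p dquot_def avg_def field_simps)
qed

text \<open>\<open>prim 1 g\<close> is the negative of an antiderivative of g; its base point 1 is
  arbitrary, since only a difference of its values enters.\<close>

lemma avg_eq_prim:
  assumes "continuous_on quarter g" "0 < h" "p \<in> quarter"
  shows "avg h g p = - dquot h (prim 1 g) p"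
proof -
  have "has_x_deriv (\<lambda>p. - prim 1 g p) g"
    using has_x_deriv_prim[OF assms(1), of 1] assms(1) unfolding has_x_deriv_def
    by (auto intro!: continuous_intros derivative_eq_intros)
  from dquot_eq_avg[OF this assms(2,3)] show ?thesis
    by (simp add: dquot_def minus_divide_left[symmetric] del: minus_divide_left)
      (simp add: minus_divide_left add.commute)
qed

text \<open>An average gains one derivative: g is assumed continuous only, and its average is a
  difference of values of a primitive.\<close>

lemma has_x_deriv_avg_dquot:
  assumes g: "continuous_on quarter g" and h: "0 < h"
  shows "has_x_deriv (avg h g) (dquot h g)"
  unfolding has_x_deriv_def
proof (intro conjI allI impI)
  show "continuous_on quarter (avg h g)" by (rule continuous_avg[OF assms])
  show "continuous_on quarter (dquot h g)"
    unfolding dquot_def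
    by (intro continuous_intros g continuous_on_compose2[OF g])
      (use h in \<open>auto simp: quarter_def\<close>)
  fix x t :: real assume xt: "x > 0" "t > 0"
  note D = has_x_derivD(3)[OF has_x_deriv_prim[OF g, of 1]]
  have "((\<lambda>y. y + h) has_vector_derivative 1) (at x)"
    by (auto intro!: derivative_eq_intros)
  then have "((\<lambda>y. prim 1 g (y + h, t)) has_vector_derivative - g (x + h, t)) (at x)"
    using vector_diff_chain_at[of "\<lambda>y. y + h" 1 x "\<lambda>y. prim 1 g (y, t)" "- g (x + h, t)"] D[of "x + h" t UNIV] xt h
    by (auto simp: o_def)
  then have "((\<lambda>y. - dquot h (prim 1 g) (y, t)) has_vector_derivative dquot h g (x, t)) (at x)"
    unfolding dquot_def using D[of x t UNIV] xt
    by (auto intro!: derivative_eq_intros simp: diff_divide_distrib)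
  then show "((\<lambda>y. avg h g (y, t)) has_vector_derivative dquot h g (x, t)) (at x)"
    using has_vector_derivative_transform_within_open[of "\<lambda>y. - dquot h (prim 1 g) (y, t)"
        "dquot h g (x, t)" x "{0<..}" "\<lambda>y. avg h g (y, t)"] xt avg_eq_prim[OF g h]
    by (auto simp: quarter_iff)
qed

lemma has_x_deriv_avg:
  assumes "has_x_deriv g g'" "0 < h"
  shows "has_x_deriv (avg h g) (avg h g')"
  by (rule has_x_deriv_cong[OF has_x_deriv_avg_dquot[OF has_x_derivD(1)[OF assms(1)] assms(2)]])
    (simp_all add: dquot_eq_avg[OF assms])

lemma has_t_deriv_dquot:
  assumes "has_t_deriv g g'" "0 < h"
  shows "has_t_deriv (dquot h g) (dquot h g')"
  unfolding has_t_deriv_def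
proof (intro conjI allI impI)
  note D = has_t_derivD[OF assms(1)]
  show "continuous_on quarter (dquot h g)" "continuous_on quarter (dquot h g')"
    using has_x_derivD(2)[OF has_x_deriv_avg_dquot] D(1,2) assms(2) by blast+
  fix x t :: real assume xt: "x > 0" "t > 0"
  show "((\<lambda>s. dquot h g (x, s)) has_vector_derivative dquot h g' (x, t)) (at t)"
    unfolding dquot_def using D(3)[of x t UNIV] D(3)[of "x + h" t UNIV] xt assms(2)
    by (auto intro!: derivative_eq_intros)
qed

section \<open>Norm estimates for averages and difference quotients\<close>

lemma dquot_norm_le:
  assumes "0 < h" "\<And>y. x \<le> y \<Longrightarrow> norm (g (y, t)) \<le> c"
  shows "norm (dquot h g (x, t)) \<le> 2 * c / h"
proof -
  have "norm (g (x + h, t) - g (x, t)) \<le> c + c"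
    by (rule order_trans[OF norm_triangle_ineq4]) (intro add_mono assms, use assms(1) in auto)
  then show ?thesis using assms(1) by (simp add: dquot_def norm_divide divide_right_mono)
qed

lemma avg_integrable:
  assumes "continuous_on quarter g" "0 < h" "0 < x" "0 < t"
  shows "continuous_on {0..1} (\<lambda>s. g (x + h * s, t))"
  by (rule continuous_on_compose2[OF assms(1)])
    (use assms in \<open>auto intro!: continuous_intros add_pos_nonneg simp: quarter_iff\<close>)

lemma avg_norm_diff_le:
  assumes g: "continuous_on quarter g" and h: "0 < h" and xt: "0 < x" "0 < t"
    and le: "\<And>y. y \<in> {x..x + h} \<Longrightarrow> norm (g (y, t) - c) \<le> e"
  shows "norm (avg h g (x, t) - c) \<le> e"
proof -
  note ci = avg_integrable[OF g h xt]
  have "avg h g (x, t) - c = integral {0..1} (\<lambda>s. g (x + h * s, t) - c)"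
    using integral_diff[OF integrable_continuous_real[OF ci], of "\<lambda>s. c"]
    by (simp add: avg_def integrable_const_ivl)
  also have "norm \<dots> \<le> e * (1 - 0)"
    by (rule integral_bound) (use ci h in \<open>auto intro!: continuous_intros le simp: mult_left_le\<close>)
  finally show ?thesis by simp
qed

lemma avg_norm_le:
  assumes "continuous_on quarter g" "0 < h" "0 < x" "0 < t"
    and "\<And>y. y \<in> {x..x + h} \<Longrightarrow> norm (g (y, t)) \<le> e"
  shows "norm (avg h g (x, t)) \<le> e"
  using avg_norm_diff_le[of g h x t 0 e] assms by simp

lemma avg_eq_integral:
  assumes "continuous_on quarter g" "0 < h" "0 < x" "0 < t"
  shows "of_real h * avg h g (x, t) = integral {x..x + h} (\<lambda>y. g (y, t))"
proof -
  have "continuous_on {x..x + h} (\<lambda>y. g (y, t))"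
    by (rule continuous_on_slice_x[OF assms(1)]) (use assms in auto)
  then obtain V where V: "\<And>y. y \<in> {x..x + h} \<Longrightarrow> (V has_vector_derivative g (y, t)) (at y within {x..x + h})"
    by (blast intro: antiderivative_continuous)
  have "of_real (x + h - x) * integral {0..1} (\<lambda>s. g (x + (x + h - x) * s, t)) = V (x + h) - V x"
    by (rule integral_affine_FTC[where v = "\<lambda>y. g (y, t)"])
      (use V assms in \<open>auto simp: closed_segment_eq_real_ivl\<close>)
  then show ?thesis
    using fundamental_theorem_of_calculus[of x "x + h" V "\<lambda>y. g (y, t)"] V assms
    by (simp add: integral_unique avg_def)
qed

text \<open>The variance of \<open>norm (f s)\<close> about its mean c is nonnegative.\<close>

lemma cauchy_schwarz_unit_interval:
  fixes f :: "real \<Rightarrow> complex"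
  assumes f: "continuous_on {0..1} f"
  shows "(norm (integral {0..1} f))\<^sup>2 \<le> integral {0..1} (\<lambda>s. (norm (f s))\<^sup>2)"
proof -
  define c where "c = integral {0..1} (\<lambda>s. norm (f s))"
  have i1: "(\<lambda>s. norm (f s)) integrable_on {0..1}" and i2: "(\<lambda>s. (norm (f s))\<^sup>2) integrable_on {0..1}"
    by (intro integrable_continuous_real continuous_intros f)+
  have "0 \<le> integral {0..1} (\<lambda>s. (norm (f s) - c)\<^sup>2)"
    by (intro integral_nonneg integrable_continuous_real continuous_intros f) auto
  also have "(\<lambda>s. (norm (f s) - c)\<^sup>2) = (\<lambda>s. (norm (f s))\<^sup>2 - (2 * c) * norm (f s) + c\<^sup>2)"
    by (auto simp: power2_eq_square algebra_simps)
  also have "integral {0..1} \<dots> = integral {0..1} (\<lambda>s. (norm (f s))\<^sup>2) - (2 * c) * c + c\<^sup>2"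
  proof (rule integral_unique, intro has_integral_add has_integral_diff has_integral_mult_right)
    show "((\<lambda>s. c\<^sup>2) has_integral c\<^sup>2) {0..1::real}"
      using has_integral_const_real[of "c\<^sup>2" 0 1] by simp
  qed (use i1 i2 in \<open>auto simp: c_def has_integral_integral\<close>)
  finally have "c\<^sup>2 \<le> integral {0..1} (\<lambda>s. (norm (f s))\<^sup>2)"
    by (simp add: power2_eq_square)
  moreover have "norm (integral {0..1} f) \<le> c"
    unfolding c_def by (rule integral_norm_bound_integral) (use integrable_continuous_real[OF f] i1 in auto)
  ultimately show ?thesis
    by (meson norm_ge_zero order_trans power_mono)
qed

text \<open>Cauchy-Schwarz in s, Fubini, and a shift in x. The interval grows by h on the right
  because the average at x looks ahead to x + h.\<close>

lemma avg_L2_contraction: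
  assumes g: "continuous_on quarter g" and h: "0 < h" and R: "1 \<le> R" and t: "0 < t"
  shows "integral {1..R} (\<lambda>x. (norm (avg h g (x, t)))\<^sup>2) \<le> integral {1..R + h} (\<lambda>x. (norm (g (x, t)))\<^sup>2)"
proof -
  let ?G = "\<lambda>x. (norm (g (x, t)))\<^sup>2"
  have Gc: "continuous_on S ?G" if "S \<subseteq> {0<..}" for S
    by (intro continuous_intros continuous_on_slice_x[OF g t] that)
  have cp: "continuous_on (cbox (1, 0) (R, 1)) (\<lambda>(x, s). ?G (x + h * s))"
  proof -
    have "continuous_on (cbox (1, 0) (R, 1)) (\<lambda>z. ?G (fst z + h * snd z))"
      by (rule continuous_on_compose2[OF Gc, of "{0<..}"])
        (use h in \<open>auto intro!: continuous_intros add_pos_nonneg\<close>)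
    then show ?thesis by (simp add: case_prod_unfold)
  qed
  have "integral {1..R} (\<lambda>x. (norm (avg h g (x, t)))\<^sup>2) \<le> integral {1..R} (\<lambda>x. integral {0..1} (\<lambda>s. ?G (x + h * s)))"
  proof (rule integral_le)
    show "(\<lambda>x. (norm (avg h g (x, t)))\<^sup>2) integrable_on {1..R}"
      by (intro integrable_continuous_real continuous_intros continuous_on_slice_x[OF continuous_avg[OF g h] t]) auto
    show "(\<lambda>x. integral {0..1} (\<lambda>s. ?G (x + h * s))) integrable_on {1..R}"
      using integral_continuous_on_param[of "{1..R}" 0 1 "\<lambda>x s. ?G (x + h * s)"] cp
      by (auto intro!: integrable_continuous_real simp: cbox_Pair_eq)
    fix x assume "x \<in> {1..R}"
    then show "(norm (avg h g (x, t)))\<^sup>2 \<le> integral {0..1} (\<lambda>s. ?G (x + h * s))"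
      using cauchy_schwarz_unit_interval[OF avg_integrable[OF g h, of x t]] t by (simp add: avg_def)
  qed
  also have "\<dots> = integral {0..1} (\<lambda>s. integral {1..R} (\<lambda>x. ?G (x + h * s)))"
    using integral_swap_continuous[OF cp] by simp
  also have "\<dots> \<le> integral {0..1} (\<lambda>s::real. integral {1..R + h} ?G)"
  proof (rule integral_le)
    have "continuous_on ({0..1} \<times> {1..R}) (\<lambda>(s, x). ?G (x + h * s))"
    proof -
      have "continuous_on ({0..1} \<times> {1..R}) (\<lambda>z. ?G (snd z + h * fst z))"
        by (rule continuous_on_compose2[OF Gc, of "{0<..}"])
          (use h in \<open>auto intro!: continuous_intros add_pos_nonneg\<close>)
      then show ?thesis by (simp add: case_prod_unfold)
    qed
    then show "(\<lambda>s. integral {1..R} (\<lambda>x. ?G (x + h * s))) integrable_on {0..1}"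
      using integral_continuous_on_param[of "{0..1}" 1 R "\<lambda>s x. ?G (x + h * s)"]
      by (auto intro!: integrable_continuous_real)
    fix s :: real assume s: "s \<in> {0..1}"
    have hs: "0 \<le> h * s" "h * s \<le> h" using s h by (auto simp: mult_left_le)
    have "integral {1..R} (?G \<circ> (\<lambda>x. x + h * s)) = integral {1 + h * s..R + h * s} ?G"
      by (rule integral_shift) (use hs in \<open>auto intro!: Gc\<close>)
    then have "integral {1..R} (\<lambda>x. ?G (x + h * s)) = integral {1 + h * s..R + h * s} ?G"
      by (simp add: o_def)
    also have "\<dots> \<le> integral {1..R + h} ?G"
      by (rule integral_subset_le) (use hs in \<open>auto intro!: integrable_continuous_real Gc\<close>)
    finally show "integral {1..R} (\<lambda>x. ?G (x + h * s)) \<le> integral {1..R + h} ?G" .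
  qed auto
  finally show ?thesis by simp
qed

lemma avg_L1_bound:
  assumes v: "continuous_on quarter v" and h: "0 < h" and xt: "0 < x" "0 < t"
    and L1: "\<And>a b. 0 < a \<Longrightarrow> a \<le> b \<Longrightarrow> integral {a..b} (\<lambda>y. norm (v (y, t))) \<le> C"
  shows "norm (avg h v (x, t)) \<le> C / h"
proof -
  have c: "continuous_on {x..x + h} (\<lambda>y. v (y, t))"
    by (rule continuous_on_slice_x[OF v xt(2)]) (use xt in auto)
  have "norm (of_real h * avg h v (x, t)) \<le> integral {x..x + h} (\<lambda>y. norm (v (y, t)))"
    unfolding avg_eq_integral[OF v h xt]
    by (rule integral_norm_bound_integral) (auto intro!: integrable_continuous_real continuous_intros c)
  also have "\<dots> \<le> C" using L1 xt h by auto
  finally show ?thesis using h by (simp add: norm_mult field_simps)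
qed

text \<open>One average turns the L1 bound into a sup bound, one absorbs the derivative as a
  difference quotient, and one preserves the bound.\<close>

lemma avg3_deriv_bound:
  assumes v: "has_x_deriv v v1" and h: "0 < h" and xt: "0 < x" "0 < t"
    and L1: "\<And>a b. 0 < a \<Longrightarrow> a \<le> b \<Longrightarrow> integral {a..b} (\<lambda>y. norm (v (y, t))) \<le> C"
  shows "norm (avg h (avg h (avg h v1)) (x, t)) \<le> 2 * (C / h) / h"
proof -
  note c = has_x_derivD(1)[OF v]
  have "norm (avg h (avg h v) (y, t)) \<le> C / h" if "x \<le> y" for y
    by (rule avg_norm_le[OF continuous_avg[OF c h] h _ xt(2)], use that xt in linarith)
      (rule avg_L1_bound[OF c h _ xt(2) L1], use that xt in auto)
  from dquot_norm_le[of h x "avg h (avg h v)" t "C / h", OF h this]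
  show ?thesis
    using dquot_eq_avg[OF has_x_deriv_avg[OF has_x_deriv_avg[OF v h] h] h, of "(x, t)"] xt
    by (simp add: quarter_iff)
qed

text \<open>Two of the three averages turn into difference quotients, so a bound in \<open>L\<^sup>1\<close> alone makes the
  smoothed second derivative bounded uniformly in space and time.\<close>

lemma avg3_second_deriv_bound:
  assumes v: "has_x_deriv v v1" and v1: "has_x_deriv v1 v2" and h: "0 < h" and xt: "0 < x" "0 < t"
    and L1: "\<And>a b. 0 < a \<Longrightarrow> a \<le> b \<Longrightarrow> integral {a..b} (\<lambda>y. norm (v (y, t))) \<le> C"
  shows "norm (avg h (avg h (avg h v2)) (x, t)) \<le> 2 * (2 * (C / h) / h) / h"
proof -
  have av: "norm (avg h v (y, t)) \<le> C / h" if "x \<le> y" for y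
    by (rule avg_L1_bound[OF has_x_derivD(1)[OF v] h _ xt(2) L1]) (use that xt in auto)
  have q: "(y, t) \<in> quarter" if "x \<le> y" for y using that xt by (auto simp: quarter_iff)
  have dd: "norm (dquot h (avg h v) (y, t)) \<le> 2 * (C / h) / h" if "x \<le> y" for y
    by (rule dquot_norm_le[OF h]) (use av that in auto)
  have "avg h (avg h (avg h v2)) (x, t) = dquot h (avg h (avg h v1)) (x, t)"
    using dquot_eq_avg[OF has_x_deriv_avg[OF has_x_deriv_avg[OF v1 h] h] h q[OF order_refl]] by simp
  also have "\<dots> = dquot h (dquot h (avg h v)) (x, t)"
    unfolding dquot_def[of h "avg h (avg h v1)"] dquot_def[of h "dquot h (avg h v)"] fst_conv snd_conv
    using dquot_eq_avg[OF has_x_deriv_avg[OF v h] h] q h by simp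
  also have "norm \<dots> \<le> 2 * (2 * (C / h) / h) / h"
    by (rule dquot_norm_le[of h x "dquot h (avg h v)" t, OF h dd])
  finally show ?thesis .
qed

lemma dquot_lin:
  assumes "p \<in> quarter" "0 < h" "\<And>p. p \<in> quarter \<Longrightarrow> w p = \<i> * f p - \<i> * g p"
  shows "dquot h w p = \<i> * dquot h f p - \<i> * dquot h g p"
proof -
  have "(fst p + h, snd p) \<in> quarter"
    using assms(1,2) by (cases p) (auto simp: quarter_iff)
  then show ?thesis
    by (simp add: dquot_def assms(3)[OF assms(1)] assms(3) diff_divide_distrib right_diff_distrib)
qed

lemma avg_lin:
  assumes "continuous_on quarter f" "continuous_on quarter g" "0 < h" "p \<in> quarter"
    and "\<And>p. p \<in> quarter \<Longrightarrow> w p = \<i> * f p - \<i> * g p"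
  shows "avg h w p = \<i> * avg h f p - \<i> * avg h g p"
proof -
  obtain x t where p: "p = (x, t)" "0 < x" "0 < t" using assms(4) by (cases p) (auto simp: quarter_iff)
  have "avg h w p = integral {0..1} (\<lambda>s. \<i> * f (x + h * s, t) - \<i> * g (x + h * s, t))"
    unfolding avg_def p fst_conv snd_conv
    by (rule integral_cong, rule assms(5)) (use p assms(3) in \<open>auto simp: quarter_iff intro: add_pos_nonneg\<close>)
  also have "\<dots> = \<i> * avg h f p - \<i> * avg h g p"
    using avg_integrable[OF assms(1,3) p(2,3)] avg_integrable[OF assms(2,3) p(2,3)]
    by (subst integral_diff)
      (auto simp: avg_def p intro!: integrable_continuous_real continuous_intros)
  finally show ?thesis .
qed

section \<open>The energy estimate\<close>

text \<open>Let z be the triple average of \<open>v1\<close>. It solves z_t = i z_xx - i f, and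
  differentiating the squared L2 norm of z over [1, R] leaves the forcing and two boundary fluxes.
  The flux at 1 is bounded through \<open>M\<close>, which is given up to x = 4 because three
  averages of length at most 1 look ahead by at most 3. The flux at R vanishes in the time integral
  as R grows. The bound is free of h, which is what the passage h -> 0 requires.\<close>

lemma L2_deriv_bound_of_smoothing:
  fixes h :: real
  assumes v: "has_x_deriv v v1" and v1: "has_x_deriv v1 v2" and vt: "has_t_deriv v vt"
    and eq: "\<And>p. p \<in> quarter \<Longrightarrow> vt p = \<i> * v2 p - \<i> * F p" and F: "has_x_deriv F F1"
    and h: "0 < h" "h \<le> 1" and t0: "0 < t0"
    and L1: "\<And>t a b. t0 \<le> t \<Longrightarrow> t \<le> T \<Longrightarrow> 0 < a \<Longrightarrow> a \<le> b \<Longrightarrow> integral {a..b} (\<lambda>y. norm (v (y, t))) \<le> C"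
    and decay: "\<And>t. t0 \<le> t \<Longrightarrow> t \<le> T \<Longrightarrow> \<exists>K. \<forall>x\<ge>1. norm (v1 (x, t)) \<le> K / x"
    and decay0: "\<And>x. 1 \<le> x \<Longrightarrow> norm (v1 (x, t0)) \<le> K0 / x"
    and force: "\<And>t R. t0 \<le> t \<Longrightarrow> t \<le> T \<Longrightarrow> 1 \<le> R \<Longrightarrow> integral {1..R} (\<lambda>y. (norm (F1 (y, t)))\<^sup>2) \<le> B"
    and M: "\<And>x t. 1 \<le> x \<Longrightarrow> x \<le> 4 \<Longrightarrow> t0 \<le> t \<Longrightarrow> t \<le> T \<Longrightarrow> norm (v1 (x, t)) \<le> M"
           "\<And>x t. 1 \<le> x \<Longrightarrow> x \<le> 4 \<Longrightarrow> t0 \<le> t \<Longrightarrow> t \<le> T \<Longrightarrow> norm (v2 (x, t)) \<le> M"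
    and t1: "t0 \<le> t1" "t1 \<le> T" and R1: "1 \<le> R1"
  shows "integral {1..R1} (\<lambda>x. (norm (avg h (avg h (avg h v1)) (x, t1)))\<^sup>2)
    \<le> exp (T - t0) * (K0\<^sup>2 + (2 * M\<^sup>2 + B) * (T - t0))"
proof -
  let ?A = "\<lambda>g. avg h (avg h (avg h g))"
  define z where "z = ?A v1"
  define z1 where "z1 = ?A v2"
  define z2 where "z2 = dquot h (avg h (avg h v2))"
  define f where "f = ?A F1"
  have zx: "has_x_deriv z z1" unfolding z_def z1_def
    by (intro has_x_deriv_avg v1 h)
  have z1x: "has_x_deriv z1 z2" unfolding z1_def z2_def
    by (intro has_x_deriv_avg_dquot continuous_avg has_x_derivD(2)[OF v1] h)
  \<comment> \<open>Written as a difference quotient of averages of v, z can be differentiated in t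
    through the equation for v itself; no mixed derivative of v is involved.\<close>
  have zt: "has_t_deriv z (\<lambda>p. \<i> * z2 p - \<i> * f p)"
  proof (rule has_t_deriv_cong)
    show "has_t_deriv (dquot h (avg h (avg h v))) (dquot h (avg h (avg h vt)))"
      by (intro has_t_deriv_dquot has_t_deriv_avg vt h)
    fix p assume p: "p \<in> quarter"
    show "z p = dquot h (avg h (avg h v)) p"
      unfolding z_def using dquot_eq_avg[OF has_x_deriv_avg[OF has_x_deriv_avg[OF v]]] h p by simp
    have c: "continuous_on quarter v2" "continuous_on quarter F"
      using has_x_derivD[OF v1] has_x_derivD[OF F] by auto
    have "dquot h (avg h (avg h vt)) p = \<i> * z2 p - \<i> * dquot h (avg h (avg h F)) p"
      unfolding z2_def by (intro dquot_lin avg_lin continuous_avg c p h eq)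
    also have "dquot h (avg h (avg h F)) p = f p"
      unfolding f_def using dquot_eq_avg[OF has_x_deriv_avg[OF has_x_deriv_avg[OF F]]] h p by simp
    finally show "\<i> * z2 p - \<i> * f p = dquot h (avg h (avg h vt)) p" by simp
  qed
  have cz: "continuous_on quarter z" and cz1: "continuous_on quarter z1" and cz2: "continuous_on quarter z2"
    and cf: "continuous_on quarter f"
    using has_x_derivD[OF zx] has_x_derivD[OF z1x] has_x_derivD(2)[OF F] h unfolding f_def
    by (auto intro: continuous_avg)
  have v1c: "continuous_on quarter v1" using has_x_derivD[OF v1] by auto
  have zdecay: "norm (z (x, t)) \<le> K / x"
    if K: "\<And>x. 1 \<le> x \<Longrightarrow> norm (v1 (x, t)) \<le> K / x" and "0 < t" "1 \<le> x" for K x t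
  proof -
    have K0: "0 \<le> K" using K[of 1] norm_ge_zero[of "v1 (1, t)"] by (simp del: norm_ge_zero)
    have le: "norm (v1 (y, t)) \<le> K / x" if "x \<le> y" for y
      using K[of y] K0 that \<open>1 \<le> x\<close> by (meson dual_order.trans frac_le order_refl order_less_le_trans zero_less_one)
    show ?thesis unfolding z_def
      by (intro avg_norm_le continuous_avg v1c h le) (use that in auto)
  qed
  have bd1: "norm (z (1, t)) * norm (z1 (1, t)) \<le> M\<^sup>2" if "t0 \<le> t" "t \<le> T" for t
    unfolding power2_eq_square z_def z1_def
    by (intro mult_mono avg_norm_le continuous_avg v1c has_x_derivD(2)[OF v1] h M norm_ge_zero
        order_trans[OF norm_ge_zero M(1)[of 1 t]]) (use that t0 h in auto)
  \<comment> \<open>This constant depends on h, but it serves only to dominate the flux at R when R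
    grows; it does not enter the final bound.\<close>
  define D where "D = 2 * (2 * (C / h) / h) / h"
  have z1b: "norm (z1 (x, t)) \<le> D" if "t0 \<le> t" "t \<le> T" "0 < x" for x t
    unfolding z1_def D_def
    by (rule avg3_second_deriv_bound[OF v v1 h(1)]) (use L1 that t0 in auto)
  have fb: "integral {1..R} (\<lambda>y. (norm (f (y, t)))\<^sup>2) \<le> B" if "t0 \<le> t" "t \<le> T" "1 \<le> R" for t R
  proof -
    have c: "continuous_on quarter F1" using has_x_derivD[OF F] by auto
    have "integral {1..R} (\<lambda>y. (norm (f (y, t)))\<^sup>2) \<le> integral {1..R + h} (\<lambda>x. (norm (avg h (avg h F1) (x, t)))\<^sup>2)"
      unfolding f_def by (rule avg_L2_contraction) (use that t0 h c in \<open>auto intro: continuous_avg\<close>)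
    also have "\<dots> \<le> integral {1..R + h + h} (\<lambda>x. (norm (avg h F1 (x, t)))\<^sup>2)"
      by (rule avg_L2_contraction) (use that t0 h c in \<open>auto intro: continuous_avg\<close>)
    also have "\<dots> \<le> integral {1..R + h + h + h} (\<lambda>x. (norm (F1 (x, t)))\<^sup>2)"
      by (rule avg_L2_contraction) (use that t0 h c in \<open>auto intro: continuous_avg\<close>)
    also have "\<dots> \<le> B" by (rule force) (use that h in auto)
    finally show ?thesis .
  qed
  have B0: "0 \<le> B" using fb[of t0 1] t1 by simp
  let ?m = "2 * M\<^sup>2 + B"
  define \<Phi> where "\<Phi> R t = integral {1..R} (\<lambda>x. (norm (z (x, t)))\<^sup>2)" for R t
  define b where "b R s = 2 * (norm (z (R, s)) * norm (z1 (R, s)))" for R s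
  have bc: "continuous_on {t0..t} (b R)" if "0 < R" for R t
    unfolding b_def by (intro continuous_intros continuous_on_slice_t[OF cz that] continuous_on_slice_t[OF cz1 that])
      (use t0 in auto)
  \<comment> \<open>Gronwall's inequality in integrated form: the factor exp (-(t - t0)) absorbs the
    term \<open>\<Phi> R t\<close> in the estimate of the derivative \<open>G t\<close>.\<close>
  have main: "exp (- (t1 - t0)) * \<Phi> R t1 \<le> \<Phi> R t0 + ?m * (t1 - t0) + integral {t0..t1} (b R)" if R: "1 \<le> R" for R
  proof -
    define G where "G t = integral {1..R} (\<lambda>x. 2 * (z (x, t) \<bullet> (\<i> * z2 (x, t) - \<i> * f (x, t))))" for t
    have dPhi: "(\<Phi> R has_real_derivative G t) (at t)" if t: "0 < t" for t
    proof -
      have "((\<lambda>t. integral (cbox 1 R) (\<lambda>x. (norm (z (x, t)))\<^sup>2)) has_vector_derivative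
          integral (cbox 1 R) (\<lambda>x. 2 * (z (x, t) \<bullet> (\<i> * z2 (x, t) - \<i> * f (x, t))))) (at t within {0<..})"
      proof (rule leibniz_rule_vector_derivative)
        fix s x :: real assume "s \<in> {0<..}" "x \<in> cbox 1 R"
        then have "((\<lambda>s. z (x, s)) has_vector_derivative \<i> * z2 (x, s) - \<i> * f (x, s)) (at s within {0<..})"
          by (intro has_t_derivD(3)[OF zt]) auto
        then have "((\<lambda>s. z (x, s) \<bullet> z (x, s)) has_vector_derivative
            2 * (z (x, s) \<bullet> (\<i> * z2 (x, s) - \<i> * f (x, s)))) (at s within {0<..})"
          unfolding has_vector_derivative_def
          by (auto intro!: derivative_eq_intros simp: inner_commute)
        then show "((\<lambda>t. (norm (z (x, t)))\<^sup>2) has_vector_derivative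
            2 * (z (x, s) \<bullet> (\<i> * z2 (x, s) - \<i> * f (x, s)))) (at s within {0<..})"
          by (simp add: power2_norm_eq_inner)
      next
        fix s :: real assume "s \<in> {0<..}"
        then show "(\<lambda>x. (norm (z (x, s)))\<^sup>2) integrable_on cbox 1 R"
          by (auto intro!: integrable_continuous_real continuous_intros continuous_on_slice_x[OF cz])
      next
        have "continuous_on ({0<..} \<times> cbox 1 R) (\<lambda>y. z (snd y, fst y))"
          "continuous_on ({0<..} \<times> cbox 1 R) (\<lambda>y. z2 (snd y, fst y))"
          "continuous_on ({0<..} \<times> cbox 1 R) (\<lambda>y. f (snd y, fst y))"
          by (rule continuous_on_compose2[OF cz] continuous_on_compose2[OF cz2] continuous_on_compose2[OF cf];
            auto intro!: continuous_intros simp: quarter_def)+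
        then show "continuous_on ({0<..} \<times> cbox 1 R) (\<lambda>(t, x). 2 * (z (x, t) \<bullet> (\<i> * z2 (x, t) - \<i> * f (x, t))))"
          unfolding case_prod_unfold by (intro continuous_intros)
      qed (use t in auto)
      then show ?thesis
        unfolding \<Phi>_def[abs_def] G_def using t
        by (simp add: at_within_open[of t "{0<..}"] has_real_derivative_iff_has_vector_derivative)
    qed
    have Gle: "G t \<le> b R t + ?m + \<Phi> R t" if t: "t0 \<le> t" "t \<le> T" for t
    proof -
      have tp: "0 < t" using t t0 by auto
      note sl = continuous_on_slice_x[OF cz tp] continuous_on_slice_x[OF cz1 tp]
        continuous_on_slice_x[OF cz2 tp] continuous_on_slice_x[OF cf tp]
      have I: "((\<lambda>x. 2 * (z (x, t) \<bullet> (\<i> * z2 (x, t)))) has_integral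
          2 * (z (R, t) \<bullet> (\<i> * z1 (R, t))) - 2 * (z (1, t) \<bullet> (\<i> * z1 (1, t)))) {1..R}"
      proof (rule fundamental_theorem_of_calculus[OF R])
        fix x assume "x \<in> {1..R}"
        then have x: "0 < x" by auto
        have "((\<lambda>x. 2 * (z (x, t) \<bullet> (\<i> * z1 (x, t)))) has_vector_derivative
            2 * (z (x, t) \<bullet> (\<i> * z2 (x, t)) + z1 (x, t) \<bullet> (\<i> * z1 (x, t)))) (at x within {1..R})"
          using has_x_derivD(3)[OF zx x tp] has_x_derivD(3)[OF z1x x tp]
          unfolding has_vector_derivative_def
          by (auto intro!: derivative_eq_intros simp: algebra_simps)
        \<comment> \<open>Conservation of mass for the free equation: w and \<open>\<i> * w\<close>
          are orthogonal over the reals, so the term with |z_x|^2 drops out.\<close>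
        moreover have "w \<bullet> (\<i> * w) = 0" for w :: complex by (simp add: inner_complex_def)
        ultimately show "((\<lambda>x. 2 * (z (x, t) \<bullet> (\<i> * z1 (x, t)))) has_vector_derivative
            2 * (z (x, t) \<bullet> (\<i> * z2 (x, t)))) (at x within {1..R})" by simp
      qed
      have "G t = integral {1..R} (\<lambda>x. 2 * (z (x, t) \<bullet> (\<i> * z2 (x, t)))) +
          integral {1..R} (\<lambda>x. - 2 * (z (x, t) \<bullet> (\<i> * f (x, t))))"
        unfolding G_def
        by (subst integral_add[symmetric])
          (auto intro!: integrable_continuous_real continuous_intros sl simp: inner_diff_right algebra_simps)
      also have "integral {1..R} (\<lambda>x. - 2 * (z (x, t) \<bullet> (\<i> * f (x, t)))) \<le>
          integral {1..R} (\<lambda>x. (norm (z (x, t)))\<^sup>2 + (norm (f (x, t)))\<^sup>2)"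
      proof (rule integral_le)
        fix x
        have "- 2 * (a \<bullet> c) \<le> (norm a)\<^sup>2 + (norm c)\<^sup>2" for a c :: complex
        proof -
          have "0 \<le> (a + c) \<bullet> (a + c)" by simp
          then show ?thesis by (simp add: inner_add_left inner_add_right inner_commute power2_norm_eq_inner)
        qed
        from this[of "z (x, t)" "\<i> * f (x, t)"]
        show "- 2 * (z (x, t) \<bullet> (\<i> * f (x, t))) \<le> (norm (z (x, t)))\<^sup>2 + (norm (f (x, t)))\<^sup>2"
          by (simp add: norm_mult)
      qed (auto intro!: integrable_continuous_real continuous_intros sl)
      also have "integral {1..R} (\<lambda>x. (norm (z (x, t)))\<^sup>2 + (norm (f (x, t)))\<^sup>2) =
          \<Phi> R t + integral {1..R} (\<lambda>x. (norm (f (x, t)))\<^sup>2)"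
        unfolding \<Phi>_def by (rule integral_add) (auto intro!: integrable_continuous_real continuous_intros sl)
      also have "integral {1..R} (\<lambda>x. 2 * (z (x, t) \<bullet> (\<i> * z2 (x, t)))) =
          2 * (z (R, t) \<bullet> (\<i> * z1 (R, t))) - 2 * (z (1, t) \<bullet> (\<i> * z1 (1, t)))"
        using I by (rule integral_unique)
      also have "2 * (z (R, t) \<bullet> (\<i> * z1 (R, t))) \<le> b R t"
        using norm_cauchy_schwarz[of "z (R, t)" "\<i> * z1 (R, t)"] by (simp add: b_def norm_mult)
      finally have "G t \<le> b R t - 2 * (z (1, t) \<bullet> (\<i> * z1 (1, t))) + (\<Phi> R t + integral {1..R} (\<lambda>x. (norm (f (x, t)))\<^sup>2))"
        by simp
      moreover have "- (z (1, t) \<bullet> (\<i> * z1 (1, t))) \<le> M\<^sup>2"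
        using Cauchy_Schwarz_ineq2[of "z (1, t)" "\<i> * z1 (1, t)"] bd1[OF t] by (simp add: norm_mult)
      ultimately show ?thesis using fb[OF t R] by simp
    qed
    define y where "y t = exp (- (t - t0)) * \<Phi> R t" for t
    have "((\<lambda>t. exp (- (t - t0)) * (G t - \<Phi> R t)) has_integral y t1 - y t0) {t0..t1}"
    proof (rule fundamental_theorem_of_calculus[OF t1(1)])
      fix t assume "t \<in> {t0..t1}"
      then have t: "0 < t" using t0 by auto
      have "(y has_real_derivative exp (- (t - t0)) * (G t - \<Phi> R t)) (at t)"
        unfolding y_def by (auto intro!: derivative_eq_intros dPhi[OF t] simp: algebra_simps)
      then show "(y has_vector_derivative exp (- (t - t0)) * (G t - \<Phi> R t)) (at t within {t0..t1})"
        by (simp add: has_real_derivative_iff_has_vector_derivative has_vector_derivative_at_within)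
    qed
    moreover have "((\<lambda>t. b R t + ?m) has_integral integral {t0..t1} (b R) + ?m * (t1 - t0)) {t0..t1}"
    proof (rule has_integral_add)
      show "(b R has_integral integral {t0..t1} (b R)) {t0..t1}"
        using bc[of R t1] R by (intro integrable_integral integrable_continuous_real) auto
      show "((\<lambda>x. ?m) has_integral ?m * (t1 - t0)) {t0..t1}"
        using has_integral_const_real[of ?m t0 t1] t1 by (simp add: mult.commute)
    qed
    ultimately have "y t1 - y t0 \<le> integral {t0..t1} (b R) + ?m * (t1 - t0)"
    proof (rule has_integral_le)
      fix t assume t: "t \<in> {t0..t1}"
      have nn: "0 \<le> b R t + ?m" using B0 by (simp add: b_def)
      have "exp (- (t - t0)) * (G t - \<Phi> R t) \<le> exp (- (t - t0)) * (b R t + ?m)"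
        using Gle[of t] t t1 by (intro mult_left_mono) auto
      also have "\<dots> \<le> 1 * (b R t + ?m)"
        using t nn by (intro mult_right_mono) auto
      finally show "exp (- (t - t0)) * (G t - \<Phi> R t) \<le> b R t + ?m" by simp
    qed
    then show ?thesis by (simp add: y_def)
  qed
  \<comment> \<open>At each fixed time the flux at x = R is O(1 / R) by the spatial decay of
    \<open>v1\<close>, with a constant depending on that time. The L1 bounds give a majorant uniform
    in time, so dominated convergence applies.\<close>
  have blim: "(\<lambda>n. integral {t0..t1} (b (real n + 1))) \<longlonglongrightarrow> integral {t0..t1} (\<lambda>s. 0)"
  proof (rule dominated_convergence)
    show "b (real n + 1) integrable_on {t0..t1}" for n
      by (intro integrable_continuous_real bc) auto
    have nb: "norm (z (x, s)) \<le> 2 * (C / h) / h" if "t0 \<le> s" "s \<le> T" "0 < x" for x s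
      unfolding z_def by (rule avg3_deriv_bound[OF v h(1)]) (use L1 that t0 in auto)
    show "(\<lambda>s. 2 * (2 * (C / h) / h * D)) integrable_on {t0..t1}" by (rule integrable_const_ivl)
    fix s assume s: "s \<in> {t0..t1}"
    then have s': "t0 \<le> s" "s \<le> T" "0 < s" using t1 t0 by auto
    show "norm (b (real n + 1) s) \<le> 2 * (2 * (C / h) / h * D)" for n
    proof -
      have "norm (z (real n + 1, s)) * norm (z1 (real n + 1, s)) \<le> 2 * (C / h) / h * D"
        by (intro mult_mono nb z1b s' norm_ge_zero order_trans[OF norm_ge_zero nb[OF s'(1,2), of 1]]) auto
      then show ?thesis by (simp add: b_def)
    qed
    obtain K where K: "\<And>x. 1 \<le> x \<Longrightarrow> norm (v1 (x, s)) \<le> K / x" using decay[OF s'(1,2)] by auto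
    have "(\<lambda>n. 2 * (K * inverse (real (Suc n)) * D)) \<longlonglongrightarrow> 2 * (K * 0 * D)"
      by (intro tendsto_intros LIMSEQ_inverse_real_of_nat)
    then have "(\<lambda>n. 2 * (K / (real n + 1) * D)) \<longlonglongrightarrow> 0"
      by (simp add: field_simps)
    then show "(\<lambda>n. b (real n + 1) s) \<longlonglongrightarrow> 0"
    proof (rule Lim_null_comparison[rotated])
      show "\<forall>\<^sub>F n in sequentially. norm (b (real n + 1) s) \<le> 2 * (K / (real n + 1) * D)"
      proof (rule always_eventually, rule allI)
        fix n
        have "norm (z (real n + 1, s)) * norm (z1 (real n + 1, s)) \<le> K / (real n + 1) * D"
          by (intro mult_mono zdecay[OF K] z1b s' norm_ge_zero order_trans[OF norm_ge_zero zdecay[OF K s'(3)]]) auto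
        then show "norm (b (real n + 1) s) \<le> 2 * (K / (real n + 1) * D)" by (simp add: b_def)
      qed
    qed
  qed
  have init: "\<Phi> R t0 \<le> K0\<^sup>2" if R: "1 \<le> R" for R
  proof -
    have I1: "((\<lambda>x. K0\<^sup>2 / x\<^sup>2) has_integral (- K0\<^sup>2 / R) - (- K0\<^sup>2 / 1)) {1..R}"
    proof (rule fundamental_theorem_of_calculus[OF R])
      fix x assume "x \<in> {1..R}"
      then have "((\<lambda>x. - K0\<^sup>2 / x) has_real_derivative K0\<^sup>2 / x\<^sup>2) (at x within {1..R})"
        by (auto intro!: derivative_eq_intros simp: power2_eq_square)
      then show "((\<lambda>x. - K0\<^sup>2 / x) has_vector_derivative K0\<^sup>2 / x\<^sup>2) (at x within {1..R})"
        by (simp add: has_real_derivative_iff_has_vector_derivative)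
    qed
    have I2: "((\<lambda>x. (norm (z (x, t0)))\<^sup>2) has_integral \<Phi> R t0) {1..R}"
      unfolding \<Phi>_def by (intro integrable_integral integrable_continuous_real continuous_intros continuous_on_slice_x[OF cz t0]) auto
    have "\<Phi> R t0 \<le> (- K0\<^sup>2 / R) - (- K0\<^sup>2 / 1)"
    proof (rule has_integral_le[OF I2 I1])
      fix x assume "x \<in> {1..R}"
      then have "norm (z (x, t0)) \<le> K0 / x" by (intro zdecay decay0 t0) auto
      from power_mono[OF this, of 2] show "(norm (z (x, t0)))\<^sup>2 \<le> K0\<^sup>2 / x\<^sup>2" by (simp add: power_divide)
    qed
    also have "\<dots> \<le> K0\<^sup>2" using R by simp
    finally show ?thesis .
  qed
  \<comment> \<open>The integral over [1, R1] is at most the one over [1, n + 1] once n is large, so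
    R may tend to infinity on the right while R1 stays fixed on the left.\<close>
  have "exp (- (t1 - t0)) * \<Phi> R1 t1 \<le> K0\<^sup>2 + ?m * (t1 - t0) + 0"
  proof (rule LIMSEQ_le_const)
    show "(\<lambda>n. K0\<^sup>2 + ?m * (t1 - t0) + integral {t0..t1} (b (real n + 1))) \<longlonglongrightarrow> K0\<^sup>2 + ?m * (t1 - t0) + 0"
      using blim by (intro tendsto_intros) simp
    have "exp (- (t1 - t0)) * \<Phi> R1 t1 \<le> K0\<^sup>2 + ?m * (t1 - t0) + integral {t0..t1} (b (real n + 1))"
      if n: "nat \<lceil>R1\<rceil> \<le> n" for n
    proof -
      have R: "R1 \<le> real n + 1" using n by linarith
      have tp: "0 < t1" using t0 t1 by auto
      have "\<Phi> R1 t1 \<le> \<Phi> (real n + 1) t1"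
        unfolding \<Phi>_def by (rule integral_subset_le)
          (use R tp in \<open>auto intro!: integrable_continuous_real continuous_intros continuous_on_slice_x[OF cz]\<close>)
      then have "exp (- (t1 - t0)) * \<Phi> R1 t1 \<le> exp (- (t1 - t0)) * \<Phi> (real n + 1) t1" by simp
      also have "\<dots> \<le> K0\<^sup>2 + ?m * (t1 - t0) + integral {t0..t1} (b (real n + 1))"
        using main[of "real n + 1"] init[of "real n + 1"] by linarith
      finally show ?thesis .
    qed
    then show "\<exists>N. \<forall>n\<ge>N. exp (- (t1 - t0)) * \<Phi> R1 t1 \<le> K0\<^sup>2 + ?m * (t1 - t0) + integral {t0..t1} (b (real n + 1))"
      by blast
  qed
  then have "exp (t1 - t0) * (exp (- (t1 - t0)) * \<Phi> R1 t1) \<le> exp (t1 - t0) * (K0\<^sup>2 + ?m * (t1 - t0) + 0)"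
    by (rule mult_left_mono) simp
  then have "\<Phi> R1 t1 \<le> exp (t1 - t0) * (K0\<^sup>2 + ?m * (t1 - t0))"
    unfolding mult.assoc[symmetric] exp_add[symmetric] by simp
  also have "\<dots> \<le> exp (T - t0) * (K0\<^sup>2 + ?m * (T - t0))"
    using t1 B0 by (intro mult_mono add_mono) (auto intro!: add_nonneg_nonneg mult_nonneg_nonneg)
  finally show ?thesis by (simp add: \<Phi>_def z_def)
qed

text \<open>The estimate for the triple average is uniform in h, and at fixed t and R the average
  tends to \<open>v1\<close> uniformly on [1, R] as h -> 0. So h may be chosen depending on t and
  R.\<close>

lemma L2_deriv_bound:
  assumes v: "has_x_deriv v v1" and v1: "has_x_deriv v1 v2" and vt: "has_t_deriv v vt"
    and eq: "\<And>p. p \<in> quarter \<Longrightarrow> vt p = \<i> * v2 p - \<i> * F p" and F: "has_x_deriv F F1"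
    and t0: "0 < t0"
    and L1: "\<And>t a b. t0 \<le> t \<Longrightarrow> t \<le> T \<Longrightarrow> 0 < a \<Longrightarrow> a \<le> b \<Longrightarrow> integral {a..b} (\<lambda>y. norm (v (y, t))) \<le> C"
    and decay: "\<And>t. t0 \<le> t \<Longrightarrow> t \<le> T \<Longrightarrow> \<exists>K. \<forall>x\<ge>1. norm (v1 (x, t)) \<le> K / x"
    and force: "\<And>t R. t0 \<le> t \<Longrightarrow> t \<le> T \<Longrightarrow> 1 \<le> R \<Longrightarrow> integral {1..R} (\<lambda>y. (norm (F1 (y, t)))\<^sup>2) \<le> B"
  shows "\<exists>C'. \<forall>t R. t0 \<le> t \<longrightarrow> t \<le> T \<longrightarrow> 1 \<le> R \<longrightarrow> integral {1..R} (\<lambda>x. (norm (v1 (x, t)))\<^sup>2) \<le> C'"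
proof (cases "t0 \<le> T")
  case False
  then show ?thesis by auto
next
  case True
  obtain K0 where K0: "\<And>x. 1 \<le> x \<Longrightarrow> norm (v1 (x, t0)) \<le> K0 / x" using decay[of t0] True by auto
  have v1c: "continuous_on quarter v1" and v2c: "continuous_on quarter v2" using has_x_derivD[OF v1] by auto
  have sub: "{1..4} \<times> {t0..T} \<subseteq> quarter" using t0 by (auto simp: quarter_def)
  have "bounded (v1 ` ({1..4} \<times> {t0..T}))" "bounded (v2 ` ({1..4} \<times> {t0..T}))"
    by (intro compact_imp_bounded compact_continuous_image compact_Times compact_Icc
        continuous_on_subset[OF v1c sub] continuous_on_subset[OF v2c sub])+
  then obtain M1 M2 where "\<forall>p\<in>{1..4} \<times> {t0..T}. norm (v1 p) \<le> M1" "\<forall>p\<in>{1..4} \<times> {t0..T}. norm (v2 p) \<le> M2"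
    by (auto simp: bounded_iff)
  then have M: "\<And>x t. 1 \<le> x \<Longrightarrow> x \<le> 4 \<Longrightarrow> t0 \<le> t \<Longrightarrow> t \<le> T \<Longrightarrow> norm (v1 (x, t)) \<le> max M1 M2"
    "\<And>x t. 1 \<le> x \<Longrightarrow> x \<le> 4 \<Longrightarrow> t0 \<le> t \<Longrightarrow> t \<le> T \<Longrightarrow> norm (v2 (x, t)) \<le> max M1 M2"
    by (fastforce simp: le_max_iff_disj)+
  define Q where "Q = exp (T - t0) * (K0\<^sup>2 + (2 * (max M1 M2)\<^sup>2 + B) * (T - t0))"
  have "integral {1..R} (\<lambda>x. (norm (v1 (x, t)))\<^sup>2) \<le> 2 * Q + 2"
    if t: "t0 \<le> t" "t \<le> T" and R: "1 \<le> R" for t R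
  proof -
    have tp: "0 < t" using t t0 by auto
    have uc: "uniformly_continuous_on {1..R + 3} (\<lambda>x. v1 (x, t))"
      by (intro compact_uniformly_continuous continuous_on_slice_x[OF v1c tp]) auto
    \<comment> \<open>With tolerance 1 / R the squared error, integrated over [1, R], contributes at
      most 2.\<close>
    have "0 < 1 / R" using R by simp
    from uniformly_continuous_onE[OF uc this] obtain d where d: "0 < d"
      "\<And>x y. x \<in> {1..R + 3} \<Longrightarrow> y \<in> {1..R + 3} \<Longrightarrow> dist y x < d \<Longrightarrow> dist (v1 (y, t)) (v1 (x, t)) < 1 / R"
      by blast
    \<comment> \<open>Three forward averages of length h reach at most 3 * h < d ahead; h <= 1 keeps
      them inside [1, R + 3].\<close>
    define h where "h = min 1 (d / 4)"
    have h: "0 < h" "h \<le> 1" "3 * h < d" using d(1) by (auto simp: h_def min_def)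
    let ?z = "\<lambda>x. avg h (avg h (avg h v1)) (x, t)"
    have zc: "continuous_on {1..R} ?z"
      by (intro continuous_on_slice_x[OF _ tp] continuous_avg v1c h) auto
    have near: "norm (?z x - v1 (x, t)) \<le> 1 / R" if x: "x \<in> {1..R}" for x
    proof -
      have "norm (v1 (y, t) - v1 (x, t)) \<le> 1 / R" if "x \<le> y" "y \<le> x + 3 * h" for y
        using d(2)[of x y] that x h by (auto simp: dist_norm less_imp_le)
      then show ?thesis
        by (intro avg_norm_diff_le continuous_avg v1c h tp) (use x h in auto)
    qed
    have "integral {1..R} (\<lambda>x. (norm (v1 (x, t)))\<^sup>2) \<le> integral {1..R} (\<lambda>x. 2 * (norm (?z x))\<^sup>2 + 2 / R)"
    proof (rule integral_le)
      fix x assume x: "x \<in> {1..R}"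
      have "norm (v1 (x, t)) \<le> norm (?z x) + 1 / R"
        using near[OF x] norm_triangle_ineq2[of "v1 (x, t)" "?z x"] by (simp add: norm_minus_commute)
      then have "(norm (v1 (x, t)))\<^sup>2 \<le> (norm (?z x) + 1 / R)\<^sup>2" by (intro power_mono) auto
      also have "\<dots> \<le> 2 * (norm (?z x))\<^sup>2 + 2 * (1 / R)\<^sup>2"
        using sum_squares_bound[of "norm (?z x)" "1 / R"] by (simp add: power2_sum)
      also have "(1 / R)\<^sup>2 \<le> 1 / R" using R by (simp add: power2_eq_square field_simps)
      finally show "(norm (v1 (x, t)))\<^sup>2 \<le> 2 * (norm (?z x))\<^sup>2 + 2 / R" by simp
    qed (auto intro!: integrable_continuous_real continuous_intros zc continuous_on_slice_x[OF v1c tp])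
    also have "\<dots> = 2 * integral {1..R} (\<lambda>x. (norm (?z x))\<^sup>2) + 2 / R * (R - 1)"
      by (subst integral_add)
        (auto intro!: integrable_continuous_real continuous_intros zc simp: R mult.commute)
    also have "\<dots> \<le> 2 * Q + 2"
    proof -
      have "integral {1..R} (\<lambda>x. (norm (?z x))\<^sup>2) \<le> Q"
        unfolding Q_def
        by (rule L2_deriv_bound_of_smoothing[OF v v1 vt eq F h(1,2) t0 L1 decay K0 force M t R])
      moreover have "2 / R * (R - 1) \<le> 2" using R by (simp add: field_simps)
      ultimately show ?thesis by linarith
    qed
    finally show ?thesis .
  qed
  then show ?thesis by blast
qed

section \<open>Bounds for perturbative solutions\<close>

lemma partials_has_derivs:
  assumes "smooth_on_quarter v" "w \<in> partials v"
  shows "has_x_deriv w (Dx w)" "has_t_deriv w (Dt w)"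
proof -
  have diff: "g differentiable_on quarter" if "g \<in> partials v" for g
    using assms(1) that unfolding smooth_on_quarter_def by blast
  have cont: "continuous_on quarter w" "continuous_on quarter (Dx w)" "continuous_on quarter (Dt w)"
    using assms(2) by (auto intro!: differentiable_imp_continuous_on diff partials.intros)
  have at: "w differentiable (at (x, t))" if "0 < x" "0 < t" for x t
    using diff[OF assms(2)] that at_within_open[OF _ open_quarter, of "(x, t)"]
    by (simp add: differentiable_on_def quarter_iff) (metis quarter_iff)
  have "((\<lambda>y. w (y, t)) has_vector_derivative Dx w (x, t)) (at x)" if "0 < x" "0 < t" for x t
  proof -
    have "(\<lambda>y. (y, t)) differentiable (at x)"
      by (rule differentiableI[OF has_derivative_Pair[OF has_derivative_ident has_derivative_const]])
    then have "(w \<circ> (\<lambda>y. (y, t))) differentiable (at x)"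
      by (intro differentiable_chain_at) (use at[OF that] in auto)
    then show ?thesis by (simp add: Dx_def o_def vector_derivative_works)
  qed
  moreover have "((\<lambda>s. w (x, s)) has_vector_derivative Dt w (x, t)) (at t)" if "0 < x" "0 < t" for x t
  proof -
    have "(\<lambda>s. (x, s)) differentiable (at t)"
      by (rule differentiableI[OF has_derivative_Pair[OF has_derivative_const has_derivative_ident]])
    then have "(w \<circ> (\<lambda>s. (x, s))) differentiable (at t)"
      by (intro differentiable_chain_at) (use at[OF that] in auto)
    then show ?thesis by (simp add: Dt_def o_def vector_derivative_works)
  qed
  ultimately show "has_x_deriv w (Dx w)" "has_t_deriv w (Dt w)"
    using cont by (auto simp: has_x_deriv_def has_t_deriv_def)
qed

lemma ext_eq:
  assumes "continuous_on quarter v" "p \<in> quarter"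
  shows "ext v p = v p"
proof -
  have "(v \<longlongrightarrow> v p) (at p within quarter)"
    using assms unfolding continuous_on_def by blast
  moreover have "\<not> trivial_limit (at p within quarter)"
    unfolding at_within_open[OF assms(2) open_quarter] by (rule trivial_limit_at)
  ultimately show ?thesis unfolding ext_def by (rule tendsto_Lim[rotated])
qed

locale nls_perturbation =
  fixes lam :: real and u :: "nat \<Rightarrow> real \<times> real \<Rightarrow> complex"
  assumes lam: "lam \<in> {1, -1}"
    and sol: "perturbative_solution lam u"
    and L1: "\<And>N. N \<ge> 1 \<Longrightarrow> bounded_in_L1 (u N)"
begin

lemma norm_lam [simp]: "norm (complex_of_real lam) = 1"
  using lam by (elim insertE) simp_all

definition U where "U p = eps_series (\<lambda>M. u M p)"
definition Ux where "Ux p = eps_series (\<lambda>M. Dx (u M) p)"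
definition Uxx where "Uxx p = eps_series (\<lambda>M. Dx (Dx (u M)) p)"
definition Ut where "Ut p = eps_series (\<lambda>M. Dt (u M) p)"

lemma U_nth: "N \<ge> 1 \<Longrightarrow> U p $ N = u N p" "U p $ 0 = 0"
  "N \<ge> 1 \<Longrightarrow> Ux p $ N = Dx (u N) p" "Ux p $ 0 = 0"
  "N \<ge> 1 \<Longrightarrow> Uxx p $ N = Dx (Dx (u N)) p" "Uxx p $ 0 = 0"
  "N \<ge> 1 \<Longrightarrow> Ut p $ N = Dt (u N) p" "Ut p $ 0 = 0"
  by (simp_all add: U_def Ux_def Uxx_def Ut_def eps_series_nth)

lemmas solD = sol[unfolded perturbative_solution_def Let_def, THEN spec, THEN mp]

lemma smooth: "N \<ge> 1 \<Longrightarrow> smooth_on_quarter (u N)"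
  by (rule conjunct1[OF solD])

lemma u_derivs:
  assumes "N \<ge> 1"
  shows "has_x_deriv (u N) (Dx (u N))" "has_x_deriv (Dx (u N)) (Dx (Dx (u N)))" "has_t_deriv (u N) (Dt (u N))"
  by (rule partials_has_derivs[OF smooth[OF assms]], intro partials.intros)+

lemma U_derivs:
  assumes "0 < x" "0 < t"
  shows "fps_deriv_at (\<lambda>y. U (y, t)) (Ux (x, t)) x"
    "fps_deriv_at (\<lambda>y. Ux (y, t)) (Uxx (x, t)) x"
    "fps_deriv_at (\<lambda>s. U (x, s)) (Ut (x, t)) t"
proof -
  have "((\<lambda>y. U (y, t) $ N) has_vector_derivative Ux (x, t) $ N) (at x) \<and>
    ((\<lambda>y. Ux (y, t) $ N) has_vector_derivative Uxx (x, t) $ N) (at x) \<and>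
    ((\<lambda>s. U (x, s) $ N) has_vector_derivative Ut (x, t) $ N) (at t)" for N
  proof (cases "N = 0")
    case False
    then have N: "N \<ge> 1" by simp
    show ?thesis
      unfolding U_nth(1,3,5,7)[OF N]
      by (intro conjI has_x_derivD(3) has_t_derivD(3) u_derivs N assms)
  qed (simp add: U_nth)
  then show "fps_deriv_at (\<lambda>y. U (y, t)) (Ux (x, t)) x"
    "fps_deriv_at (\<lambda>y. Ux (y, t)) (Uxx (x, t)) x"
    "fps_deriv_at (\<lambda>s. U (x, s)) (Ut (x, t)) t"
    by (auto simp: fps_deriv_at_def)
qed

lemma U_continuous: "fps_continuous_on quarter U" "fps_continuous_on quarter Ux"
  "fps_continuous_on quarter Uxx" "fps_continuous_on quarter Ut"
proof -
  have "continuous_on quarter (\<lambda>p. U p $ N) \<and> continuous_on quarter (\<lambda>p. Ux p $ N) \<and>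
    continuous_on quarter (\<lambda>p. Uxx p $ N) \<and> continuous_on quarter (\<lambda>p. Ut p $ N)" for N
  proof (cases "N = 0")
    case False
    then have N: "N \<ge> 1" by simp
    show ?thesis
      unfolding U_nth(1,3,5,7)[OF N]
      using has_x_derivD(1,2)[OF u_derivs(1)[OF N]] has_x_derivD(2)[OF u_derivs(2)[OF N]]
        has_t_derivD(2)[OF u_derivs(3)[OF N]] by blast
  qed (simp add: U_nth)
  then show "fps_continuous_on quarter U" "fps_continuous_on quarter Ux"
    "fps_continuous_on quarter Uxx" "fps_continuous_on quarter Ut"
    by (auto simp: fps_continuous_on_def)
qed

lemma pde_nth:
  assumes "p \<in> quarter" "N \<ge> 1"
  shows "Dt (u N) p = \<i> * Dx (Dx (u N)) p - \<i> * (2 * of_real lam * (U p * U p * fps_cnj (U p)) $ N)"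
proof -
  have "\<i> * Dt (u N) p + Dx (Dx (u N)) p - 2 * of_real lam * (U p * U p * fps_cnj (U p)) $ N = 0"
    unfolding U_def by (rule bspec[OF conjunct1[OF conjunct2[OF solD[OF assms(2)]]] assms(1)])
  then have "\<i> * Dt (u N) p = 2 * of_real lam * (U p * U p * fps_cnj (U p)) $ N - Dx (Dx (u N)) p"
    by algebra
  then have "- \<i> * (\<i> * Dt (u N) p) = - \<i> * (2 * of_real lam * (U p * U p * fps_cnj (U p)) $ N - Dx (Dx (u N)) p)"
    by (simp only:)
  then show ?thesis by (simp add: right_diff_distrib mult.assoc[symmetric])
qed

lemma L1_lebesgue:
  assumes "N \<ge> 1"
  obtains C where "C \<ge> 0"
    "\<And>t. 0 < t \<Longrightarrow> integrable lborel (\<lambda>y. indicator {0<..} y *\<^sub>R u N (y, t))"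
    "\<And>t. 0 < t \<Longrightarrow> (LINT y|lborel. norm (indicator {0<..} y *\<^sub>R u N (y, t))) \<le> C"
proof -
  obtain C where C: "\<And>t. 0 \<le> t \<Longrightarrow> set_integrable lborel {0..} (\<lambda>x. ext (u N) (x, t)) \<and>
      (LINT x:{0..}|lborel. norm (ext (u N) (x, t))) \<le> C"
    using L1[OF assms] unfolding bounded_in_L1_def by blast
  have cont: "continuous_on quarter (u N)" using has_x_derivD(1)[OF u_derivs(1)[OF assms]] .
  have int: "integrable lborel (\<lambda>y. indicator {0<..} y *\<^sub>R u N (y, t))"
    and le: "(LINT y|lborel. norm (indicator {0<..} y *\<^sub>R u N (y, t))) \<le> C" if t: "0 < t" for t
  proof -
    have eq: "indicator {0<..} y *\<^sub>R u N (y, t) = indicator {0<..} y *\<^sub>R ext (u N) (y, t)" for y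
      using ext_eq[OF cont, of "(y, t)"] t by (auto simp: quarter_iff indicator_def)
    have si: "set_integrable lborel {0..} (\<lambda>x. ext (u N) (x, t))" using C t by simp
    then have "set_integrable lborel {0<..} (\<lambda>x. ext (u N) (x, t))"
      by (rule set_integrable_subset) auto
    then show int: "integrable lborel (\<lambda>y. indicator {0<..} y *\<^sub>R u N (y, t))"
      unfolding eq by (simp add: set_integrable_def)
    have "(LINT y|lborel. norm (indicator {0<..} y *\<^sub>R u N (y, t))) \<le> (LINT x:{0..}|lborel. norm (ext (u N) (x, t)))"
      unfolding set_lebesgue_integral_def
    proof (rule integral_mono)
      show "integrable lborel (\<lambda>y. indicat_real {0..} y *\<^sub>R norm (ext (u N) (y, t)))"
        using set_integrable_norm[OF si] by (simp add: set_integrable_def)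
      show "norm (indicator {0<..} y *\<^sub>R u N (y, t)) \<le> indicat_real {0..} y *\<^sub>R norm (ext (u N) (y, t))" for y
        unfolding eq by (auto simp: indicator_def)
    qed (rule integrable_norm[OF int])
    also have "\<dots> \<le> C" using C t by simp
    finally show "(LINT y|lborel. norm (indicator {0<..} y *\<^sub>R u N (y, t))) \<le> C" .
  qed
  have "0 \<le> C" using le[of 1] by (auto intro: order_trans[rotated])
  from this int le show ?thesis by (rule that)
qed

text \<open>The L1 bound once more, for gauge integrals over compact intervals: the form in which
  the energy estimate and the bound on the defect use it.\<close>

lemma L1_henstock:
  assumes "N \<ge> 1"
  obtains C where "C \<ge> 0"
    "\<And>t a b. 0 < t \<Longrightarrow> 0 < a \<Longrightarrow> a \<le> b \<Longrightarrow> integral {a..b} (\<lambda>y. norm (u N (y, t))) \<le> C"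
proof -
  obtain C where C: "C \<ge> 0"
    "\<And>t. 0 < t \<Longrightarrow> integrable lborel (\<lambda>y. indicator {0<..} y *\<^sub>R u N (y, t))"
    "\<And>t. 0 < t \<Longrightarrow> (LINT y|lborel. norm (indicator {0<..} y *\<^sub>R u N (y, t))) \<le> C"
    by (rule L1_lebesgue[OF assms]) (rule that)
  have "integral {a..b} (\<lambda>y. norm (u N (y, t))) \<le> C" if t: "0 < t" and ab: "0 < a" "a \<le> b" for t a b
  proof -
    have "continuous_on {a..b} (\<lambda>y. norm (u N (y, t)))"
      by (intro continuous_intros continuous_on_slice_x[OF has_x_derivD(1)[OF u_derivs(1)[OF assms]] t]) (use ab in auto)
    then have si: "set_integrable lborel {a..b} (\<lambda>y. norm (u N (y, t)))"
      by (rule borel_integrable_atLeastAtMost')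
    have "integral {a..b} (\<lambda>y. norm (u N (y, t))) = (LINT y|lborel. indicator {a..b} y *\<^sub>R norm (u N (y, t)))"
      using set_borel_integral_eq_integral(2)[OF si] by (simp add: set_lebesgue_integral_def)
    also have "\<dots> \<le> (LINT y|lborel. norm (indicator {0<..} y *\<^sub>R u N (y, t)))"
      by (rule integral_mono[OF _ integrable_norm[OF C(2)[OF t]]])
        (use si ab in \<open>auto simp: set_integrable_def indicator_def\<close>)
    also have "\<dots> \<le> C" by (rule C(3)[OF t])
    finally show ?thesis .
  qed
  with C(1) show ?thesis by (rule that)
qed

text \<open>The Schwartz condition at the single time t; the constant may depend on t without any
  control.\<close>

lemma Dx_decay:
  assumes "N \<ge> 1" "0 < t"
  shows "\<exists>K. \<forall>x\<ge>1. norm (Dx (u N) (x, t)) \<le> K / x"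
proof -
  have cont: "continuous_on quarter (u N)" using has_x_derivD(1)[OF u_derivs(1)[OF assms(1)]] .
  have "(\<lambda>x. ext (u N) (x, t)) \<in> schwartz_half"
    using conjunct2[OF conjunct2[OF conjunct2[OF solD[OF assms(1)]]]] assms(2) by simp
  then obtain D where D: "derivs_on {0..} (\<lambda>x. ext (u N) (x, t)) D"
      "bounded ((\<lambda>x. x ^ 1 *\<^sub>R D 1 x) ` {0..})"
    unfolding schwartz_half_def by blast
  from D(2) obtain K where K: "\<And>x. 0 \<le> x \<Longrightarrow> norm (x ^ 1 *\<^sub>R D 1 x) \<le> K"
    by (auto simp: bounded_iff)
  have "norm (Dx (u N) (x, t)) \<le> K / x" if x: "1 \<le> x" for x
  proof -
    have "(D 0 has_vector_derivative D 1 x) (at x within {0..})"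
      using spec[OF conjunct2[OF D(1)[unfolded derivs_on_def]], of 0] x by simp
    then have "(D 0 has_vector_derivative D 1 x) (at x within {0<..})"
      by (rule has_vector_derivative_within_subset) auto
    then have "(D 0 has_vector_derivative D 1 x) (at x)"
      using x by (simp add: at_within_open[of x "{0<..}"])
    moreover have "D 0 y = u N (y, t)" if "0 < y" for y
      using conjunct1[OF D(1)[unfolded derivs_on_def]] that ext_eq[OF cont, of "(y, t)"] assms(2)
      by (simp add: quarter_iff)
    ultimately have "((\<lambda>y. u N (y, t)) has_vector_derivative D 1 x) (at x)"
      using has_vector_derivative_transform_within_open[of "D 0" "D 1 x" x "{0<..}" "\<lambda>y. u N (y, t)"] x by auto
    moreover have "((\<lambda>y. u N (y, t)) has_vector_derivative Dx (u N) (x, t)) (at x)"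
      by (rule has_x_derivD(3)[OF u_derivs(1)[OF assms(1)]]) (use x assms in auto)
    ultimately have "Dx (u N) (x, t) = D 1 x" by (rule vector_derivative_unique_at[rotated])
    then show ?thesis using K[of x] x by (simp add: field_simps)
  qed
  then show ?thesis by blast
qed

text \<open>Sobolev's inequality on [x, x + 1]: the mean of u is controlled in L1, and the deviation
  from it by the integral of |u_x|, which is at most the integral of 1 + |u_x|^2.\<close>

lemma sup_bound_from_L2_deriv:
  assumes N: "N \<ge> 1" and t0: "0 < t0"
    and L2: "\<And>t R. t0 \<le> t \<Longrightarrow> t \<le> T \<Longrightarrow> 1 \<le> R \<Longrightarrow> integral {1..R} (\<lambda>x. (norm (Dx (u N) (x, t)))\<^sup>2) \<le> C"
  obtains S where "\<And>x t. t0 \<le> t \<Longrightarrow> t \<le> T \<Longrightarrow> 1 \<le> x \<Longrightarrow> norm (u N (x, t)) \<le> S"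
proof -
  note D = u_derivs(1)[OF N]
  obtain C1 where "0 \<le> C1" and C1: "\<And>t a b. 0 < t \<Longrightarrow> 0 < a \<Longrightarrow> a \<le> b \<Longrightarrow> integral {a..b} (\<lambda>y. norm (u N (y, t))) \<le> C1"
    by (rule L1_henstock[OF N]) (rule that)
  have "norm (u N (x, t)) \<le> C1 + (1 + C)" if t: "t0 \<le> t" "t \<le> T" and x: "1 \<le> x" for x t
  proof -
    have tp: "0 < t" and xp: "0 < x" using t t0 x by auto
    note cx = continuous_on_slice_x[OF has_x_derivD(2)[OF D] tp]
    define e where "e = integral {x..x + 1} (\<lambda>y. norm (Dx (u N) (y, t)))"
    have "e \<le> integral {x..x + 1} (\<lambda>y. 1 + (norm (Dx (u N) (y, t)))\<^sup>2)"
      unfolding e_def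
    proof (rule integral_le)
      show "norm (Dx (u N) (y, t)) \<le> 1 + (norm (Dx (u N) (y, t)))\<^sup>2" for y
        using zero_le_power2[of "norm (Dx (u N) (y, t)) - 1"]
        by (simp add: power2_eq_square algebra_simps) (use norm_ge_zero[of "Dx (u N) (y, t)"] in linarith)
    qed (use xp in \<open>auto intro!: integrable_continuous_real continuous_intros cx\<close>)
    also have "\<dots> = 1 + integral {x..x + 1} (\<lambda>y. (norm (Dx (u N) (y, t)))\<^sup>2)"
      by (subst integral_add) (use xp in \<open>auto intro!: integrable_continuous_real continuous_intros cx\<close>)
    also have "integral {x..x + 1} (\<lambda>y. (norm (Dx (u N) (y, t)))\<^sup>2) \<le> integral {1..x + 1} (\<lambda>y. (norm (Dx (u N) (y, t)))\<^sup>2)"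
      by (rule integral_subset_le) (use x in \<open>auto intro!: integrable_continuous_real continuous_intros cx\<close>)
    also have "\<dots> \<le> C" by (rule L2) (use t x in auto)
    finally have e: "e \<le> 1 + C" by simp
    have "norm (avg 1 (u N) (x, t) - u N (x, t)) \<le> e"
    proof (rule avg_norm_diff_le[OF has_x_derivD(1)[OF D] _ xp tp])
      fix y assume y: "y \<in> {x..x + 1}"
      have "((\<lambda>y. Dx (u N) (y, t)) has_integral u N (y, t) - u N (x, t)) {x..y}"
        by (rule fundamental_theorem_of_calculus) (use y xp tp in \<open>auto intro!: has_x_derivD(3)[OF D]\<close>)
      then have "u N (y, t) - u N (x, t) = integral {x..y} (\<lambda>y. Dx (u N) (y, t))" by (simp add: integral_unique)
      also have "norm \<dots> \<le> integral {x..y} (\<lambda>y. norm (Dx (u N) (y, t)))"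
        by (rule integral_norm_bound_integral) (use xp in \<open>auto intro!: integrable_continuous_real continuous_intros cx\<close>)
      also have "\<dots> \<le> e" unfolding e_def
        by (rule integral_subset_le) (use xp y in \<open>auto intro!: integrable_continuous_real continuous_intros cx\<close>)
      finally show "norm (u N (y, t) - u N (x, t)) \<le> e" .
    qed simp
    moreover have "norm (avg 1 (u N) (x, t)) \<le> C1 / 1"
      by (rule avg_L1_bound[OF has_x_derivD(1)[OF D] _ xp tp C1[OF tp]]) auto
    ultimately show ?thesis
      using e norm_triangle_ineq4[of "avg 1 (u N) (x, t)" "avg 1 (u N) (x, t) - u N (x, t)"] by simp
  qed
  with that show ?thesis by blast
qed

text \<open>By the product rule each term of \<open>F1\<close> has one differentiated factor of
  order below N, measured in L2, and two undifferentiated ones, measured in the sup norm through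
  \<open>sup_bound_from_L2_deriv\<close>. This closes the induction on N.\<close>

lemma cubic_deriv_L2_bound:
  assumes N: "N \<ge> 1" and t0: "0 < t0"
    and L2: "\<And>M. 1 \<le> M \<Longrightarrow> M < N \<Longrightarrow> \<exists>C. \<forall>t R. t0 \<le> t \<longrightarrow> t \<le> T \<longrightarrow> 1 \<le> R \<longrightarrow>
      integral {1..R} (\<lambda>x. (norm (Dx (u M) (x, t)))\<^sup>2) \<le> C"
    and F1: "\<And>p. F1 p = 2 * of_real lam * (Ux p * U p * fps_cnj (U p) + U p * Ux p * fps_cnj (U p) + U p * U p * fps_cnj (Ux p)) $ N"
  shows "\<exists>B. \<forall>t R. t0 \<le> t \<longrightarrow> t \<le> T \<longrightarrow> 1 \<le> R \<longrightarrow> integral {1..R} (\<lambda>y. (norm (F1 (y, t)))\<^sup>2) \<le> B"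
proof -
  obtain C where C: "\<And>M t R. 1 \<le> M \<Longrightarrow> M < N \<Longrightarrow> t0 \<le> t \<Longrightarrow> t \<le> T \<Longrightarrow> 1 \<le> R \<Longrightarrow>
      integral {1..R} (\<lambda>x. (norm (Dx (u M) (x, t)))\<^sup>2) \<le> C M"
    using L2 by metis
  have "\<exists>S. \<forall>x t. t0 \<le> t \<longrightarrow> t \<le> T \<longrightarrow> 1 \<le> x \<longrightarrow> norm (u M (x, t)) \<le> S" if "1 \<le> M" "M < N" for M
    by (rule sup_bound_from_L2_deriv[OF that(1) t0 C[OF that]]) blast+
  then obtain S' where S': "\<And>M x t. 1 \<le> M \<Longrightarrow> M < N \<Longrightarrow> t0 \<le> t \<Longrightarrow> t \<le> T \<Longrightarrow> 1 \<le> x \<Longrightarrow> norm (u M (x, t)) \<le> S' M"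
    by metis
  define S where "S = (\<Sum>M\<in>{1..<N}. \<bar>S' M\<bar>)"
  have S: "norm (u M (x, t)) \<le> S" if "1 \<le> M" "M < N" "t0 \<le> t" "t \<le> T" "1 \<le> x" for M x t
  proof -
    have "norm (u M (x, t)) \<le> \<bar>S' M\<bar>" using S'[OF that] by simp
    also have "\<dots> \<le> S" unfolding S_def by (rule member_le_sum) (use that in auto)
    finally show ?thesis .
  qed
  have S0: "0 \<le> S" by (simp add: S_def sum_nonneg)
  \<comment> \<open>The outer 2 is the coefficient of the nonlinearity, the 3 counts the terms of
    the product rule, and S^2 bounds the two undifferentiated factors.\<close>
  define Q where "Q = 2 * (3 * (real (card (triples N)) * S\<^sup>2))"
  have pt: "(norm (F1 (x, t)))\<^sup>2 \<le> Q\<^sup>2 * (real N * (\<Sum>M\<in>{1..<N}. (norm (Dx (u M) (x, t)))\<^sup>2))"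
    if t: "t0 \<le> t" "t \<le> T" and x: "1 \<le> x" for x t
  proof -
    define A where "A = (\<Sum>M\<in>{1..<N}. norm (Dx (u M) (x, t)))"
    have A0: "0 \<le> A" by (simp add: A_def sum_nonneg)
    have DA: "norm (Dx (u M) (x, t)) \<le> A" if "1 \<le> M" "M < N" for M
      unfolding A_def by (rule member_le_sum) (use that in auto)
    have trm: "norm ((X * Y * Z) $ N) \<le> real (card (triples N)) * (S\<^sup>2 * A)"
      if XYZ: "X $ 0 = 0" "Y $ 0 = 0" "Z $ 0 = 0"
        "\<And>p q r. (p, q, r) \<in> triples N \<Longrightarrow> norm (X $ p) * norm (Y $ q) * norm (Z $ r) \<le> S\<^sup>2 * A"
      for X Y Z :: "complex fps"
    proof -
      have "norm ((X * Y * Z) $ N) \<le> (\<Sum>(p, q, r)\<in>triples N. norm (X $ p) * norm (Y $ q) * norm (Z $ r))"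
        unfolding fps_triple_mult_nth[OF XYZ(1-3)]
        by (rule order_trans[OF norm_sum]) (auto intro!: sum_mono simp: norm_mult)
      also have "\<dots> \<le> (\<Sum>(p, q, r)\<in>triples N. S\<^sup>2 * A)"
        by (rule sum_mono) (use XYZ(4) in auto)
      finally show ?thesis by simp
    qed
    have bU: "norm (U (x, t) $ M) \<le> S" and bUx: "norm (Ux (x, t) $ M) \<le> A" if "1 \<le> M" "M < N" for M
      using S[OF that t x] DA[OF that] that by (auto simp: U_nth)
    have b1: "norm ((Ux (x, t) * U (x, t) * fps_cnj (U (x, t))) $ N) \<le> real (card (triples N)) * (S\<^sup>2 * A)"
    proof (rule trm)
      fix p q r assume pqr: "(p, q, r) \<in> triples N"
      have "norm (Ux (x, t) $ p) * norm (U (x, t) $ q) * norm (fps_cnj (U (x, t)) $ r) \<le> A * S * S"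
        unfolding fps_cnj_nth complex_mod_cnj
        by (intro mult_mono bU bUx triples_less[OF pqr] mult_nonneg_nonneg S0 A0 norm_ge_zero)
      then show "norm (Ux (x, t) $ p) * norm (U (x, t) $ q) * norm (fps_cnj (U (x, t)) $ r) \<le> S\<^sup>2 * A"
        by (simp add: power2_eq_square mult_ac)
    qed (auto simp: U_nth)
    have b2: "norm ((U (x, t) * Ux (x, t) * fps_cnj (U (x, t))) $ N) \<le> real (card (triples N)) * (S\<^sup>2 * A)"
      using b1 by (simp add: mult.commute[of "U (x, t)" "Ux (x, t)"])
    have b3: "norm ((U (x, t) * U (x, t) * fps_cnj (Ux (x, t))) $ N) \<le> real (card (triples N)) * (S\<^sup>2 * A)"
    proof (rule trm)
      fix p q r assume pqr: "(p, q, r) \<in> triples N"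
      have "norm (U (x, t) $ p) * norm (U (x, t) $ q) * norm (fps_cnj (Ux (x, t)) $ r) \<le> S * S * A"
        unfolding fps_cnj_nth complex_mod_cnj
        by (intro mult_mono bU bUx triples_less[OF pqr] mult_nonneg_nonneg S0 A0 norm_ge_zero)
      then show "norm (U (x, t) $ p) * norm (U (x, t) $ q) * norm (fps_cnj (Ux (x, t)) $ r) \<le> S\<^sup>2 * A"
        by (simp add: power2_eq_square mult_ac)
    qed (auto simp: U_nth)
    have "norm (F1 (x, t)) \<le> 2 * (real (card (triples N)) * (S\<^sup>2 * A) + real (card (triples N)) * (S\<^sup>2 * A) + real (card (triples N)) * (S\<^sup>2 * A))"
    proof -
      have tri: "norm (a + b + c) \<le> X + X + X" if "norm a \<le> X" "norm b \<le> X" "norm c \<le> X" for a b c :: complex and X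
        using that norm_triangle_ineq[of "a + b" c] norm_triangle_ineq[of a b] by linarith
      have "norm (F1 (x, t)) = 2 * norm ((Ux (x, t) * U (x, t) * fps_cnj (U (x, t))) $ N +
          (U (x, t) * Ux (x, t) * fps_cnj (U (x, t))) $ N + (U (x, t) * U (x, t) * fps_cnj (Ux (x, t))) $ N)"
        unfolding F1 norm_mult fps_add_nth norm_lam by simp
      then show ?thesis
        using mult_left_mono[OF tri[OF b1 b2 b3] zero_le_numeral] by (simp only:)
    qed
    then have "norm (F1 (x, t)) \<le> Q * A" by (simp add: Q_def algebra_simps)
    then have "(norm (F1 (x, t)))\<^sup>2 \<le> (Q * A)\<^sup>2" by (intro power_mono) auto
    also have "\<dots> = Q\<^sup>2 * A\<^sup>2" by (simp add: power_mult_distrib)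
    finally have FA: "(norm (F1 (x, t)))\<^sup>2 \<le> Q\<^sup>2 * A\<^sup>2" .
    have "A\<^sup>2 \<le> (\<Sum>M\<in>{1..<N}. (norm (Dx (u M) (x, t)))\<^sup>2) * real (card {1..<N})"
      unfolding A_def by (rule sum_squared_le_sum_of_squares)
    also have "\<dots> \<le> (\<Sum>M\<in>{1..<N}. (norm (Dx (u M) (x, t)))\<^sup>2) * real N"
      by (intro mult_left_mono sum_nonneg) auto
    finally have "Q\<^sup>2 * A\<^sup>2 \<le> Q\<^sup>2 * ((\<Sum>M\<in>{1..<N}. (norm (Dx (u M) (x, t)))\<^sup>2) * real N)"
      by (rule mult_left_mono) simp
    with FA show ?thesis by (simp only: mult.commute[of _ "real N"])
  qed
  have cF: "continuous_on quarter F1"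
  proof -
    have "fps_continuous_on quarter (\<lambda>p. Ux p * U p * fps_cnj (U p) + U p * Ux p * fps_cnj (U p) + U p * U p * fps_cnj (Ux p))"
      by (intro fps_continuous_intros U_continuous)
    then have "continuous_on quarter (\<lambda>p. 2 * of_real lam *
        (Ux p * U p * fps_cnj (U p) + U p * Ux p * fps_cnj (U p) + U p * U p * fps_cnj (Ux p)) $ N)"
      by (intro continuous_intros) (simp only: fps_continuous_on_def)
    moreover have "F1 = (\<lambda>p. 2 * of_real lam *
        (Ux p * U p * fps_cnj (U p) + U p * Ux p * fps_cnj (U p) + U p * U p * fps_cnj (Ux p)) $ N)"
      by (rule ext) (rule F1)
    ultimately show ?thesis by (simp only:)
  qed
  have "integral {1..R} (\<lambda>y. (norm (F1 (y, t)))\<^sup>2) \<le> Q\<^sup>2 * (real N * (\<Sum>M\<in>{1..<N}. C M))"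
    if t: "t0 \<le> t" "t \<le> T" and R: "1 \<le> R" for t R
  proof -
    have tp: "0 < t" using t t0 by auto
    have cD: "continuous_on {1..R} (\<lambda>x. Dx (u M) (x, t))" if "1 \<le> M" for M
      by (rule continuous_on_slice_x[OF has_x_derivD(2)[OF u_derivs(1)[OF that]] tp]) auto
    have "integral {1..R} (\<lambda>y. (norm (F1 (y, t)))\<^sup>2) \<le>
        integral {1..R} (\<lambda>x. Q\<^sup>2 * (real N * (\<Sum>M\<in>{1..<N}. (norm (Dx (u M) (x, t)))\<^sup>2)))"
    proof (rule integral_le)
      show "(\<lambda>y. (norm (F1 (y, t)))\<^sup>2) integrable_on {1..R}"
        by (intro integrable_continuous_real continuous_intros continuous_on_slice_x[OF cF tp]) auto
      show "(\<lambda>x. Q\<^sup>2 * (real N * (\<Sum>M\<in>{1..<N}. (norm (Dx (u M) (x, t)))\<^sup>2))) integrable_on {1..R}"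
        by (intro integrable_continuous_real continuous_intros cD) auto
      show "(norm (F1 (x, t)))\<^sup>2 \<le> Q\<^sup>2 * (real N * (\<Sum>M\<in>{1..<N}. (norm (Dx (u M) (x, t)))\<^sup>2))"
        if "x \<in> {1..R}" for x by (rule pt[OF t]) (use that in auto)
    qed
    also have "\<dots> = Q\<^sup>2 * (real N * (\<Sum>M\<in>{1..<N}. integral {1..R} (\<lambda>x. (norm (Dx (u M) (x, t)))\<^sup>2)))"
    proof -
      have "integral {1..R} (\<lambda>x. \<Sum>M\<in>{1..<N}. (norm (Dx (u M) (x, t)))\<^sup>2) =
          (\<Sum>M\<in>{1..<N}. integral {1..R} (\<lambda>x. (norm (Dx (u M) (x, t)))\<^sup>2))"
        by (rule integral_sum) (auto intro!: integrable_continuous_real continuous_intros cD)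
      then show ?thesis by (simp only: integral_mult_right)
    qed
    also have "\<dots> \<le> Q\<^sup>2 * (real N * (\<Sum>M\<in>{1..<N}. C M))"
      by (intro mult_left_mono sum_mono C) (use t R in auto)
    finally show ?thesis .
  qed
  then show ?thesis by blast
qed

lemma Dx_L2_bound:
  assumes "N \<ge> 1" "0 < t0"
  shows "\<exists>C. \<forall>t R. t0 \<le> t \<longrightarrow> t \<le> T \<longrightarrow> 1 \<le> R \<longrightarrow> integral {1..R} (\<lambda>x. (norm (Dx (u N) (x, t)))\<^sup>2) \<le> C"
  using assms(1)
proof (induction N rule: less_induct)
  case (less N)
  let ?F = "\<lambda>p. 2 * of_real lam * (U p * U p * fps_cnj (U p)) $ N"
  let ?F1 = "\<lambda>p. 2 * of_real lam * (Ux p * U p * fps_cnj (U p) + U p * Ux p * fps_cnj (U p) + U p * U p * fps_cnj (Ux p)) $ N"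
  obtain B where B: "\<And>t R. t0 \<le> t \<Longrightarrow> t \<le> T \<Longrightarrow> 1 \<le> R \<Longrightarrow> integral {1..R} (\<lambda>y. (norm (?F1 (y, t)))\<^sup>2) \<le> B"
    using cubic_deriv_L2_bound[OF less.prems assms(2), of T ?F1] less.IH by blast
  obtain C1 where "0 \<le> C1" and C1: "\<And>t a b. 0 < t \<Longrightarrow> 0 < a \<Longrightarrow> a \<le> b \<Longrightarrow> integral {a..b} (\<lambda>y. norm (u N (y, t))) \<le> C1"
    by (rule L1_henstock[OF less.prems]) (rule that)
  have c: "fps_continuous_on quarter (\<lambda>p. U p * U p * fps_cnj (U p))"
    "fps_continuous_on quarter (\<lambda>p. Ux p * U p * fps_cnj (U p) + U p * Ux p * fps_cnj (U p) + U p * U p * fps_cnj (Ux p))"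
    by (intro fps_continuous_intros U_continuous)+
  have "has_x_deriv ?F ?F1"
    unfolding has_x_deriv_def
  proof (intro conjI allI impI)
    show "continuous_on quarter ?F" "continuous_on quarter ?F1"
      by (intro continuous_intros c[unfolded fps_continuous_on_def, rule_format])+
    fix x t :: real assume xt: "0 < x" "0 < t"
    note D = U_derivs(1)[OF xt]
    have "fps_deriv_at (\<lambda>y. U (y, t) * U (y, t) * fps_cnj (U (y, t)))
        ((Ux (x, t) * U (x, t) + U (x, t) * Ux (x, t)) * fps_cnj (U (x, t)) + U (x, t) * U (x, t) * fps_cnj (Ux (x, t))) x"
      by (intro fps_deriv_at_mult fps_deriv_at_cnj D)
    then have "((\<lambda>y. (U (y, t) * U (y, t) * fps_cnj (U (y, t))) $ N) has_vector_derivative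
      (Ux (x, t) * U (x, t) * fps_cnj (U (x, t)) + U (x, t) * Ux (x, t) * fps_cnj (U (x, t)) + U (x, t) * U (x, t) * fps_cnj (Ux (x, t))) $ N) (at x)"
      unfolding fps_deriv_at_def by (simp add: algebra_simps)
    then show "((\<lambda>y. ?F (y, t)) has_vector_derivative ?F1 (x, t)) (at x)"
      by (intro has_vector_derivative_mult_right)
  qed
  then show ?case
  proof (rule L2_deriv_bound[OF u_derivs[OF less.prems] _ _ assms(2), rotated])
    show "Dt (u N) p = \<i> * Dx (Dx (u N)) p - \<i> * ?F p" if "p \<in> quarter" for p
      by (rule pde_nth[OF that less.prems])
    show "integral {a..b} (\<lambda>y. norm (u N (y, t))) \<le> C1"
      if "t0 \<le> t" "t \<le> T" "0 < a" "a \<le> b" for t a b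
      by (rule C1) (use that assms(2) in auto)
    show "\<exists>K. \<forall>x\<ge>1. norm (Dx (u N) (x, t)) \<le> K / x" if "t0 \<le> t" "t \<le> T" for t
      by (rule Dx_decay[OF less.prems]) (use that assms(2) in auto)
  qed (rule B)
qed

end

section \<open>The decaying solution of the Riccati equation in space\<close>

text \<open>The coefficients of the solution of \<open>f' = -2ikf + w - \<lambda> (cnj w) f\<^sup>2\<close> that tends to \<open>0\<close> at
  infinity.\<close>

context fixes lam :: real and k :: complex begin

function decay_sol :: "(nat \<Rightarrow> real \<Rightarrow> complex) \<Rightarrow> nat \<Rightarrow> real \<Rightarrow> complex" where
  "decay_sol w N x = - (LINT y|lborel. indicator {x..} y *\<^sub>R (exp (2 * \<i> * k * of_real (y - x)) *
     (w N y - of_real lam * (\<Sum>(a, b, c)\<in>triples N. cnj (w a y) * decay_sol w b y * decay_sol w c y))))"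
  by auto
termination by (relation "Wellfounded.measure (\<lambda>(w, N, x). N)") (auto dest: triples_less)

end

declare decay_sol.simps [simp del]

lemma cnj_measurable:
  "f \<in> borel_measurable M \<Longrightarrow> (\<lambda>y. cnj (f y)) \<in> borel_measurable M"
  by (erule measurable_compose) (intro borel_measurable_continuous_onI continuous_intros)

lemma decay_sol_measurable:
  assumes "\<And>a. w a \<in> borel_measurable borel"
  shows "decay_sol lam k w N \<in> borel_measurable borel"
proof (induction N rule: less_induct)
  case (less N)
  have IH: "decay_sol lam k w b \<in> borel_measurable borel" "decay_sol lam k w c \<in> borel_measurable borel"
    if "(a, b, c) \<in> triples N" for a b c
    using less.IH triples_less[OF that] by auto
  define s where "s y = w N y - of_real lam * (\<Sum>(a, b, c)\<in>triples N. cnj (w a y) * decay_sol lam k w b y * decay_sol lam k w c y)" for y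
  have "(\<lambda>y. \<Sum>(a, b, c)\<in>triples N. cnj (w a y) * decay_sol lam k w b y * decay_sol lam k w c y) \<in> borel_measurable borel"
  proof (rule borel_measurable_sum)
    fix z assume z: "z \<in> triples N"
    obtain a b c where [simp]: "z = (a, b, c)" by (cases z)
    have "(\<lambda>y. cnj (w a y) * decay_sol lam k w b y * decay_sol lam k w c y) \<in> borel_measurable borel"
      by (intro borel_measurable_times cnj_measurable assms IH[OF z[simplified]])
    then show "(\<lambda>y. case z of (a, b, c) \<Rightarrow> cnj (w a y) * decay_sol lam k w b y * decay_sol lam k w c y) \<in> borel_measurable borel"
      by simp
  qed
  then have [measurable]: "s \<in> borel_measurable borel"
    unfolding s_def by (intro borel_measurable_diff borel_measurable_times assms borel_measurable_const)
  \<comment> \<open>Measurability in x comes from joint measurability in x and y; for this the lower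
    end point is written as a condition.\<close>
  have "(\<lambda>x. LINT y|lborel. (if x \<le> y then 1 else 0) *\<^sub>R (exp (2 * \<i> * k * of_real (y - x)) * s y)) \<in> borel_measurable borel"
    by (rule lborel.borel_measurable_lebesgue_integral) measurable
  moreover have "decay_sol lam k w N = (\<lambda>x. - (LINT y|lborel. (if x \<le> y then 1 else 0) *\<^sub>R (exp (2 * \<i> * k * of_real (y - x)) * s y)))"
    by (rule ext, subst decay_sol.simps) (simp add: s_def indicator_def of_bool_def)
  ultimately show ?case by (simp only: borel_measurable_uminus)
qed

lemma norm_exp_decay:
  assumes "0 < Im k" "x \<le> y"
  shows "norm (exp (2 * \<i> * k * of_real (y - x))) \<le> 1"
  using assms by (simp add: mult_nonneg_nonneg)

definition riccati_src :: "real \<Rightarrow> complex \<Rightarrow> (nat \<Rightarrow> real \<Rightarrow> complex) \<Rightarrow> nat \<Rightarrow> real \<Rightarrow> complex"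
  where "riccati_src lam k w N y =
    w N y - of_real lam * (\<Sum>(a, b, c)\<in>triples N. cnj (w a y) * decay_sol lam k w b y * decay_sol lam k w c y)"

lemma decay_sol_eq:
  "decay_sol lam k w N x = - (LINT y|lborel. indicator {x..} y *\<^sub>R (exp (2 * \<i> * k * of_real (y - x)) * riccati_src lam k w N y))"
  unfolding riccati_src_def by (rule decay_sol.simps)

lemma riccati_src_measurable:
  assumes "\<And>a. w a \<in> borel_measurable borel"
  shows "riccati_src lam k w N \<in> borel_measurable borel"
proof -
  have "(\<lambda>y. \<Sum>(a, b, c)\<in>triples N. cnj (w a y) * decay_sol lam k w b y * decay_sol lam k w c y) \<in> borel_measurable borel"
    by (rule borel_measurable_sum)
      (auto intro!: borel_measurable_times decay_sol_measurable cnj_measurable assms)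
  then show ?thesis
    unfolding riccati_src_def[abs_def] by (intro borel_measurable_diff borel_measurable_times assms borel_measurable_const)
qed

text \<open>Each cubic term keeps the factor \<open>w a y\<close>, while the two factors of lower
  order are merely bounded. The majorant is thus integrable as soon as the functions W are, without
  any decay of the lower-order solutions.\<close>

lemma riccati_src_bound:
  assumes k: "norm (complex_of_real lam) = 1"
    and w: "\<And>a. 1 \<le> a \<Longrightarrow> norm (w a y) \<le> W a y"
    and N: "1 \<le> N"
    and C: "\<And>b. 1 \<le> b \<Longrightarrow> b < N \<Longrightarrow> norm (decay_sol lam k w b y) \<le> C b"
  shows "norm (riccati_src lam k w N y) \<le> W N y + (\<Sum>(a, b, c)\<in>triples N. W a y * C b * C c)"
proof -
  have "norm (\<Sum>(a, b, c)\<in>triples N. cnj (w a y) * decay_sol lam k w b y * decay_sol lam k w c y)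
      \<le> (\<Sum>(a, b, c)\<in>triples N. W a y * C b * C c)"
  proof (rule order_trans[OF norm_sum sum_mono])
    fix z assume z: "z \<in> triples N"
    obtain a b c where [simp]: "z = (a, b, c)" by (cases z)
    note t = triples_less[OF z[simplified]]
    have W0: "0 \<le> W a y" and C0: "0 \<le> C b"
      using order_trans[OF norm_ge_zero w[OF t(1)]] order_trans[OF norm_ge_zero C[OF t(2,5)]] by auto
    have "norm (w a y) * norm (decay_sol lam k w b y) * norm (decay_sol lam k w c y) \<le> W a y * C b * C c"
      by (intro mult_mono w C t W0 C0 mult_nonneg_nonneg norm_ge_zero)
    then show "norm (case z of (a, b, c) \<Rightarrow> cnj (w a y) * decay_sol lam k w b y * decay_sol lam k w c y)
        \<le> (case z of (a, b, c) \<Rightarrow> W a y * C b * C c)"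
      by (simp add: norm_mult)
  qed
  then show ?thesis
    unfolding riccati_src_def
    by (intro order_trans[OF norm_triangle_ineq4] add_mono w N) (simp add: norm_mult k[simplified])
qed

text \<open>For Im k > 0 the kernel has modulus at most 1 on y >= x, so the L1 bounds B determine
  everything. C is chosen before k and w; this later yields uniformity in k, in t and in the
  cutoff.\<close>

lemma decay_sol_bounded:
  assumes lam: "norm (complex_of_real lam) = 1"
  shows "\<exists>C\<ge>0. \<forall>k w. 0 < Im k \<longrightarrow> (\<forall>a\<ge>1. integrable lborel (w a) \<and> (LINT y|lborel. norm (w a y)) \<le> B a) \<longrightarrow>
    (\<forall>a. w a \<in> borel_measurable borel) \<longrightarrow> N \<ge> 1 \<longrightarrow>
    (\<forall>x. norm (decay_sol lam k w N x) \<le> C)"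
proof (induction N rule: less_induct)
  case (less N)
  from less.IH obtain C where C0: "\<And>b. b < N \<Longrightarrow> 0 \<le> C b" and C: "\<And>b k w x. b < N \<Longrightarrow> 0 < Im k \<Longrightarrow>
      (\<forall>a\<ge>1. integrable lborel (w a) \<and> (LINT y|lborel. norm (w a y)) \<le> B a) \<Longrightarrow>
      (\<forall>a. w a \<in> borel_measurable borel) \<Longrightarrow> b \<ge> 1 \<Longrightarrow> norm (decay_sol lam k w b x) \<le> C b"
    by metis
  define K where "K = \<bar>B N\<bar> + (\<Sum>(a, b, c)\<in>triples N. \<bar>B a\<bar> * C b * C c)"
  have K0: "0 \<le> K" unfolding K_def
    by (intro add_nonneg_nonneg abs_ge_zero sum_nonneg) (auto intro!: mult_nonneg_nonneg C0 dest: triples_less)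
  have "norm (decay_sol lam k w N x) \<le> K"
    if k: "0 < Im k" and w: "\<forall>a\<ge>1. integrable lborel (w a) \<and> (LINT y|lborel. norm (w a y)) \<le> B a"
      and meas: "\<forall>a. w a \<in> borel_measurable borel" and N: "N \<ge> 1" for k w x
  proof -
    let ?D = "\<lambda>y. norm (w N y) + (\<Sum>(a, b, c)\<in>triples N. norm (w a y) * C b * C c)"
    have iw: "integrable lborel (\<lambda>y. norm (w a y))" if "a \<ge> 1" for a
      using w that by (intro Bochner_Integration.integrable_norm) auto
    have iD: "integrable lborel (\<lambda>y. \<Sum>(a, b, c)\<in>triples N. norm (w a y) * C b * C c)"
      by (rule Bochner_Integration.integrable_sum) (auto intro!: Bochner_Integration.integrable_mult_left iw dest: triples_less)
    have ID: "integrable lborel ?D" by (intro Bochner_Integration.integrable_add iw N iD)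
    have "norm (decay_sol lam k w N x) \<le> (LINT y|lborel. ?D y)"
      unfolding decay_sol_eq norm_minus_cancel
    proof (rule order_trans[OF integral_norm_bound integral_mono'])
      show "integrable lborel ?D" by (rule ID)
      fix y
      have "norm (riccati_src lam k w N y) \<le> ?D y"
        by (rule riccati_src_bound[OF lam _ N]) (use C k w meas in auto)
      moreover have "norm (exp (2 * \<i> * k * of_real (y - x)) * riccati_src lam k w N y) \<le> 1 * norm (riccati_src lam k w N y)" if "x \<le> y"
        unfolding norm_mult by (intro mult_right_mono norm_exp_decay[OF k that]) simp
      ultimately show "norm (indicator {x..} y *\<^sub>R (exp (2 * \<i> * k * of_real (y - x)) * riccati_src lam k w N y)) \<le> ?D y"
        using order_trans[OF norm_ge_zero, of "riccati_src lam k w N y" "?D y"]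
        by (cases "x \<le> y") (auto simp del: norm_mult)
      show "0 \<le> ?D y" by (intro add_nonneg_nonneg sum_nonneg norm_ge_zero) (auto intro!: mult_nonneg_nonneg C0 dest: triples_less)
    qed
    also have "\<dots> = (LINT y|lborel. norm (w N y)) + (\<Sum>(a, b, c)\<in>triples N. (LINT y|lborel. norm (w a y)) * C b * C c)"
    proof -
      have "(LINT y|lborel. (\<Sum>(a, b, c)\<in>triples N. norm (w a y) * C b * C c)) =
          (\<Sum>z\<in>triples N. LINT y|lborel. (case z of (a, b, c) \<Rightarrow> norm (w a y) * C b * C c))"
        by (rule Bochner_Integration.integral_sum) (auto intro!: Bochner_Integration.integrable_mult_left iw dest: triples_less)
      also have "\<dots> = (\<Sum>(a, b, c)\<in>triples N. (LINT y|lborel. norm (w a y)) * C b * C c)"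
        by (rule sum.cong) auto
      finally show ?thesis by (subst Bochner_Integration.integral_add[OF iw[OF N] iD]) simp
    qed
    also have "\<dots> \<le> K" unfolding K_def
    proof (intro add_mono sum_mono)
      have le: "(LINT y|lborel. norm (w a y)) \<le> \<bar>B a\<bar>" if "a \<ge> 1" for a using w that by force
      show "(LINT y|lborel. norm (w N y)) \<le> \<bar>B N\<bar>" by (rule le[OF N])
      fix z assume z: "z \<in> triples N"
      obtain a b c where [simp]: "z = (a, b, c)" by (cases z)
      note t = triples_less[OF z[simplified]]
      have "(LINT y|lborel. norm (w a y)) * C b * C c \<le> \<bar>B a\<bar> * C b * C c"
        by (intro mult_right_mono le t C0)
      then show "(case z of (a, b, c) \<Rightarrow> (LINT y|lborel. norm (w a y)) * C b * C c) \<le> (case z of (a, b, c) \<Rightarrow> \<bar>B a\<bar> * C b * C c)"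
        by simp
    qed
    finally show ?thesis .
  qed
  with K0 show ?case by blast
qed

text \<open>Dominated convergence, order by order, in the potential and the left end point together.
  It serves to remove the cutoff R and to let x tend to 0 in one step.\<close>

lemma decay_sol_tendsto:
  assumes lam: "norm (complex_of_real lam) = 1" and k: "0 < Im k" and N: "1 \<le> N"
    and int: "\<And>a. 1 \<le> a \<Longrightarrow> integrable lborel (w a)" and meas: "\<And>a. w a \<in> borel_measurable borel"
    and meas': "\<And>j a. v j a \<in> borel_measurable borel"
    and le: "\<And>j a y. norm (v j a y) \<le> norm (w a y)"
    and lim: "\<And>a y. (\<lambda>j. v j a y) \<longlonglongrightarrow> w a y"
    and x: "\<xi> \<longlonglongrightarrow> x"
  shows "(\<lambda>j. decay_sol lam k (v j) N (\<xi> j)) \<longlonglongrightarrow> decay_sol lam k w N x"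
  using N x
proof (induction N arbitrary: \<xi> x rule: less_induct)
  case (less N)
  note N = \<open>1 \<le> N\<close>
  define B where "B a = (LINT y|lborel. norm (w a y))" for a
  have intv: "integrable lborel (v j a) \<and> (LINT y|lborel. norm (v j a y)) \<le> B a" if "1 \<le> a" for j a
  proof
    show i: "integrable lborel (v j a)"
      by (rule Bochner_Integration.integrable_bound[OF int[OF that]]) (use le meas' in auto)
    show "(LINT y|lborel. norm (v j a y)) \<le> B a"
      unfolding B_def by (rule integral_mono) (use le i int[OF that] in auto)
  qed
  obtain C where C: "\<And>M k w x. 0 < Im k \<Longrightarrow> (\<forall>a\<ge>1. integrable lborel (w a) \<and> (LINT y|lborel. norm (w a y)) \<le> B a) \<Longrightarrow>
    (\<forall>a. w a \<in> borel_measurable borel) \<Longrightarrow> M \<ge> 1 \<Longrightarrow> norm (decay_sol lam k w M x) \<le> C M"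
    using decay_sol_bounded[OF lam, of B] by metis
  have Cv: "norm (decay_sol lam k (v j) M y) \<le> C M" if "M \<ge> 1" for j M y
    by (rule C[OF k]) (use intv meas' that in auto)
  let ?D = "\<lambda>y. norm (w N y) + (\<Sum>(a, b, c)\<in>triples N. norm (w a y) * C b * C c)"
  have ID: "integrable lborel ?D"
    by (intro Bochner_Integration.integrable_add Bochner_Integration.integrable_norm int N Bochner_Integration.integrable_sum)
      (auto intro!: Bochner_Integration.integrable_mult_left Bochner_Integration.integrable_norm int dest: triples_less)
  have src: "(\<lambda>j. riccati_src lam k (v j) N y) \<longlonglongrightarrow> riccati_src lam k w N y" for y
    unfolding riccati_src_def
  proof (intro tendsto_intros lim tendsto_sum)
    fix z assume z: "z \<in> triples N"
    obtain a b c where [simp]: "z = (a, b, c)" by (cases z)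
    note t = triples_less[OF z[simplified]]
    have "(\<lambda>j. cnj (v j a y) * decay_sol lam k (v j) b y * decay_sol lam k (v j) c y) \<longlonglongrightarrow>
       cnj (w a y) * decay_sol lam k w b y * decay_sol lam k w c y"
      by (intro tendsto_intros lim less.IH t)
    then show "(\<lambda>j. case z of (a, b, c) \<Rightarrow> cnj (v j a y) * decay_sol lam k (v j) b y * decay_sol lam k (v j) c y) \<longlonglongrightarrow>
      (case z of (a, b, c) \<Rightarrow> cnj (w a y) * decay_sol lam k w b y * decay_sol lam k w c y)" by simp
  qed
  have bound: "norm (riccati_src lam k (v j) N y) \<le> ?D y" for j y
    by (rule riccati_src_bound[OF lam _ N]) (use le Cv in auto)
  show ?case
    unfolding decay_sol_eq
  proof (intro tendsto_minus integral_dominated_convergence[where w = ?D])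
    show "(\<lambda>y. indicator {x..} y *\<^sub>R (exp (2 * \<i> * k * of_real (y - x)) * riccati_src lam k w N y)) \<in> borel_measurable lborel"
      using riccati_src_measurable[OF meas, where k = k and N = N] by measurable
    show "(\<lambda>y. indicator {\<xi> j..} y *\<^sub>R (exp (2 * \<i> * k * of_real (y - \<xi> j)) * riccati_src lam k (v j) N y)) \<in> borel_measurable lborel" for j
      using riccati_src_measurable[OF meas', where k = k and N = N] by measurable
    show "integrable lborel ?D" by (rule ID)
    show "AE y in lborel. norm (indicator {\<xi> j..} y *\<^sub>R (exp (2 * \<i> * k * of_real (y - \<xi> j)) * riccati_src lam k (v j) N y)) \<le> ?D y" for j
    proof (rule AE_I2)
      fix y
      have "norm (exp (2 * \<i> * k * of_real (y - \<xi> j)) * riccati_src lam k (v j) N y) \<le> 1 * norm (riccati_src lam k (v j) N y)" if "\<xi> j \<le> y"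
        unfolding norm_mult by (intro mult_right_mono norm_exp_decay[OF k that]) simp
      then show "norm (indicator {\<xi> j..} y *\<^sub>R (exp (2 * \<i> * k * of_real (y - \<xi> j)) * riccati_src lam k (v j) N y)) \<le> ?D y"
        using bound[of j y] order_trans[OF norm_ge_zero bound[of j y]]
        by (cases "\<xi> j \<le> y") (auto simp del: norm_mult)
    qed
    show "AE y in lborel. (\<lambda>j. indicator {\<xi> j..} y *\<^sub>R (exp (2 * \<i> * k * of_real (y - \<xi> j)) * riccati_src lam k (v j) N y))
      \<longlonglongrightarrow> indicator {x..} y *\<^sub>R (exp (2 * \<i> * k * of_real (y - x)) * riccati_src lam k w N y)"
    \<comment> \<open>At y = x the indicators need not converge; a single point is
      negligible.\<close>
    proof (rule AE_mp[OF AE_lborel_singleton[of x]], rule AE_I2, rule impI)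
      fix y assume "y \<noteq> x"
      have "(\<lambda>j. indicator {\<xi> j..} y) \<longlonglongrightarrow> (indicator {x..} y :: real)"
      proof (rule tendsto_eventually)
        consider "y < x" | "x < y" using \<open>y \<noteq> x\<close> by linarith
        then show "\<forall>\<^sub>F j in sequentially. indicator {\<xi> j..} y = (indicator {x..} y :: real)"
        proof cases
          case 1
          then show ?thesis using order_tendstoD(1)[OF \<open>\<xi> \<longlonglongrightarrow> x\<close> 1] by (auto elim!: eventually_mono)
        next
          case 2
          then show ?thesis using order_tendstoD(2)[OF \<open>\<xi> \<longlonglongrightarrow> x\<close> 2] by (auto elim!: eventually_mono)
        qed
      qed
      then show "(\<lambda>j. indicator {\<xi> j..} y *\<^sub>R (exp (2 * \<i> * k * of_real (y - \<xi> j)) * riccati_src lam k (v j) N y))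
        \<longlonglongrightarrow> indicator {x..} y *\<^sub>R (exp (2 * \<i> * k * of_real (y - x)) * riccati_src lam k w N y)"
        by (intro tendsto_intros src \<open>\<xi> \<longlonglongrightarrow> x\<close>)
    qed
  qed
qed

section \<open>The Lax pair\<close>

lemma has_t_deriv_diff:
  "has_t_deriv f f' \<Longrightarrow> has_t_deriv g g' \<Longrightarrow> has_t_deriv (\<lambda>p. f p - g p) (\<lambda>p. f' p - g' p)"
  unfolding has_t_deriv_def by (simp add: continuous_on_diff has_vector_derivative_diff)

lemma has_t_deriv_mult:
  assumes "has_t_deriv f f'" "has_t_deriv g g'"
  shows "has_t_deriv (\<lambda>p. f p * g p) (\<lambda>p. f p * g' p + f' p * g p)"
  using assms unfolding has_t_deriv_def
  by (auto intro!: continuous_intros has_vector_derivative_mult)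

lemma has_t_deriv_cmult:
  "has_t_deriv f f' \<Longrightarrow> has_t_deriv (\<lambda>p. c * f p) (\<lambda>p. c * f' p)"
  unfolding has_t_deriv_def by (auto intro!: continuous_intros has_vector_derivative_mult_right)

lemma has_t_deriv_cnj:
  "has_t_deriv f f' \<Longrightarrow> has_t_deriv (\<lambda>p. cnj (f p)) (\<lambda>p. cnj (f' p))"
  unfolding has_t_deriv_def by (auto intro!: continuous_intros has_vector_derivative_cnj)

lemma has_t_deriv_sum:
  assumes "finite A" "\<And>a. a \<in> A \<Longrightarrow> has_t_deriv (f a) (f' a)"
  shows "has_t_deriv (\<lambda>p. \<Sum>a\<in>A. f a p) (\<lambda>p. \<Sum>a\<in>A. f' a p)"
  using assms unfolding has_t_deriv_def
  by (auto intro!: continuous_intros has_vector_derivative_sum)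

lemma has_t_deriv_Dt:
  assumes "has_t_deriv f g"
  shows "has_t_deriv f (Dt f)" "\<And>p. p \<in> quarter \<Longrightarrow> Dt f p = g p"
proof -
  show eq: "Dt f p = g p" if p: "p \<in> quarter" for p
    unfolding Dt_def
    by (rule vector_derivative_at, cases p) (use p has_t_derivD(3)[OF assms, of "fst p" "snd p" UNIV] in \<open>auto simp: quarter_iff\<close>)
  show "has_t_deriv f (Dt f)"
    by (rule has_t_deriv_cong[OF assms]) (simp_all add: eq)
qed

text \<open>Duhamel's formula for the solution of f_x = -2ikf + H that vanishes at x = R.\<close>

definition expint :: "complex \<Rightarrow> real \<Rightarrow> (real \<times> real \<Rightarrow> complex) \<Rightarrow> real \<times> real \<Rightarrow> complex"
  where "expint k R H p = - exp (- (2 * \<i> * k * of_real (fst p))) * prim R (\<lambda>q. exp (2 * \<i> * k * of_real (fst q)) * H q) p"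

lemma has_x_deriv_expint:
  assumes H: "continuous_on quarter H" and R: "0 < R"
  shows "has_x_deriv (expint k R H) (\<lambda>p. - (2 * \<i> * k) * expint k R H p + H p)"
proof -
  have c: "continuous_on quarter (\<lambda>q. exp (2 * \<i> * k * of_real (fst q)) * H q)"
    by (intro continuous_intros H)
  note D = has_x_deriv_prim[OF c R]
  have ce: "continuous_on quarter (expint k R H)"
    unfolding expint_def[abs_def] by (intro continuous_intros has_x_derivD(1)[OF D])
  show ?thesis
    unfolding has_x_deriv_def
  proof (intro conjI allI impI)
    show "continuous_on quarter (\<lambda>p. - (2 * \<i> * k) * expint k R H p + H p)"
      by (intro continuous_intros ce H)
    fix x t :: real assume xt: "0 < x" "0 < t"
    have e: "((\<lambda>y. exp (- (2 * \<i> * k * of_real y))) has_vector_derivative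
        - (2 * \<i> * k) * exp (- (2 * \<i> * k * of_real x))) (at x)"
      by (rule has_vector_derivative_real_field) (auto intro!: derivative_eq_intros)
    have ee: "exp (- (2 * \<i> * k * of_real x)) * exp (2 * \<i> * k * of_real x) = 1"
      by (simp add: exp_minus)
    have A: "((\<lambda>y. - (exp (- (2 * \<i> * k * of_real y)) * prim R (\<lambda>q. exp (2 * \<i> * k * of_real (fst q)) * H q) (y, t)))
      has_vector_derivative - (exp (- (2 * \<i> * k * of_real x)) * - (exp (2 * \<i> * k * of_real (fst (x, t))) * H (x, t)) +
       - (2 * \<i> * k) * exp (- (2 * \<i> * k * of_real x)) * prim R (\<lambda>q. exp (2 * \<i> * k * of_real (fst q)) * H q) (x, t))) (at x)"
      by (intro has_vector_derivative_minus has_vector_derivative_mult e has_x_derivD(3)[OF D xt])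
    have B: "- (exp (- (2 * \<i> * k * of_real x)) * - (exp (2 * \<i> * k * of_real (fst (x, t))) * H (x, t)) +
       - (2 * \<i> * k) * exp (- (2 * \<i> * k * of_real x)) * prim R (\<lambda>q. exp (2 * \<i> * k * of_real (fst q)) * H q) (x, t))
      = - (2 * \<i> * k) * expint k R H (x, t) + H (x, t)"
      unfolding expint_def fst_conv using ee by algebra
    have "(\<lambda>y. expint k R H (y, t)) = (\<lambda>y. - (exp (- (2 * \<i> * k * of_real y)) * prim R (\<lambda>q. exp (2 * \<i> * k * of_real (fst q)) * H q) (y, t)))"
      by (simp add: expint_def)
    then show "((\<lambda>y. expint k R H (y, t)) has_vector_derivative - (2 * \<i> * k) * expint k R H (x, t) + H (x, t)) (at x)"
      using A[unfolded B] by (simp only:)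
  qed (rule ce)
qed

lemma has_t_deriv_expint:
  assumes "has_t_deriv H H'" "0 < R"
  shows "has_t_deriv (expint k R H) (expint k R H')"
proof -
  have ex: "has_t_deriv (\<lambda>q. exp (c * of_real (fst q))) (\<lambda>q. 0)" for c
    unfolding has_t_deriv_def by (auto intro!: continuous_intros)
  have "has_t_deriv (\<lambda>q. exp (2 * \<i> * k * of_real (fst q)) * H q) (\<lambda>q. exp (2 * \<i> * k * of_real (fst q)) * H' q)"
    using has_t_deriv_mult[OF ex[of "2 * \<i> * k"] assms(1)] by simp
  from has_t_deriv_prim[OF this assms(2)]
  have "has_t_deriv (\<lambda>p. exp (- (2 * \<i> * k) * of_real (fst p)) * prim R (\<lambda>q. exp (2 * \<i> * k * of_real (fst q)) * H q) p)
     (\<lambda>p. exp (- (2 * \<i> * k) * of_real (fst p)) * prim R (\<lambda>q. exp (2 * \<i> * k * of_real (fst q)) * H' q) p)"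
    using has_t_deriv_mult[OF ex[of "- (2 * \<i> * k)"]] by simp
  from has_t_deriv_cmult[OF this, of "- 1"] show ?thesis
    unfolding expint_def[abs_def] by simp
qed

lemma expint_at [simp]: "expint k R H (R, t) = 0"
  by (simp add: expint_def)

lemma fps_cnj_mult: "fps_cnj (A * B) = fps_cnj A * fps_cnj B"
  by (rule fps_ext) (simp add: fps_mult_nth)

lemma fps_cnj_diff: "fps_cnj (A - B) = fps_cnj A - fps_cnj B"
  by (rule fps_ext) simp

lemma fps_cnj_const: "fps_cnj (fps_const c) = fps_const (cnj c)"
  by (rule fps_ext) (simp add: fps_const_def)

lemma fps_cnj_cnj [simp]: "fps_cnj (fps_cnj A) = A"
  by (rule fps_ext) simp

text \<open>The right-hand side of the Riccati equation in time, apart from the term \<open>-4ik\<^sup>2f\<close>.\<close>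

definition riccati_rhs :: "real \<Rightarrow> complex \<Rightarrow> complex fps \<Rightarrow> complex fps \<Rightarrow> complex fps \<Rightarrow> complex fps"
  where "riccati_rhs lam k g h f =
      fps_const (- 2 * of_real lam * k) * (fps_cnj g * f * f)
    + fps_const (of_real lam * \<i>) * (fps_cnj h * f * f)
    - fps_const (2 * \<i> * of_real lam) * (fps_cnj g * g * f)
    + fps_const (2 * k) * g + fps_const \<i> * h"

text \<open>The compatibility of the two Riccati equations as an identity in a ring: u and its
  conjugate c count as independent, and j, K, L stand for i, k and \<lambda>. The left side is the
  x-derivative of \<open>ft - T\<close>, with that of \<open>ft\<close> taken from the equation in x
  differentiated in t. Substituting everything leaves a multiple of j * j + 1.\<close>

lemma zero_curvature_identity:
  fixes j K L u c ux cx uxx cxx ut ct f fx ft :: "'a::idom"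
  assumes "j * j = -1"
    and "ut = j * uxx - 2 * j * L * u * u * c"
    and "ct = - (j * cxx) + 2 * j * L * c * c * u"
    and "fx = - 2 * j * K * f + u - L * c * f * f"
    and "T = - 2 * L * K * (c * f * f) + L * j * (cx * f * f) - 2 * j * L * (c * u * f) + 2 * K * u + j * ux - 4 * j * K * K * f"
    and "Tx = - 2 * L * K * (cx * f * f + 2 * c * f * fx) + L * j * (cxx * f * f + 2 * cx * f * fx)
        - 2 * j * L * (cx * u * f + c * ux * f + c * u * fx) + 2 * K * ux + j * uxx - 4 * j * K * K * fx"
  shows "- 2 * j * K * ft + ut - L * (ct * f * f + 2 * c * f * ft) - Tx = (- 2 * j * K - 2 * L * c * f) * (ft - T)"
proof -
  have "(- 2 * j * K * ft + ut - L * (ct * f * f + 2 * c * f * ft) - Tx) - (- 2 * j * K - 2 * L * c * f) * (ft - T)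
      = (j * j + 1) * (2 * K * L * cx * f * f - 2 * K * ux)"
    unfolding assms(2-6) by algebra
  then show ?thesis using assms(1) by simp
qed

context nls_perturbation
begin

lemma Ut_eq:
  assumes "p \<in> quarter"
  shows "Ut p = fps_const \<i> * Uxx p - 2 * fps_const \<i> * fps_const (of_real lam) * U p * U p * fps_cnj (U p)"
proof (rule fps_ext)
  fix N
  have eq: "2 * fps_const \<i> * fps_const (of_real lam) * U p * U p * fps_cnj (U p) =
      fps_const (\<i> * (2 * of_real lam)) * (U p * U p * fps_cnj (U p))"
    by (simp add: numeral_fps_const mult_ac)
  show "Ut p $ N = (fps_const \<i> * Uxx p - 2 * fps_const \<i> * fps_const (of_real lam) * U p * U p * fps_cnj (U p)) $ N"
    unfolding eq using pde_nth[OF assms, of N]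
    by (cases "N = 0") (simp_all add: U_nth)
qed

text \<open>Coefficients of the solution with zero data at R. The integral runs over the compact
  interval between x and R, so differentiating under it in t needs no decay in x; this is the
  purpose of the cutoff.\<close>

function trunc :: "complex \<Rightarrow> real \<Rightarrow> nat \<Rightarrow> real \<times> real \<Rightarrow> complex" where
  "trunc k R N p = expint k R (\<lambda>q. U q $ N - of_real lam *
     (\<Sum>(a, b, c)\<in>triples N. cnj (U q $ a) * trunc k R b q * trunc k R c q)) p"
  by auto
termination by (relation "Wellfounded.measure (\<lambda>(k, R, N, p). N)") (auto dest: triples_less)

declare trunc.simps [simp del]

definition F where "F k R p = eps_series (\<lambda>N. trunc k R N p)"

lemma F_nth: "F k R p $ N = trunc k R N p"
proof (cases "N = 0")
  case True
  have "triples 0 = {}" by (auto simp: triples_def)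
  then have "trunc k R 0 p = 0" by (subst trunc.simps) (simp add: U_nth expint_def prim_def)
  with True show ?thesis by (simp add: F_def eps_series_nth)
qed (simp add: F_def eps_series_nth)

lemma F_nth_0 [simp]: "F k R p $ 0 = 0"
  by (simp add: F_def eps_series_nth)

definition src where "src k R q = U q - fps_const (of_real lam) * (fps_cnj (U q) * F k R q * F k R q)"

lemma src_nth: "src k R q $ N = U q $ N - of_real lam *
     (\<Sum>(a, b, c)\<in>triples N. cnj (U q $ a) * trunc k R b q * trunc k R c q)"
  unfolding src_def
  using fps_triple_mult_nth[of "fps_cnj (U q)" "F k R q" "F k R q" N, OF _ F_nth_0 F_nth_0]
  by (simp add: U_nth(2) F_nth)

lemma trunc_eq: "trunc k R N = expint k R (\<lambda>q. src k R q $ N)"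
  by (rule ext) (simp only: src_nth trunc.simps[of k R N])

lemma trunc_has_t_deriv:
  assumes R: "0 < R"
  shows "has_t_deriv (trunc k R N) (Dt (trunc k R N))"
proof (induction N rule: less_induct)
  case (less N)
  have "has_t_deriv (\<lambda>q. \<Sum>(a, b, c)\<in>triples N. cnj (U q $ a) * trunc k R b q * trunc k R c q)
    (\<lambda>q. \<Sum>z\<in>triples N. case z of (a, b, c) \<Rightarrow> cnj (U q $ a) * trunc k R b q * Dt (trunc k R c) q
       + (cnj (U q $ a) * Dt (trunc k R b) q + cnj (Ut q $ a) * trunc k R b q) * trunc k R c q)"
  proof (rule has_t_deriv_sum[OF finite_triples])
    fix z assume z: "z \<in> triples N"
    obtain a b c where [simp]: "z = (a, b, c)" by (cases z)
    note t = triples_less[OF z[simplified]]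
    have "has_t_deriv (\<lambda>q. U q $ a) (\<lambda>q. Ut q $ a)"
      using u_derivs(3)[OF t(1)] t(1) by (simp add: U_nth)
    then show "has_t_deriv (\<lambda>q. case z of (a, b, c) \<Rightarrow> cnj (U q $ a) * trunc k R b q * trunc k R c q)
       (\<lambda>q. case z of (a, b, c) \<Rightarrow> cnj (U q $ a) * trunc k R b q * Dt (trunc k R c) q
       + (cnj (U q $ a) * Dt (trunc k R b) q + cnj (Ut q $ a) * trunc k R b q) * trunc k R c q)"
      using t by (auto intro!: has_t_deriv_mult has_t_deriv_cnj less.IH)
  qed
  moreover have "has_t_deriv (\<lambda>q. U q $ N) (\<lambda>q. Ut q $ N)"
  proof (cases "N = 0")
    case True
    then show ?thesis by (simp add: U_nth has_t_deriv_def)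
  next
    case False
    then have "1 \<le> N" by simp
    from u_derivs(3)[OF this] show ?thesis unfolding U_nth(1,7)[OF \<open>1 \<le> N\<close>] .
  qed
  ultimately have "\<exists>G. has_t_deriv (\<lambda>q. src k R q $ N) G"
    unfolding src_nth using has_t_deriv_diff[OF _ has_t_deriv_cmult[where c = "of_real lam"]] by blast
  then obtain G where "has_t_deriv (\<lambda>q. src k R q $ N) G" ..
  from has_t_deriv_expint[OF this R, of k] show ?case
    unfolding trunc_eq by (rule has_t_deriv_Dt(1))
qed

lemma F_continuous: "0 < R \<Longrightarrow> fps_continuous_on quarter (F k R)"
  using has_t_derivD(1)[OF trunc_has_t_deriv] by (simp add: fps_continuous_on_def F_nth)

definition Ft where "Ft k R p = Abs_fps (\<lambda>N. Dt (trunc k R N) p)"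

lemma Ft_continuous: "0 < R \<Longrightarrow> fps_continuous_on quarter (Ft k R)"
  using has_t_derivD(2)[OF trunc_has_t_deriv] by (simp add: fps_continuous_on_def Ft_def)

lemma F_t_deriv:
  assumes "0 < R" "0 < x" "0 < t"
  shows "fps_deriv_at (\<lambda>s. F k R (x, s)) (Ft k R (x, t)) t"
  using has_t_derivD(3)[OF trunc_has_t_deriv[OF assms(1)] assms(2,3), where A = UNIV]
  by (simp add: fps_deriv_at_def F_nth Ft_def)

lemma src_continuous: "0 < R \<Longrightarrow> fps_continuous_on quarter (src k R)"
  unfolding src_def[abs_def] by (intro fps_continuous_intros U_continuous F_continuous)

lemma F_x_deriv:
  assumes "0 < R" "0 < x" "0 < t"
  shows "fps_deriv_at (\<lambda>y. F k R (y, t)) (fps_const (- (2 * \<i> * k)) * F k R (x, t) + src k R (x, t)) x"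
  unfolding fps_deriv_at_def
proof
  fix N
  have "continuous_on quarter (\<lambda>q. src k R q $ N)"
    using src_continuous[OF assms(1)] by (simp add: fps_continuous_on_def)
  from has_x_derivD(3)[OF has_x_deriv_expint[OF this assms(1)] assms(2,3), of k UNIV]
  show "((\<lambda>y. F k R (y, t) $ N) has_vector_derivative (fps_const (- (2 * \<i> * k)) * F k R (x, t) + src k R (x, t)) $ N) (at x)"
    by (simp add: F_nth trunc_eq[symmetric])
qed

definition srct where "srct k R q = Ut q - fps_const (of_real lam) *
  (fps_cnj (Ut q) * F k R q * F k R q + fps_cnj (U q) * Ft k R q * F k R q + fps_cnj (U q) * F k R q * Ft k R q)"

lemma srct_continuous: "0 < R \<Longrightarrow> fps_continuous_on quarter (srct k R)"
  unfolding srct_def[abs_def] by (intro fps_continuous_intros U_continuous F_continuous Ft_continuous)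

text \<open>The t-derivative of a Duhamel integral is the Duhamel integral of the t-derivative. So
  \<open>Ft\<close> is differentiable in x although no mixed derivative of \<open>trunc\<close> has
  been established beforehand.\<close>

lemma Ft_x_deriv:
  assumes R: "0 < R" and xt: "0 < x" "0 < t"
  shows "fps_deriv_at (\<lambda>y. Ft k R (y, t)) (fps_const (- (2 * \<i> * k)) * Ft k R (x, t) + srct k R (x, t)) x"
  unfolding fps_deriv_at_def
proof
  fix N
  have "has_t_deriv (\<lambda>q. src k R q $ N) (\<lambda>q. srct k R q $ N)"
    unfolding has_t_deriv_def
  proof (intro conjI allI impI)
    fix x t :: real assume xt: "0 < x" "0 < t"
    have D: "fps_deriv_at (\<lambda>s. src k R (x, s)) (Ut (x, t) - fps_const (of_real lam) *
      ((fps_cnj (Ut (x, t)) * F k R (x, t) + fps_cnj (U (x, t)) * Ft k R (x, t)) * F k R (x, t)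
        + fps_cnj (U (x, t)) * F k R (x, t) * Ft k R (x, t))) t"
      unfolding src_def
      by (intro fps_deriv_at_diff fps_deriv_at_cmult fps_deriv_at_mult fps_deriv_at_cnj U_derivs(3) F_t_deriv R xt)
    have "Ut (x, t) - fps_const (of_real lam) *
      ((fps_cnj (Ut (x, t)) * F k R (x, t) + fps_cnj (U (x, t)) * Ft k R (x, t)) * F k R (x, t)
        + fps_cnj (U (x, t)) * F k R (x, t) * Ft k R (x, t)) = srct k R (x, t)"
      unfolding srct_def by (simp only: distrib_right)
    with D show "((\<lambda>s. src k R (x, s) $ N) has_vector_derivative srct k R (x, t) $ N) (at t)"
      unfolding fps_deriv_at_def by (simp only:)
  qed (use src_continuous[OF R] srct_continuous[OF R] in \<open>simp_all only: fps_continuous_on_def\<close>)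
  note ht = has_t_deriv_expint[OF this R, of k]
  have cs: "continuous_on quarter (\<lambda>q. srct k R q $ N)"
    using srct_continuous[OF R] by (simp add: fps_continuous_on_def)
  have eq: "Ft k R p $ N = expint k R (\<lambda>q. srct k R q $ N) p" if "p \<in> quarter" for p
    using has_t_deriv_Dt(2)[OF ht that] by (simp add: Ft_def trunc_eq)
  have val: "(fps_const (- (2 * \<i> * k)) * Ft k R (x, t) + srct k R (x, t)) $ N
     = - (2 * \<i> * k) * expint k R (\<lambda>q. srct k R q $ N) (x, t) + srct k R (x, t) $ N"
    by (simp only: fps_add_nth fps_mult_left_const_nth eq[of "(x, t)", unfolded quarter_iff, OF conjI[OF xt]])
  show "((\<lambda>y. Ft k R (y, t) $ N) has_vector_derivative
      (fps_const (- (2 * \<i> * k)) * Ft k R (x, t) + srct k R (x, t)) $ N) (at x)"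
    unfolding val
  proof (rule has_vector_derivative_transform_within_open[OF has_x_derivD(3)[OF has_x_deriv_expint[OF cs R] xt]])
    show "open {0::real<..}" "x \<in> {0<..}" using xt by simp_all
    show "expint k R (\<lambda>q. srct k R q $ N) (y, t) = Ft k R (y, t) $ N" if "y \<in> {0<..}" for y
      using that xt by (intro eq[symmetric]) (simp add: quarter_iff)
  qed
qed

definition T where "T k R p = riccati_rhs lam k (U p) (Ux p) (F k R p) - fps_const (4 * \<i> * k\<^sup>2) * F k R p"

definition P where "P k R p = Ft k R p - T k R p"

lemma T_continuous: "0 < R \<Longrightarrow> fps_continuous_on quarter (T k R)"
  unfolding T_def[abs_def] riccati_rhs_def by (intro fps_continuous_intros U_continuous F_continuous)

lemma P_continuous: "0 < R \<Longrightarrow> fps_continuous_on quarter (P k R)"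
  unfolding P_def[abs_def] by (intro fps_continuous_intros T_continuous Ft_continuous)

text \<open>The zero-curvature property of the Lax pair: the defect \<open>P\<close> of the equation in time
  satisfies a linear homogeneous equation in space.\<close>

lemma P_x_deriv:
  assumes R: "0 < R" and xt: "0 < x" "0 < t"
  shows "fps_deriv_at (\<lambda>y. P k R (y, t))
    (fps_const (- (2 * \<i> * k)) * P k R (x, t) - fps_const (2 * of_real lam) * (fps_cnj (U (x, t)) * F k R (x, t) * P k R (x, t))) x"
proof -
  let ?p = "(x, t)"
  let ?j = "fps_const \<i>" and ?K = "fps_const k" and ?L = "fps_const (complex_of_real lam)"
  define f where "f = F k R ?p"
  define fx where "fx = fps_const (- (2 * \<i> * k)) * F k R ?p + src k R ?p"
  define u' where "u' = U ?p"
  define c where "c = fps_cnj (U ?p)"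
  define Tx where "Tx = (fps_const (- 2 * of_real lam * k) * ((fps_cnj (Ux ?p) * f + c * fx) * f + c * f * fx)
    + fps_const (of_real lam * \<i>) * ((fps_cnj (Uxx ?p) * f + fps_cnj (Ux ?p) * fx) * f + fps_cnj (Ux ?p) * f * fx)
    - fps_const (2 * \<i> * of_real lam) * ((fps_cnj (Ux ?p) * u' + c * Ux ?p) * f + c * u' * fx)
    + fps_const (2 * k) * Ux ?p + fps_const \<i> * Uxx ?p) - fps_const (4 * \<i> * k\<^sup>2) * fx"
  have dT: "fps_deriv_at (\<lambda>y. T k R (y, t)) Tx x"
    unfolding T_def riccati_rhs_def Tx_def f_def c_def u'_def fx_def
    by (intro fps_deriv_at_diff fps_deriv_at_add fps_deriv_at_cmult fps_deriv_at_mult fps_deriv_at_cnj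
        U_derivs F_x_deriv R xt)
  have q: "?p \<in> quarter" using xt by (simp add: quarter_iff)

  \<comment> \<open>Constants are split into products of \<open>?j\<close>, \<open>?K\<close> and
    \<open>?L\<close>, so that the ring identity applies with these in place of i, k and
    \<lambda>.\<close>
  have coeffs_eq: "fps_const (- 2 * of_real lam * k) = - 2 * ?L * ?K" "fps_const (of_real lam * \<i>) = ?L * ?j"
    "fps_const (2 * \<i> * of_real lam) = 2 * ?j * ?L" "fps_const (2 * k) = 2 * ?K"
    "fps_const (4 * \<i> * k\<^sup>2) = 4 * ?j * ?K * ?K" "fps_const (- (2 * \<i> * k)) = - 2 * ?j * ?K"
    "fps_const (2 * of_real lam) = 2 * ?L"
    by (simp_all add: numeral_fps_const power2_eq_square mult_ac)
  have ident: "- 2 * ?j * ?K * Ft k R ?p + Ut ?p - ?L * (fps_cnj (Ut ?p) * f * f + 2 * c * f * Ft k R ?p) - Tx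
      = (- 2 * ?j * ?K - 2 * ?L * c * f) * (Ft k R ?p - T k R ?p)"
  proof (rule zero_curvature_identity[where uxx = "Uxx ?p" and ux = "Ux ?p" and cx = "fps_cnj (Ux ?p)"
        and cxx = "fps_cnj (Uxx ?p)" and u = u' and fx = fx])
    show "?j * ?j = - 1" by (simp add: fps_const_neg[symmetric] del: fps_const_neg)
    show "Ut ?p = ?j * Uxx ?p - 2 * ?j * ?L * u' * u' * c"
      unfolding u'_def c_def by (rule Ut_eq[OF q])
    have n2: "fps_cnj 2 = 2" and ci: "fps_cnj ?j = - ?j" and cl: "fps_cnj ?L = ?L"
      by (simp_all add: numeral_fps_const fps_cnj_const)
    show "fps_cnj (Ut ?p) = - (?j * fps_cnj (Uxx ?p)) + 2 * ?j * ?L * c * c * u'"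
      unfolding u'_def c_def Ut_eq[OF q] fps_cnj_diff fps_cnj_mult ci cl n2 fps_cnj_cnj by algebra
    show "fx = - 2 * ?j * ?K * f + u' - ?L * c * f * f"
      unfolding fx_def src_def f_def u'_def c_def coeffs_eq by algebra
    show "T k R ?p = - 2 * ?L * ?K * (c * f * f) + ?L * ?j * (fps_cnj (Ux ?p) * f * f) - 2 * ?j * ?L * (c * u' * f)
        + 2 * ?K * u' + ?j * Ux ?p - 4 * ?j * ?K * ?K * f"
      unfolding T_def riccati_rhs_def coeffs_eq f_def u'_def c_def ..
    show "Tx = - 2 * ?L * ?K * (fps_cnj (Ux ?p) * f * f + 2 * c * f * fx) + ?L * ?j * (fps_cnj (Uxx ?p) * f * f + 2 * fps_cnj (Ux ?p) * f * fx)
        - 2 * ?j * ?L * (fps_cnj (Ux ?p) * u' * f + c * Ux ?p * f + c * u' * fx) + 2 * ?K * Ux ?p + ?j * Uxx ?p - 4 * ?j * ?K * ?K * fx"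
      unfolding Tx_def coeffs_eq by algebra
  qed
  have "fps_deriv_at (\<lambda>y. P k R (y, t)) (fps_const (- (2 * \<i> * k)) * Ft k R ?p + srct k R ?p - Tx) x"
    unfolding P_def by (intro fps_deriv_at_diff Ft_x_deriv dT R xt)
  also have "fps_const (- (2 * \<i> * k)) * Ft k R ?p + srct k R ?p - Tx =
      - 2 * ?j * ?K * Ft k R ?p + Ut ?p - ?L * (fps_cnj (Ut ?p) * f * f + 2 * c * f * Ft k R ?p) - Tx"
    unfolding srct_def coeffs_eq f_def c_def by algebra
  also have "\<dots> = fps_const (- (2 * \<i> * k)) * P k R ?p - fps_const (2 * of_real lam) * (fps_cnj (U ?p) * F k R ?p * P k R ?p)"
    unfolding ident unfolding P_def coeffs_eq f_def c_def by algebra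
  finally show ?thesis .
qed

end

section \<open>Continuous extensions; boundedness and limits of coefficients\<close>

text \<open>The open quarter plane is dense in the closed one, so the limit that defines
  \<open>ext\<close> exists at every point and equals the value of any continuous extension.\<close>

lemma ext_continuous:
  assumes "extends_continuously v"
  shows "continuous_on closed_quarter (ext v)" "\<And>p. p \<in> quarter \<Longrightarrow> ext v p = v p"
proof -
  obtain G where G: "continuous_on closed_quarter G" "\<And>p. p \<in> quarter \<Longrightarrow> G p = v p"
    using assms unfolding extends_continuously_def by blast
  have sub: "quarter \<subseteq> closed_quarter" by (auto simp: quarter_def closed_quarter_def)
  have cl: "closure quarter = closed_quarter"
    unfolding quarter_def closed_quarter_def closure_Times by simp
  have eq: "ext v p = G p" if p: "p \<in> closed_quarter" for p
  proof -
    have "(G \<longlongrightarrow> G p) (at p within closed_quarter)" using G(1) p unfolding continuous_on_def by blast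
    then have "(G \<longlongrightarrow> G p) (at p within quarter)" by (rule tendsto_within_subset[OF _ sub])
    then have "(v \<longlongrightarrow> G p) (at p within quarter)"
      by (rule Lim_transform_eventually) (auto simp: eventually_at_filter G(2))
    moreover have "\<not> trivial_limit (at p within quarter)"
    proof (cases "p \<in> quarter")
      case True
      show ?thesis unfolding at_within_open[OF True open_quarter] by (rule trivial_limit_at)
    next
      case False
      then have "p islimpt quarter" using p unfolding cl[symmetric] closure_def by blast
      then show ?thesis by (simp add: trivial_limit_within)
    qed
    ultimately show ?thesis unfolding ext_def by (rule tendsto_Lim[rotated])
  qed
  show "continuous_on closed_quarter (ext v)"
    using G(1) by (simp add: eq cong: continuous_on_cong)
  show "ext v p = v p" if "p \<in> quarter" for p
    using eq[of p] G(2)[OF that] sub that by auto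
qed

definition fps_bounded_on :: "'a set \<Rightarrow> ('a \<Rightarrow> complex fps) \<Rightarrow> bool"
  where "fps_bounded_on S A \<longleftrightarrow> (\<forall>N. \<exists>K. \<forall>s\<in>S. norm (A s $ N) \<le> K)"

lemma fps_bounded_on_const: "fps_bounded_on S (\<lambda>s. c)"
  by (auto simp: fps_bounded_on_def)

lemma fps_bounded_on_add:
  assumes "fps_bounded_on S A" "fps_bounded_on S B"
  shows "fps_bounded_on S (\<lambda>s. A s + B s)"
  unfolding fps_bounded_on_def
proof
  fix N
  obtain K L where "\<forall>s\<in>S. norm (A s $ N) \<le> K" "\<forall>s\<in>S. norm (B s $ N) \<le> L"
    using assms unfolding fps_bounded_on_def by blast
  then have "\<forall>s\<in>S. norm ((A s + B s) $ N) \<le> K + L"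
    by (auto intro!: order_trans[OF norm_triangle_ineq] add_mono)
  then show "\<exists>K. \<forall>s\<in>S. norm ((A s + B s) $ N) \<le> K" ..
qed

lemma fps_bounded_on_mult:
  assumes "fps_bounded_on S A" "fps_bounded_on S B"
  shows "fps_bounded_on S (\<lambda>s. A s * B s)"
  unfolding fps_bounded_on_def
proof
  fix N
  obtain K L where KL: "\<And>M s. s \<in> S \<Longrightarrow> norm (A s $ M) \<le> K M" "\<And>M s. s \<in> S \<Longrightarrow> norm (B s $ M) \<le> L M"
    using assms unfolding fps_bounded_on_def by metis
  have "norm ((A s * B s) $ N) \<le> (\<Sum>i=0..N. \<bar>K i\<bar> * \<bar>L (N - i)\<bar>)" if s: "s \<in> S" for s
    unfolding fps_mult_nth
  proof (rule order_trans[OF norm_sum sum_mono])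
    fix i
    show "norm (A s $ i * B s $ (N - i)) \<le> \<bar>K i\<bar> * \<bar>L (N - i)\<bar>"
      unfolding norm_mult
      by (intro mult_mono order_trans[OF KL(1)[OF s] abs_ge_self] order_trans[OF KL(2)[OF s] abs_ge_self]) auto
  qed
  then show "\<exists>K. \<forall>s\<in>S. norm ((A s * B s) $ N) \<le> K" by blast
qed

lemma fps_bounded_on_cnj: "fps_bounded_on S A \<Longrightarrow> fps_bounded_on S (\<lambda>s. fps_cnj (A s))"
  by (simp add: fps_bounded_on_def)

lemma fps_bounded_on_diff:
  assumes "fps_bounded_on S A" "fps_bounded_on S B"
  shows "fps_bounded_on S (\<lambda>s. A s - B s)"
  using fps_bounded_on_add[OF assms(1) fps_bounded_on_mult[OF fps_bounded_on_const[of S "- 1"] assms(2)]]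
  by simp

lemmas fps_bounded_intros = fps_bounded_on_const fps_bounded_on_add fps_bounded_on_diff
  fps_bounded_on_mult fps_bounded_on_cnj

lemma fps_bounded_on_riccati_rhs:
  "fps_bounded_on S g \<Longrightarrow> fps_bounded_on S h \<Longrightarrow> fps_bounded_on S f \<Longrightarrow>
    fps_bounded_on S (\<lambda>s. riccati_rhs lam k (g s) (h s) (f s) - fps_const c * f s)"
  unfolding riccati_rhs_def by (intro fps_bounded_intros)

definition fps_tendsto :: "('a \<Rightarrow> complex fps) \<Rightarrow> complex fps \<Rightarrow> 'a filter \<Rightarrow> bool"
  where "fps_tendsto f l \<F> \<longleftrightarrow> (\<forall>N. ((\<lambda>s. f s $ N) \<longlongrightarrow> l $ N) \<F>)"

lemma fps_tendsto_const: "fps_tendsto (\<lambda>s. c) c \<F>"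
  by (simp add: fps_tendsto_def)

lemma fps_tendsto_add: "fps_tendsto f a \<F> \<Longrightarrow> fps_tendsto g b \<F> \<Longrightarrow> fps_tendsto (\<lambda>s. f s + g s) (a + b) \<F>"
  by (auto simp: fps_tendsto_def intro!: tendsto_intros)

lemma fps_tendsto_diff: "fps_tendsto f a \<F> \<Longrightarrow> fps_tendsto g b \<F> \<Longrightarrow> fps_tendsto (\<lambda>s. f s - g s) (a - b) \<F>"
  by (auto simp: fps_tendsto_def intro!: tendsto_intros)

lemma fps_tendsto_mult: "fps_tendsto f a \<F> \<Longrightarrow> fps_tendsto g b \<F> \<Longrightarrow> fps_tendsto (\<lambda>s. f s * g s) (a * b) \<F>"
  by (auto simp: fps_tendsto_def fps_mult_nth intro!: tendsto_intros)

lemma fps_tendsto_cnj: "fps_tendsto f a \<F> \<Longrightarrow> fps_tendsto (\<lambda>s. fps_cnj (f s)) (fps_cnj a) \<F>"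
  by (auto simp: fps_tendsto_def intro!: tendsto_intros)

lemmas fps_tendsto_intros = fps_tendsto_const fps_tendsto_add fps_tendsto_diff fps_tendsto_mult fps_tendsto_cnj

lemma fps_tendsto_riccati_rhs:
  "fps_tendsto g g' \<F> \<Longrightarrow> fps_tendsto h h' \<F> \<Longrightarrow> fps_tendsto f f' \<F> \<Longrightarrow>
    fps_tendsto (\<lambda>s. riccati_rhs lam k (g s) (h s) (f s) - fps_const c * f s) (riccati_rhs lam k g' h' f' - fps_const c * f') \<F>"
  unfolding riccati_rhs_def by (intro fps_tendsto_intros)

lemma fps_continuous_on_riccati_rhs:
  "fps_continuous_on S g \<Longrightarrow> fps_continuous_on S h \<Longrightarrow> fps_continuous_on S f \<Longrightarrow>
    fps_continuous_on S (\<lambda>s. riccati_rhs lam k (g s) (h s) (f s) - fps_const c * f s)"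
  unfolding riccati_rhs_def by (intro fps_continuous_intros)

context nls_perturbation
begin

text \<open>Taking A = \<open>{0<..R}\<close> gives the cut-off solution and A =
  \<open>{0<..}\<close> the decaying one, so both share one bound and one continuity
  statement.\<close>

definition profile :: "real set \<Rightarrow> real \<Rightarrow> nat \<Rightarrow> real \<Rightarrow> complex"
  where "profile A t a y = indicator A y *\<^sub>R U (y, t) $ a"

lemma profile_measurable:
  assumes "A \<subseteq> {0<..}" "A \<in> sets borel" "0 < t"
  shows "profile A t a \<in> borel_measurable borel"
  unfolding profile_def[abs_def]
proof (rule borel_measurable_continuous_on_indicator[OF assms(2)])
  have "continuous_on quarter (\<lambda>p. U p $ a)" using U_continuous(1) by (simp add: fps_continuous_on_def)
  then show "continuous_on A (\<lambda>y. U (y, t) $ a)" by (rule continuous_on_slice_x[OF _ assms(3,1)])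
qed

lemma profile_L1:
  obtains B where "\<And>A t a. A \<subseteq> {0<..} \<Longrightarrow> A \<in> sets borel \<Longrightarrow> 0 < t \<Longrightarrow> 1 \<le> a \<Longrightarrow>
    integrable lborel (profile A t a) \<and> (LINT y|lborel. norm (profile A t a y)) \<le> B a"
proof -
  have "\<exists>B. \<forall>A t. A \<subseteq> {0<..} \<longrightarrow> A \<in> sets borel \<longrightarrow> 0 < t \<longrightarrow>
    integrable lborel (profile A t a) \<and> (LINT y|lborel. norm (profile A t a y)) \<le> B" if a: "1 \<le> a" for a
  proof -
    obtain C where C: "C \<ge> 0"
      "\<And>t. 0 < t \<Longrightarrow> integrable lborel (\<lambda>y. indicator {0<..} y *\<^sub>R u a (y, t))"
      "\<And>t. 0 < t \<Longrightarrow> (LINT y|lborel. norm (indicator {0<..} y *\<^sub>R u a (y, t))) \<le> C"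
      by (rule L1_lebesgue[OF a]) (rule that)
    have "integrable lborel (profile A t a) \<and> (LINT y|lborel. norm (profile A t a y)) \<le> C"
      if A: "A \<subseteq> {0<..}" "A \<in> sets borel" and t: "0 < t" for A t
    proof
      have le: "norm (profile A t a y) \<le> norm (indicator {0<..} y *\<^sub>R u a (y, t))" for y
        using A(1) a by (auto simp: profile_def U_nth indicator_def)
      show i: "integrable lborel (profile A t a)"
        by (rule Bochner_Integration.integrable_bound[OF C(2)[OF t]]) (use le profile_measurable[OF A t] in auto)
      have "(LINT y|lborel. norm (profile A t a y)) \<le> (LINT y|lborel. norm (indicator {0<..} y *\<^sub>R u a (y, t)))"
        by (intro integral_mono Bochner_Integration.integrable_norm i C(2) t le)
      also have "\<dots> \<le> C" by (rule C(3)[OF t])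
      finally show "(LINT y|lborel. norm (profile A t a y)) \<le> C" .
    qed
    then show ?thesis by blast
  qed
  then obtain B where "\<And>a A t. 1 \<le> a \<Longrightarrow> A \<subseteq> {0<..} \<Longrightarrow> A \<in> sets borel \<Longrightarrow> 0 < t \<Longrightarrow>
    integrable lborel (profile A t a) \<and> (LINT y|lborel. norm (profile A t a y)) \<le> B a" by metis
  with that show ?thesis by blast
qed

text \<open>One constant per order for every cutoff set, every time and every k with Im k > 0; the
  later uniformity in t and k descends from here.\<close>

lemma decay_sol_profile_bound:
  obtains C where "\<And>N. 0 \<le> C N" "\<And>k A t N x. 0 < Im k \<Longrightarrow> A \<subseteq> {0<..} \<Longrightarrow> A \<in> sets borel \<Longrightarrow> 0 < t \<Longrightarrow> 1 \<le> N \<Longrightarrow>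
    norm (decay_sol lam k (profile A t) N x) \<le> C N"
proof -
  obtain B where B: "\<And>A t a. A \<subseteq> {0<..} \<Longrightarrow> A \<in> sets borel \<Longrightarrow> 0 < t \<Longrightarrow> 1 \<le> a \<Longrightarrow>
    integrable lborel (profile A t a) \<and> (LINT y|lborel. norm (profile A t a y)) \<le> B a"
    by (rule profile_L1) (rule that)
  have "\<forall>N. \<exists>C\<ge>0. \<forall>k w. 0 < Im k \<longrightarrow> (\<forall>a\<ge>1. integrable lborel (w a) \<and> (LINT y|lborel. norm (w a y)) \<le> B a) \<longrightarrow>
    (\<forall>a. w a \<in> borel_measurable borel) \<longrightarrow> N \<ge> 1 \<longrightarrow> (\<forall>x. norm (decay_sol lam k w N x) \<le> C)"
    using decay_sol_bounded[OF norm_lam] by blast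
  then obtain C where "\<And>N. 0 \<le> C N" and C: "\<And>N k w x. 0 < Im k \<Longrightarrow> (\<forall>a\<ge>1. integrable lborel (w a) \<and> (LINT y|lborel. norm (w a y)) \<le> B a) \<Longrightarrow>
    (\<forall>a. w a \<in> borel_measurable borel) \<Longrightarrow> N \<ge> 1 \<Longrightarrow> norm (decay_sol lam k w N x) \<le> C N"
    by metis
  moreover have "norm (decay_sol lam k (profile A t) N x) \<le> C N"
    if "0 < Im k" "A \<subseteq> {0<..}" "A \<in> sets borel" "0 < t" "1 \<le> N" for k A t N x
    by (rule C) (use that B profile_measurable in auto)
  ultimately show ?thesis using that by blast
qed

text \<open>Below R, solving from zero data at R is the same as solving from infinity with the
  potential set to zero beyond R. The bounds and limits of \<open>decay_sol\<close> thereby apply to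
  \<open>F\<close>.\<close>

lemma trunc_eq_decay_sol:
  assumes R: "0 < R" and x: "0 < x" "x \<le> R" and t: "0 < t"
  shows "trunc k R N (x, t) = decay_sol lam k (profile {0<..R} t) N x"
  using x
proof (induction N arbitrary: x rule: less_induct)
  case (less N)
  let ?w = "profile {0<..R} t"
  have srceq: "riccati_src lam k ?w N y = src k R (y, t) $ N" if "0 < y" "y \<le> R" for y
  proof -
    have "(\<Sum>(a, b, c)\<in>triples N. cnj (?w a y) * decay_sol lam k ?w b y * decay_sol lam k ?w c y)
      = (\<Sum>(a, b, c)\<in>triples N. cnj (U (y, t) $ a) * trunc k R b (y, t) * trunc k R c (y, t))"
    proof (rule sum.cong[OF refl])
      fix z assume z: "z \<in> triples N"
      obtain a b c where [simp]: "z = (a, b, c)" by (cases z)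
      note tr = triples_less[OF z[simplified]]
      have "?w a y = U (y, t) $ a" using that by (simp add: profile_def)
      then show "(case z of (a, b, c) \<Rightarrow> cnj (?w a y) * decay_sol lam k ?w b y * decay_sol lam k ?w c y)
        = (case z of (a, b, c) \<Rightarrow> cnj (U (y, t) $ a) * trunc k R b (y, t) * trunc k R c (y, t))"
        by (simp only: prod.case less.IH[OF tr(5) that] less.IH[OF tr(6) that] \<open>z = (a, b, c)\<close>)
    qed
    moreover have "?w N y = U (y, t) $ N" using that by (simp add: profile_def)
    ultimately show ?thesis unfolding riccati_src_def src_nth by (simp only:)
  qed
  \<comment> \<open>Every cubic term contains a factor \<open>?w a y\<close>, which vanishes beyond
    R whatever the lower-order solutions are.\<close>
  have src0: "riccati_src lam k ?w N y = 0" if "R < y" for y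
  proof -
    have "?w a y = 0" for a using that by (simp add: profile_def)
    then show ?thesis unfolding riccati_src_def by (simp only:) (simp add: case_prod_unfold)
  qed
  have csrc: "continuous_on quarter (\<lambda>q. src k R q $ N)"
    using src_continuous[OF R] by (simp add: fps_continuous_on_def)
  let ?h = "\<lambda>y. exp (2 * \<i> * k * of_real (y - x)) * src k R (y, t) $ N"
  have ch: "continuous_on {x..R} ?h"
    by (intro continuous_intros continuous_on_slice_x[OF csrc t]) (use less.prems in auto)
  have "decay_sol lam k ?w N x = - (LINT y|lborel. indicator {x..R} y *\<^sub>R ?h y)"
    unfolding decay_sol_eq
    by (intro arg_cong[where f = uminus] Bochner_Integration.integral_cong refl)
      (use less.prems srceq src0 in \<open>auto simp: indicator_def\<close>)
  also have "(LINT y|lborel. indicator {x..R} y *\<^sub>R ?h y) = integral {x..R} ?h"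
    using set_borel_integral_eq_integral(2)[OF borel_integrable_atLeastAtMost'[OF ch]]
    by (simp add: set_lebesgue_integral_def)
  also have "?h = (\<lambda>y. exp (- (2 * \<i> * k * of_real x)) * (exp (2 * \<i> * k * of_real y) * src k R (y, t) $ N))"
    by (rule ext) (simp add: exp_diff exp_minus field_simps)
  also have "integral {x..R} \<dots> = exp (- (2 * \<i> * k * of_real x)) * integral {x..R} (\<lambda>y. exp (2 * \<i> * k * of_real y) * src k R (y, t) $ N)"
    by (rule integral_mult_right)
  also have "integral {x..R} (\<lambda>y. exp (2 * \<i> * k * of_real y) * src k R (y, t) $ N) =
      prim R (\<lambda>q. exp (2 * \<i> * k * of_real (fst q)) * src k R q $ N) (x, t)"
    by (subst prim_eq_integral) (use less.prems t in \<open>auto intro!: continuous_intros csrc\<close>)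
  finally show ?case by (simp add: trunc_eq expint_def)
qed

lemma L1_bounds:
  obtains B where "\<And>M t a b. 1 \<le> M \<Longrightarrow> 0 < t \<Longrightarrow> 0 < a \<Longrightarrow> a \<le> b \<Longrightarrow> integral {a..b} (\<lambda>y. norm (u M (y, t))) \<le> B M"
proof -
  have "\<forall>M. \<exists>B. 1 \<le> M \<longrightarrow> (\<forall>t a b. 0 < t \<longrightarrow> 0 < a \<longrightarrow> a \<le> b \<longrightarrow> integral {a..b} (\<lambda>y. norm (u M (y, t))) \<le> B)"
  proof
    fix M
    show "\<exists>B. 1 \<le> M \<longrightarrow> (\<forall>t a b. 0 < t \<longrightarrow> 0 < a \<longrightarrow> a \<le> b \<longrightarrow> integral {a..b} (\<lambda>y. norm (u M (y, t))) \<le> B)"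
    proof (cases "1 \<le> M")
      case True
      obtain C where "C \<ge> 0" "\<And>t a b. 0 < t \<Longrightarrow> 0 < a \<Longrightarrow> a \<le> b \<Longrightarrow> integral {a..b} (\<lambda>y. norm (u M (y, t))) \<le> C"
        by (rule L1_henstock[OF True]) (rule that)
      then show ?thesis by blast
    qed simp
  qed
  from choice[OF this] show ?thesis using that by blast
qed

text \<open>At \<open>x = R\<close> the defect is \<open>-(2ku + iu\<^sub>x)\<close>; the factor \<open>exp (2ik(R - x))\<close> makes it small.\<close>

lemma P_bound:
  assumes k: "0 < Im k"
  shows "\<exists>K\<ge>0. \<forall>R x t. 0 < x \<longrightarrow> x \<le> R \<longrightarrow> 0 < t \<longrightarrow> norm (P k R (x, t) $ N) \<le>
    K * exp (2 * Im k * (x - R)) * (\<Sum>M\<in>{1..N}. norm (u M (R, t)) + norm (Dx (u M) (R, t)))"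
proof (induction N rule: less_induct)
  case (less N)
  let ?A = "\<lambda>N R t. \<Sum>M\<in>{1..N}. norm (u M (R, t)) + norm (Dx (u M) (R, t))"
  obtain K where K0: "\<And>M. M < N \<Longrightarrow> 0 \<le> K M" and K: "\<And>M R x t. M < N \<Longrightarrow> 0 < x \<Longrightarrow> x \<le> R \<Longrightarrow> 0 < t \<Longrightarrow>
      norm (P k R (x, t) $ M) \<le> K M * exp (2 * Im k * (x - R)) * ?A M R t"
  proof -
    have "\<forall>M. \<exists>K. M < N \<longrightarrow> 0 \<le> K \<and> (\<forall>R x t. 0 < x \<longrightarrow> x \<le> R \<longrightarrow> 0 < t \<longrightarrow> norm (P k R (x, t) $ M) \<le>
      K * exp (2 * Im k * (x - R)) * ?A M R t)"
      using less.IH by blast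
    from choice[OF this] show ?thesis using that by blast
  qed
  obtain B where B: "\<And>M t a b. 1 \<le> M \<Longrightarrow> 0 < t \<Longrightarrow> 0 < a \<Longrightarrow> a \<le> b \<Longrightarrow> integral {a..b} (\<lambda>y. norm (u M (y, t))) \<le> B M"
    by (rule L1_bounds) (rule that)
  obtain C where C0: "\<And>N. 0 \<le> C N" and C: "\<And>k A t N x. 0 < Im k \<Longrightarrow> A \<subseteq> {0<..} \<Longrightarrow> A \<in> sets borel \<Longrightarrow> 0 < t \<Longrightarrow> 1 \<le> N \<Longrightarrow>
    norm (decay_sol lam k (profile A t) N x) \<le> C N" by (rule decay_sol_profile_bound) (rule that)
  \<comment> \<open>The first summand stems from the defect at R, the second from the coupling to
    lower orders, integrated against the L1 norms.\<close>
  define Q where "Q = (2 * norm k + 1) + 2 * (\<Sum>(a, b, c)\<in>triples N. \<bar>B a\<bar> * C b * K c)"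
  have Q0: "0 \<le> Q"
    unfolding Q_def by (intro add_nonneg_nonneg mult_nonneg_nonneg sum_nonneg)
      (auto intro!: mult_nonneg_nonneg C0 K0 dest: triples_less)
  have "norm (P k R (x, t) $ N) \<le> Q * exp (2 * Im k * (x - R)) * ?A N R t"
    if x: "0 < x" "x \<le> R" and t: "0 < t" for R x t
  proof -
    have R: "0 < R" using x by simp
    \<comment> \<open>The integrating factor that removes the linear term of the equation for
      \<open>P\<close>; what remains couples order N to lower orders only.\<close>
    define e where "e y = exp (2 * \<i> * k * of_real y)" for y :: real
    have ne: "norm (e y) = exp (- (2 * Im k * y))" for y by (simp add: e_def)
    let ?G = "\<lambda>y. (fps_cnj (U (y, t)) * F k R (y, t) * P k R (y, t)) $ N"
    have A0: "0 \<le> ?A N R t" by (intro sum_nonneg add_nonneg_nonneg norm_ge_zero)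
    have dE: "((\<lambda>y. e y * P k R (y, t) $ N) has_vector_derivative - (2 * of_real lam) * (e y * ?G y)) (at y within {x..R})"
      if y: "y \<in> {x..R}" for y
    proof -
      have yp: "0 < y" using y x by auto
      have e': "(e has_vector_derivative (2 * \<i> * k) * e y) (at y)"
        unfolding e_def by (rule has_vector_derivative_real_field) (auto intro!: derivative_eq_intros)
      have "((\<lambda>y. P k R (y, t) $ N) has_vector_derivative
         - (2 * \<i> * k) * P k R (y, t) $ N - 2 * of_real lam * ?G y) (at y)"
        using P_x_deriv[OF R yp t, of k] unfolding fps_deriv_at_def by simp
      from has_vector_derivative_mult[OF e' this]
      have "((\<lambda>y. e y * P k R (y, t) $ N) has_vector_derivative - (2 * of_real lam) * (e y * ?G y)) (at y)"
        by (simp add: algebra_simps)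
      then show ?thesis by (rule has_vector_derivative_at_within)
    qed
    have hi: "((\<lambda>y. - (2 * of_real lam) * (e y * ?G y)) has_integral e R * P k R (R, t) $ N - e x * P k R (x, t) $ N) {x..R}"
      by (rule fundamental_theorem_of_calculus[OF x(2) dE])
    have PR: "P k R (R, t) $ N = - (2 * k * U (R, t) $ N + \<i> * Ux (R, t) $ N)"
    proof -
      have F0: "F k R (R, t) = 0" by (rule fps_ext) (simp add: F_nth trunc_eq)
      have "trunc k R M (R, s) = 0" for M s by (simp add: trunc_eq)
      then have "Ft k R (R, t) = 0" by (intro fps_ext) (simp add: Ft_def Dt_def)
      then show ?thesis unfolding P_def T_def riccati_rhs_def F0 by simp
    qed
    have bR: "norm (e R * P k R (R, t) $ N) \<le> exp (- (2 * Im k * R)) * ((2 * norm k + 1) * ?A N R t)"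
    proof -
      have "norm (P k R (R, t) $ N) \<le> 2 * norm k * norm (U (R, t) $ N) + norm (Ux (R, t) $ N)"
        unfolding PR norm_minus_cancel by (rule order_trans[OF norm_triangle_ineq]) (simp add: norm_mult)
      also have "\<dots> \<le> (2 * norm k + 1) * (norm (U (R, t) $ N) + norm (Ux (R, t) $ N))"
        by (simp add: algebra_simps)
      also have "\<dots> \<le> (2 * norm k + 1) * ?A N R t"
      proof (rule mult_left_mono)
        show "norm (U (R, t) $ N) + norm (Ux (R, t) $ N) \<le> ?A N R t"
        proof (cases "N = 0")
          case False
          then show ?thesis
            using member_le_sum[of N "{1..N}" "\<lambda>M. norm (u M (R, t)) + norm (Dx (u M) (R, t))"] by (simp add: U_nth)
        qed (simp add: U_nth)
      qed simp
      finally show ?thesis by (simp add: norm_mult ne)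
    qed
    let ?W = "\<lambda>y. exp (- (2 * Im k * R)) * ?A N R t * (\<Sum>(a, b, c)\<in>triples N. norm (u a (y, t)) * C b * K c)"
    have cu: "continuous_on {x..R} (\<lambda>y. u a (y, t))" if "1 \<le> a" for a
      by (rule continuous_on_slice_x[OF has_x_derivD(1)[OF u_derivs(1)[OF that]] t]) (use x in auto)
    have cW: "continuous_on {x..R} ?W"
      by (intro continuous_intros) (auto intro!: continuous_intros cu dest: triples_less)
    have bI: "norm (integral {x..R} (\<lambda>y. - (2 * of_real lam) * (e y * ?G y))) \<le> integral {x..R} (\<lambda>y. 2 * ?W y)"
    proof (rule integral_norm_bound_integral)
      show "(\<lambda>y. - (2 * of_real lam) * (e y * ?G y)) integrable_on {x..R}"
        using hi by (rule has_integral_integrable)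
      show "(\<lambda>y. 2 * ?W y) integrable_on {x..R}"
        by (intro integrable_continuous_real continuous_intros cW)
      fix y assume y: "y \<in> {x..R}"
      then have yp: "0 < y" "y \<le> R" using x by auto
      have P0: "P k R (y, t) $ 0 = 0"
      proof -
        have "trunc k R 0 p = 0" for p using F_nth[of k R p 0] by simp
        then have "Ft k R (y, t) $ 0 = 0" by (simp add: Ft_def Dt_def)
        then show ?thesis unfolding P_def T_def riccati_rhs_def by (simp add: U_nth)
      qed
      have "norm (e y * ?G y) \<le> ?W y"
      proof -
        have "norm (?G y) \<le> (\<Sum>(a, b, c)\<in>triples N. norm (u a (y, t)) * C b * (K c * exp (2 * Im k * (y - R)) * ?A N R t))"
          unfolding fps_triple_mult_nth[of "fps_cnj (U (y, t))" "F k R (y, t)" "P k R (y, t)", OF _ F_nth_0 P0, simplified, OF U_nth(2)]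
        proof (rule order_trans[OF norm_sum sum_mono])
          fix z assume z: "z \<in> triples N"
          obtain a b c where [simp]: "z = (a, b, c)" by (cases z)
          note tr = triples_less[OF z[simplified]]
          have "norm (F k R (y, t) $ b) \<le> C b"
            unfolding F_nth trunc_eq_decay_sol[OF R yp t] by (rule C[OF k _ _ t tr(2)]) auto
          moreover have "norm (P k R (y, t) $ c) \<le> K c * exp (2 * Im k * (y - R)) * ?A N R t"
          proof -
            have "norm (P k R (y, t) $ c) \<le> K c * exp (2 * Im k * (y - R)) * ?A c R t"
              by (rule K[OF tr(6) yp t])
            also have "\<dots> \<le> K c * exp (2 * Im k * (y - R)) * ?A N R t"
              by (intro mult_left_mono sum_mono2 mult_nonneg_nonneg K0 tr) (use tr in auto)
            finally show ?thesis .
          qed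
          ultimately have "norm (u a (y, t)) * norm (F k R (y, t) $ b) * norm (P k R (y, t) $ c) \<le>
            norm (u a (y, t)) * C b * (K c * exp (2 * Im k * (y - R)) * ?A N R t)"
            by (intro mult_mono order_refl mult_nonneg_nonneg C0 norm_ge_zero)
          then show "norm (case z of (p, q, r) \<Rightarrow> cnj (U (y, t) $ p) * F k R (y, t) $ q * P k R (y, t) $ r) \<le>
            (case z of (a, b, c) \<Rightarrow> norm (u a (y, t)) * C b * (K c * exp (2 * Im k * (y - R)) * ?A N R t))"
            using tr(1) by (simp add: norm_mult U_nth)
        qed
        then have "norm (e y * ?G y) \<le> exp (- (2 * Im k * y)) * (\<Sum>(a, b, c)\<in>triples N. norm (u a (y, t)) * C b * (K c * exp (2 * Im k * (y - R)) * ?A N R t))"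
          by (simp add: norm_mult ne)
        also have "\<dots> = (exp (- (2 * Im k * y)) * exp (2 * Im k * (y - R))) * ?A N R t * (\<Sum>(a, b, c)\<in>triples N. norm (u a (y, t)) * C b * K c)"
        proof -
          have "e0 * (\<Sum>(a, b, c)\<in>triples N. f a * C b * (K c * e1 * X)) = (e0 * e1) * X * (\<Sum>(a, b, c)\<in>triples N. f a * C b * K c)"
            for e0 e1 X :: real and f by (subst (1 2) sum_distrib_left) (auto intro!: sum.cong simp: mult_ac)
          then show ?thesis .
        qed
        \<comment> \<open>The y-dependence of the integrating factor cancels that of the inductive
          bound, which leaves an integrand dominated by the functions \<open>u a\<close> in
          L1.\<close>
        also have "exp (- (2 * Im k * y)) * exp (2 * Im k * (y - R)) = exp (- (2 * Im k * R))"
          by (simp add: exp_add[symmetric] algebra_simps)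
        finally show ?thesis .
      qed
      then show "norm (- (2 * of_real lam) * (e y * ?G y)) \<le> 2 * ?W y"
      proof -
        have "norm (- (2 * complex_of_real lam) * z) = 2 * norm z" for z
          unfolding norm_mult[of "- (2 * complex_of_real lam)"] norm_minus_cancel norm_mult[of 2] norm_lam by simp
        with \<open>norm (e y * ?G y) \<le> ?W y\<close> show ?thesis by (simp only: mult_le_cancel_left_pos zero_less_numeral)
      qed
    qed
    have W2: "integral {x..R} (\<lambda>y. 2 * ?W y) \<le> exp (- (2 * Im k * R)) * ((2 * (\<Sum>(a, b, c)\<in>triples N. \<bar>B a\<bar> * C b * K c)) * ?A N R t)"
    proof -
      have "integral {x..R} (\<lambda>y. \<Sum>(a, b, c)\<in>triples N. norm (u a (y, t)) * C b * K c) =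
          (\<Sum>z\<in>triples N. integral {x..R} (\<lambda>y. case z of (a, b, c) \<Rightarrow> norm (u a (y, t)) * C b * K c))"
        by (rule integral_sum) (auto intro!: integrable_continuous_real continuous_intros cu dest: triples_less)
      also have "\<dots> \<le> (\<Sum>(a, b, c)\<in>triples N. \<bar>B a\<bar> * C b * K c)"
      proof (rule sum_mono)
        fix z assume z: "z \<in> triples N"
        obtain a b c where [simp]: "z = (a, b, c)" by (cases z)
        note tr = triples_less[OF z[simplified]]
        have "integral {x..R} (\<lambda>y. norm (u a (y, t))) * C b * K c \<le> \<bar>B a\<bar> * C b * K c"
          by (intro mult_right_mono C0 K0 tr order_trans[OF B abs_ge_self] t x)
        then show "integral {x..R} (\<lambda>y. case z of (a, b, c) \<Rightarrow> norm (u a (y, t)) * C b * K c) \<le> (case z of (a, b, c) \<Rightarrow> \<bar>B a\<bar> * C b * K c)"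
          by simp
      qed
      finally have "2 * (exp (- (2 * Im k * R)) * ?A N R t) * integral {x..R} (\<lambda>y. \<Sum>(a, b, c)\<in>triples N. norm (u a (y, t)) * C b * K c)
         \<le> 2 * (exp (- (2 * Im k * R)) * ?A N R t) * (\<Sum>(a, b, c)\<in>triples N. \<bar>B a\<bar> * C b * K c)"
        by (rule mult_left_mono) (use A0 in auto)
      then show ?thesis by (simp add: mult_ac)
    qed
    have "norm (e x * P k R (x, t) $ N) \<le> norm (e R * P k R (R, t) $ N) + norm (e R * P k R (R, t) $ N - e x * P k R (x, t) $ N)"
      using norm_triangle_ineq4[of "e R * P k R (R, t) $ N" "e R * P k R (R, t) $ N - e x * P k R (x, t) $ N"] by simp
    from order_trans[OF this add_mono[OF bR order_trans[OF bI[unfolded integral_unique[OF hi]] W2]]]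
    have "norm (e x * P k R (x, t) $ N) \<le> exp (- (2 * Im k * R)) * ((2 * norm k + 1) * ?A N R t) +
        exp (- (2 * Im k * R)) * ((2 * (\<Sum>(a, b, c)\<in>triples N. \<bar>B a\<bar> * C b * K c)) * ?A N R t)"
      .
    also have "\<dots> = exp (- (2 * Im k * R)) * Q * ?A N R t"
      by (simp add: Q_def algebra_simps)
    finally have "exp (2 * Im k * x) * (exp (- (2 * Im k * x)) * norm (P k R (x, t) $ N)) \<le> exp (2 * Im k * x) * (exp (- (2 * Im k * R)) * Q * ?A N R t)"
      unfolding norm_mult ne by (rule mult_left_mono) simp
    then show ?thesis
      unfolding mult.assoc[symmetric] exp_add[symmetric] by (simp add: algebra_simps)
  qed
  with Q0 show ?case by blast
qed

text \<open>The integral over \<open>[j + 1, j + 2] \<times> [t\<^sub>1, t\<^sub>2]\<close> is bounded independently of \<open>j\<close>, so some \<open>R\<close> does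
  not exceed the average.\<close>

lemma select_truncation:
  assumes t: "0 < t1" "t1 \<le> t2"
  obtains C where "\<And>j::nat. \<exists>R. real j + 1 \<le> R \<and> R \<le> real j + 2 \<and>
    integral {t1..t2} (\<lambda>t. \<Sum>M\<in>{1..N}. norm (u M (R, t)) + norm (Dx (u M) (R, t))) \<le> C"
proof -
  \<comment> \<open>The derivative enters through 1 + |u_x|^2, which dominates |u_x| and whose
    integral over a unit interval is controlled by the L2 bound.\<close>
  let ?q = "\<lambda>R t. \<Sum>M\<in>{1..N}. norm (u M (R, t)) + (1 + (norm (Dx (u M) (R, t)))\<^sup>2)"
  obtain B where B: "\<And>M t a b. 1 \<le> M \<Longrightarrow> 0 < t \<Longrightarrow> 0 < a \<Longrightarrow> a \<le> b \<Longrightarrow> integral {a..b} (\<lambda>y. norm (u M (y, t))) \<le> B M"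
    by (rule L1_bounds) (rule that)
  have "\<forall>M. \<exists>D. 1 \<le> M \<longrightarrow> (\<forall>t R. t1 \<le> t \<longrightarrow> t \<le> t2 \<longrightarrow> 1 \<le> R \<longrightarrow> integral {1..R} (\<lambda>x. (norm (Dx (u M) (x, t)))\<^sup>2) \<le> D)"
    using Dx_L2_bound[OF _ t(1), of _ t2] by blast
  from choice[OF this] obtain D where D: "\<And>M t R. 1 \<le> M \<Longrightarrow> t1 \<le> t \<Longrightarrow> t \<le> t2 \<Longrightarrow> 1 \<le> R \<Longrightarrow> integral {1..R} (\<lambda>x. (norm (Dx (u M) (x, t)))\<^sup>2) \<le> D M"
    by blast
  define C where "C = (\<Sum>M\<in>{1..N}. B M + (1 + D M)) * (t2 - t1)"
  have "\<exists>R. real j + 1 \<le> R \<and> R \<le> real j + 2 \<and>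
    integral {t1..t2} (\<lambda>t. \<Sum>M\<in>{1..N}. norm (u M (R, t)) + norm (Dx (u M) (R, t))) \<le> C + 1" for j :: nat
  proof -
    let ?a = "real j + 1" and ?b = "real j + 2"
    have cu: "continuous_on quarter (u M)" "continuous_on quarter (Dx (u M))" if "1 \<le> M" for M
      using has_x_derivD(1,2)[OF u_derivs(1)[OF that]] by auto
    have "continuous_on quarter (\<lambda>p. \<Sum>M\<in>{1..N}. norm (u M p) + (1 + (norm (Dx (u M) p))\<^sup>2))"
      by (intro continuous_intros cu) auto
    then have cq: "continuous_on (cbox (?a, t1) (?b, t2)) (\<lambda>(R, t). ?q R t)"
      by (rule continuous_on_eq[OF continuous_on_subset]) (use t in \<open>auto simp: quarter_def cbox_Pair_eq\<close>)
    have le: "integral {?a..?b} (\<lambda>R. ?q R t) \<le> (\<Sum>M\<in>{1..N}. B M + (1 + D M))" if t': "t \<in> {t1..t2}" for t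
    proof -
      have tp: "0 < t" using t' t by auto
      note sl = continuous_on_slice_x[OF cu(1) tp] continuous_on_slice_x[OF cu(2) tp]
      have "integral {?a..?b} (\<lambda>R. ?q R t) = (\<Sum>M\<in>{1..N}. integral {?a..?b} (\<lambda>R. norm (u M (R, t)) + (1 + (norm (Dx (u M) (R, t)))\<^sup>2)))"
        by (rule integral_sum) (auto intro!: integrable_continuous_real continuous_intros sl)
      also have "\<dots> \<le> (\<Sum>M\<in>{1..N}. B M + (1 + D M))"
      proof (rule sum_mono)
        fix M assume "M \<in> {1..N}"
        then have M: "1 \<le> M" by simp
        have "integral {?a..?b} (\<lambda>R. norm (u M (R, t)) + (1 + (norm (Dx (u M) (R, t)))\<^sup>2)) =
          integral {?a..?b} (\<lambda>R. norm (u M (R, t))) + (integral {?a..?b} (\<lambda>R. 1) + integral {?a..?b} (\<lambda>R. (norm (Dx (u M) (R, t)))\<^sup>2))"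
          by (subst integral_add, (auto intro!: integrable_continuous_real continuous_intros sl M)[2],
              subst integral_add, auto intro!: integrable_continuous_real continuous_intros sl M)
        also have "integral {?a..?b} (\<lambda>R. norm (u M (R, t))) \<le> B M" by (rule B[OF M tp]) auto
        also have "integral {?a..?b} (\<lambda>R. (norm (Dx (u M) (R, t)))\<^sup>2) \<le> integral {1..?b} (\<lambda>R. (norm (Dx (u M) (R, t)))\<^sup>2)"
          by (rule integral_subset_le) (auto intro!: integrable_continuous_real continuous_intros sl M)
        also have "\<dots> \<le> D M" by (rule D[OF M]) (use t' in auto)
        also have "integral {?a..?b} (\<lambda>R. 1::real) = 1" by simp
        finally show "integral {?a..?b} (\<lambda>R. norm (u M (R, t)) + (1 + (norm (Dx (u M) (R, t)))\<^sup>2)) \<le> B M + (1 + D M)" by simp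
      qed
      finally show ?thesis .
    qed
    have swap: "integral {?a..?b} (\<lambda>R. integral {t1..t2} (\<lambda>t. ?q R t)) = integral {t1..t2} (\<lambda>t. integral {?a..?b} (\<lambda>R. ?q R t))"
      using integral_swap_continuous[OF cq] by simp
    have cin: "(\<lambda>t. integral {?a..?b} (\<lambda>R. ?q R t)) integrable_on {t1..t2}"
      "(\<lambda>R. integral {t1..t2} (\<lambda>t. ?q R t)) integrable_on {?a..?b}"
    proof -
      have "continuous_on ({t1..t2} \<times> {?a..?b}) (\<lambda>z. (\<lambda>(R, t). ?q R t) (snd z, fst z))"
        by (rule continuous_on_compose2[OF cq]) (auto intro!: continuous_intros simp: cbox_Pair_eq)
      then show "(\<lambda>t. integral {?a..?b} (\<lambda>R. ?q R t)) integrable_on {t1..t2}"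
        using integral_continuous_on_param[of "{t1..t2}" ?a ?b "\<lambda>t R. ?q R t"]
        by (auto intro!: integrable_continuous_real simp: case_prod_unfold)
      show "(\<lambda>R. integral {t1..t2} (\<lambda>t. ?q R t)) integrable_on {?a..?b}"
        using integral_continuous_on_param[of "{?a..?b}" t1 t2 ?q] cq
        by (auto intro!: integrable_continuous_real simp: cbox_Pair_eq)
    qed
    have tot: "integral {?a..?b} (\<lambda>R. integral {t1..t2} (\<lambda>t. ?q R t)) \<le> C"
    proof -
      have "integral {t1..t2} (\<lambda>t. integral {?a..?b} (\<lambda>R. ?q R t)) \<le> integral {t1..t2} (\<lambda>t. \<Sum>M\<in>{1..N}. B M + (1 + D M))"
        by (rule integral_le[OF cin(1) integrable_const_ivl le])
      then show ?thesis unfolding swap C_def using t by (simp add: mult.commute)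
    qed
    \<comment> \<open>If the time integral exceeded C + 1 for all R in this interval of length 1,
      its integral over R would be at least C + 1, contrary to \<open>tot\<close>.\<close>
    have "\<exists>R\<in>{?a..?b}. integral {t1..t2} (\<lambda>t. ?q R t) \<le> C + 1"
    proof (rule ccontr)
      assume "\<not> (\<exists>R\<in>{?a..?b}. integral {t1..t2} (\<lambda>t. ?q R t) \<le> C + 1)"
      then have "integral {?a..?b} (\<lambda>R. C + 1) \<le> integral {?a..?b} (\<lambda>R. integral {t1..t2} (\<lambda>t. ?q R t))"
        by (intro integral_le integrable_const_ivl cin(2)) (auto simp: not_le less_imp_le)
      with tot show False by simp
    qed
    then obtain R where R: "R \<in> {?a..?b}" and le': "integral {t1..t2} (\<lambda>t. ?q R t) \<le> C + 1" ..
    have Rp: "0 < R" using R by auto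
    note sl = continuous_on_slice_t[OF cu(1) Rp] continuous_on_slice_t[OF cu(2) Rp]
    have "integral {t1..t2} (\<lambda>t. \<Sum>M\<in>{1..N}. norm (u M (R, t)) + norm (Dx (u M) (R, t))) \<le> integral {t1..t2} (\<lambda>t. ?q R t)"
    proof (rule integral_le)
      have le2: "a \<le> 1 + a\<^sup>2" if "0 \<le> a" for a :: real
        using zero_le_power2[of "a - 1"] that by (simp add: power2_eq_square algebra_simps)
      show "(\<Sum>M\<in>{1..N}. norm (u M (R, t)) + norm (Dx (u M) (R, t))) \<le> ?q R t" for t
        by (intro sum_mono add_mono order_refl le2 norm_ge_zero)
    qed (use t in \<open>auto intro!: integrable_continuous_real continuous_intros sl\<close>)
    with le' R show ?thesis by (intro exI[of _ R]) auto
  qed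
  with that show ?thesis by blast
qed

section \<open>The Riccati equation at the boundary\<close>

definition \<Phi> where "\<Phi> k t = eps_series (\<lambda>N. decay_sol lam k (profile {0<..} t) N 0)"
definition G0 where "G0 t = eps_series (\<lambda>N. ext (u N) (0, t))"
definition G1 where "G1 t = eps_series (\<lambda>N. ext (Dx (u N)) (0, t))"

lemma ext_u:
  assumes "1 \<le> N"
  shows "continuous_on closed_quarter (ext (u N))" "continuous_on closed_quarter (ext (Dx (u N)))"
    "p \<in> quarter \<Longrightarrow> ext (u N) p = u N p" "p \<in> quarter \<Longrightarrow> ext (Dx (u N)) p = Dx (u N) p"
proof -
  have "\<forall>v\<in>partials (u N). extends_continuously v"
    using conjunct1[OF conjunct2[OF conjunct2[OF solD[OF assms]]]] .
  then have e: "extends_continuously (u N)" "extends_continuously (Dx (u N))"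
    by (auto intro: partials.intros)
  show "continuous_on closed_quarter (ext (u N))" "continuous_on closed_quarter (ext (Dx (u N)))"
    "p \<in> quarter \<Longrightarrow> ext (u N) p = u N p" "p \<in> quarter \<Longrightarrow> ext (Dx (u N)) p = Dx (u N) p"
    using ext_continuous[OF e(1)] ext_continuous[OF e(2)] by blast+
qed

lemma G_continuous: "fps_continuous_on {0<..} G0" "fps_continuous_on {0<..} G1"
proof -
  have "continuous_on {0<..} (\<lambda>t. G0 t $ N) \<and> continuous_on {0<..} (\<lambda>t. G1 t $ N)" for N
  proof (cases "N = 0")
    case False
    then have N: "1 \<le> N" by simp
    have "continuous_on {0<..} (\<lambda>t. ext (u N) (0, t))" "continuous_on {0<..} (\<lambda>t. ext (Dx (u N)) (0, t))"
      by (rule continuous_on_compose2[OF ext_u(1)[OF N]] continuous_on_compose2[OF ext_u(2)[OF N]];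
        auto intro!: continuous_intros simp: closed_quarter_def)+
    with N show ?thesis by (simp add: G0_def G1_def eps_series_nth)
  qed (simp add: G0_def G1_def eps_series_nth)
  then show "fps_continuous_on {0<..} G0" "fps_continuous_on {0<..} G1" by (auto simp: fps_continuous_on_def)
qed

lemma \<Phi>_bounded:
  obtains C where "\<And>k t N. 0 < Im k \<Longrightarrow> 0 < t \<Longrightarrow> norm (\<Phi> k t $ N) \<le> C N"
proof -
  obtain C where C0: "\<And>N. 0 \<le> C N" and C: "\<And>k A t N x. 0 < Im k \<Longrightarrow> A \<subseteq> {0<..} \<Longrightarrow> A \<in> sets borel \<Longrightarrow> 0 < t \<Longrightarrow> 1 \<le> N \<Longrightarrow>
    norm (decay_sol lam k (profile A t) N x) \<le> C N" by (rule decay_sol_profile_bound) (rule that)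
  have "norm (\<Phi> k t $ N) \<le> C N" if "0 < Im k" "0 < t" for k t N
    using C[of k "{0<..}" t N] C0[of N] that by (cases "N = 0") (simp_all add: \<Phi>_def eps_series_nth)
  with that show ?thesis by blast
qed

text \<open>End point and cutoff move together along one sequence; \<open>real j \<le> R j\<close>
  ensures that each y eventually lies inside the cutoff.\<close>

lemma trunc_tendsto:
  assumes k: "0 < Im k" and t: "0 < t"
    and x: "\<xi> \<longlonglongrightarrow> 0" "\<And>j. 0 < \<xi> j" "\<And>j. \<xi> j \<le> R j" and R: "\<And>j. real j \<le> R j"
  shows "fps_tendsto (\<lambda>j. F k (R j) (\<xi> j, t)) (\<Phi> k t) sequentially"
  unfolding fps_tendsto_def
proof
  fix N
  show "(\<lambda>j. F k (R j) (\<xi> j, t) $ N) \<longlonglongrightarrow> \<Phi> k t $ N"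
  proof (cases "N = 0")
    case True
    then show ?thesis by (simp add: \<Phi>_def eps_series_nth)
  next
    case False
    then have N: "1 \<le> N" by simp
    obtain B where B: "\<And>A t a. A \<subseteq> {0<..} \<Longrightarrow> A \<in> sets borel \<Longrightarrow> 0 < t \<Longrightarrow> 1 \<le> a \<Longrightarrow>
      integrable lborel (profile A t a) \<and> (LINT y|lborel. norm (profile A t a y)) \<le> B a"
      by (rule profile_L1) (rule that)
    have "(\<lambda>j. decay_sol lam k (profile {0<..R j} t) N (\<xi> j)) \<longlonglongrightarrow> decay_sol lam k (profile {0<..} t) N 0"
    proof (rule decay_sol_tendsto[OF norm_lam k N _ _ _ _ _ x(1)])
      show "integrable lborel (profile {0<..} t a)" if "1 \<le> a" for a
        using B[of "{0<..}" t a] t that by simp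
      show "profile {0<..} t a \<in> borel_measurable borel" for a
        by (rule profile_measurable) (use t in auto)
      show "profile {0<..R j} t a \<in> borel_measurable borel" for j a
        by (rule profile_measurable) (use t in auto)
      show "norm (profile {0<..R j} t a y) \<le> norm (profile {0<..} t a y)" for j a y
        by (auto simp: profile_def indicator_def)
      show "(\<lambda>j. profile {0<..R j} t a y) \<longlonglongrightarrow> profile {0<..} t a y" for a y
      proof (rule tendsto_eventually)
        have "y \<le> R j" if "nat \<lceil>y\<rceil> \<le> j" for j using that R[of j] by linarith
        then show "\<forall>\<^sub>F j in sequentially. profile {0<..R j} t a y = profile {0<..} t a y"
          unfolding eventually_sequentially by (intro exI[of _ "nat \<lceil>y\<rceil>"]) (auto simp: profile_def indicator_def)
      qed
    qed
    moreover have "F k (R j) (\<xi> j, t) $ N = decay_sol lam k (profile {0<..R j} t) N (\<xi> j)" for j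
      unfolding F_nth by (rule trunc_eq_decay_sol[OF order_less_le_trans[OF x(2,3)] x(2,3) t])
    ultimately show ?thesis using False by (simp add: \<Phi>_def eps_series_nth)
  qed
qed

lemma U_tendsto:
  assumes t: "0 < t" and x: "\<xi> \<longlonglongrightarrow> 0" "\<And>j. 0 < \<xi> j"
  shows "fps_tendsto (\<lambda>j. U (\<xi> j, t)) (G0 t) sequentially" "fps_tendsto (\<lambda>j. Ux (\<xi> j, t)) (G1 t) sequentially"
proof -
  have lim: "(\<lambda>j. (\<xi> j, t)) \<longlonglongrightarrow> (0, t)" by (intro tendsto_intros x(1))
  have "((\<lambda>j. U (\<xi> j, t) $ N) \<longlonglongrightarrow> G0 t $ N) \<and> ((\<lambda>j. Ux (\<xi> j, t) $ N) \<longlonglongrightarrow> G1 t $ N)" for N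
  proof (cases "N = 0")
    case False
    then have N: "1 \<le> N" by simp
    have q: "(\<xi> j, t) \<in> quarter" "(\<xi> j, t) \<in> closed_quarter" for j
      using t x(2)[of j] by (simp_all add: quarter_iff closed_quarter_def less_imp_le)
    have "(\<lambda>j. ext (u N) (\<xi> j, t)) \<longlonglongrightarrow> ext (u N) (0, t)" "(\<lambda>j. ext (Dx (u N)) (\<xi> j, t)) \<longlonglongrightarrow> ext (Dx (u N)) (0, t)"
      by (rule continuous_on_tendsto_compose[OF ext_u(1)[OF N] lim] continuous_on_tendsto_compose[OF ext_u(2)[OF N] lim];
        use t q in \<open>simp add: closed_quarter_def less_imp_le\<close>)+
    then show ?thesis
      using N ext_u(3)[OF N q(1)] ext_u(4)[OF N q(1)] False by (simp add: U_nth G0_def G1_def eps_series_nth)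
  qed (simp add: U_nth G0_def G1_def eps_series_nth)
  then show "fps_tendsto (\<lambda>j. U (\<xi> j, t)) (G0 t) sequentially" "fps_tendsto (\<lambda>j. Ux (\<xi> j, t)) (G1 t) sequentially"
    by (auto simp: fps_tendsto_def)
qed

text \<open>The data extend continuously to x = 0, so compactness of the closed rectangle bounds
  \<open>U\<close> and \<open>Ux\<close> up to the boundary.\<close>

lemma U_bounded:
  assumes t: "0 < t1"
  shows "fps_bounded_on ({0<..1} \<times> {t1..t2}) U" "fps_bounded_on ({0<..1} \<times> {t1..t2}) Ux"
proof -
  have sub: "{0..1} \<times> {t1..t2} \<subseteq> closed_quarter" using t by (auto simp: closed_quarter_def)
  have *: "\<exists>K. \<forall>s\<in>{0<..1} \<times> {t1..t2}. norm (g s) \<le> K"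
    if c: "continuous_on closed_quarter h" and eq: "\<And>p. p \<in> quarter \<Longrightarrow> h p = g p" for g h :: "real \<times> real \<Rightarrow> complex"
  proof -
    have "bounded (h ` ({0..1} \<times> {t1..t2}))"
      by (intro compact_imp_bounded compact_continuous_image continuous_on_subset[OF c sub] compact_Times compact_Icc)
    then obtain K where "\<forall>s\<in>{0..1} \<times> {t1..t2}. norm (h s) \<le> K" by (auto simp: bounded_iff)
    moreover have "s \<in> quarter" if "s \<in> {0<..1} \<times> {t1..t2}" for s
      using that t by (auto simp: quarter_def)
    moreover have "s \<in> {0..1} \<times> {t1..t2}" if "s \<in> {0<..1} \<times> {t1..t2}" for s :: "real \<times> real"
      by (rule subsetD[OF Sigma_mono that]) auto
    ultimately have "norm (g s) \<le> K" if "s \<in> {0<..1} \<times> {t1..t2}" for s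
      unfolding eq[OF \<open>\<And>s. s \<in> {0<..1} \<times> {t1..t2} \<Longrightarrow> s \<in> quarter\<close>[OF that], symmetric] using that by blast
    then show ?thesis by blast
  qed
  have "(\<exists>K. \<forall>s\<in>{0<..1} \<times> {t1..t2}. norm (U s $ N) \<le> K) \<and> (\<exists>K. \<forall>s\<in>{0<..1} \<times> {t1..t2}. norm (Ux s $ N) \<le> K)" for N
  proof (cases "N = 0")
    case False
    then have N: "1 \<le> N" by simp
    show ?thesis unfolding U_nth(1,3)[OF N]
      by (intro conjI *[OF ext_u(1)[OF N] ext_u(3)[OF N]] *[OF ext_u(2)[OF N] ext_u(4)[OF N]])
  next
    case True
    show ?thesis by (intro conjI exI[of _ 0]) (simp_all add: True U_nth)
  qed
  then show "fps_bounded_on ({0<..1} \<times> {t1..t2}) U" "fps_bounded_on ({0<..1} \<times> {t1..t2}) Ux"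
    by (auto simp: fps_bounded_on_def)
qed

text \<open>Integrate Ft = T + P over [t1, t2] at x = 1 / (j + 1), with cutoffs \<open>R j\<close>
  tending to infinity. The integrated form is essential because \<open>u_x\<close> at x = R is
  controlled only in the mean over time. This mean times the exponential factor of
  \<open>P_bound\<close> tends to 0, and the T part converges to the right-hand side at the
  boundary.\<close>

lemma \<Phi>_integral_equation:
  assumes k: "0 < Im k" and t: "0 < t1" "t1 \<le> t2"
  shows "((\<lambda>t. (riccati_rhs lam k (G0 t) (G1 t) (\<Phi> k t) - fps_const (4 * \<i> * k\<^sup>2) * \<Phi> k t) $ N)
    has_integral \<Phi> k t2 $ N - \<Phi> k t1 $ N) {t1..t2}"
proof -
  let ?h = "\<lambda>t. (riccati_rhs lam k (G0 t) (G1 t) (\<Phi> k t) - fps_const (4 * \<i> * k\<^sup>2) * \<Phi> k t) $ N"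
  obtain C where C: "\<And>j::nat. \<exists>R. real j + 1 \<le> R \<and> R \<le> real j + 2 \<and>
    integral {t1..t2} (\<lambda>t. \<Sum>M\<in>{1..N}. norm (u M (R, t)) + norm (Dx (u M) (R, t))) \<le> C"
    by (rule select_truncation[OF t]) (rule that)
  have "\<forall>j::nat. \<exists>R. real j + 1 \<le> R \<and> R \<le> real j + 2 \<and>
    integral {t1..t2} (\<lambda>t. \<Sum>M\<in>{1..N}. norm (u M (R, t)) + norm (Dx (u M) (R, t))) \<le> C"
    by (rule allI) (rule C)
  from choice[OF this] obtain R where R: "\<And>j. real j + 1 \<le> R j"
    "\<And>j. integral {t1..t2} (\<lambda>t. \<Sum>M\<in>{1..N}. norm (u M (R j, t)) + norm (Dx (u M) (R j, t))) \<le> C" by blast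
  define \<xi> where "\<xi> j = inverse (real (Suc j))" for j
  have x: "\<xi> \<longlonglongrightarrow> 0" "\<And>j. 0 < \<xi> j" "\<And>j. \<xi> j \<le> 1"
    unfolding \<xi>_def using LIMSEQ_inverse_real_of_nat by (auto simp: field_simps)
  have Rp: "0 < R j" and xR: "\<xi> j \<le> R j" and jR: "real j \<le> R j" for j
    using R(1)[of j] x(3)[of j] by linarith+
  note lim = trunc_tendsto[OF k _ x(1,2) xR jR]
  obtain K where K0: "0 \<le> K" and K: "\<And>R x t. 0 < x \<Longrightarrow> x \<le> R \<Longrightarrow> 0 < t \<Longrightarrow> norm (P k R (x, t) $ N) \<le>
    K * exp (2 * Im k * (x - R)) * (\<Sum>M\<in>{1..N}. norm (u M (R, t)) + norm (Dx (u M) (R, t)))"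
    using P_bound[OF k, of N] by blast
  have hT: "T k (R j) (x, t) = riccati_rhs lam k (U (x, t)) (Ux (x, t)) (F k (R j) (x, t)) - fps_const (4 * \<i> * k\<^sup>2) * F k (R j) (x, t)" for j x t
    by (simp add: T_def)
  have cT: "continuous_on {t1..t2} (\<lambda>t. T k (R j) (\<xi> j, t) $ N)" and cP: "continuous_on {t1..t2} (\<lambda>t. P k (R j) (\<xi> j, t) $ N)" for j
    by (rule continuous_on_slice_t[OF T_continuous[OF Rp, unfolded fps_continuous_on_def, rule_format] x(2)]
        continuous_on_slice_t[OF P_continuous[OF Rp, unfolded fps_continuous_on_def, rule_format] x(2)]; use t in auto)+
  \<comment> \<open>Dominated convergence with a constant majorant: all ingredients of T are bounded
    over j and t jointly.\<close>
  have dc: "?h integrable_on {t1..t2}" "(\<lambda>j. integral {t1..t2} (\<lambda>t. T k (R j) (\<xi> j, t) $ N)) \<longlonglongrightarrow> integral {t1..t2} ?h"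
  proof -
    let ?S = "UNIV \<times> {t1..t2}"
    obtain CF where CF0: "\<And>N. 0 \<le> CF N" and CF: "\<And>k A t N x. 0 < Im k \<Longrightarrow> A \<subseteq> {0<..} \<Longrightarrow> A \<in> sets borel \<Longrightarrow> 0 < t \<Longrightarrow> 1 \<le> N \<Longrightarrow>
      norm (decay_sol lam k (profile A t) N x) \<le> CF N" by (rule decay_sol_profile_bound) (rule that)
    have "norm (F k (R j) (\<xi> j, t) $ M) \<le> CF M" if "t \<in> {t1..t2}" for j t M
    proof (cases "M = 0")
      case False
      have tp: "0 < t" using that t by auto
      show ?thesis unfolding F_nth trunc_eq_decay_sol[OF Rp x(2) xR tp]
        by (rule CF[OF k]) (use False tp in auto)
    qed (simp add: CF0)
    then have "\<forall>s\<in>?S. norm ((case s of (j, t) \<Rightarrow> F k (R j) (\<xi> j, t)) $ M) \<le> CF M" for M by auto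
    then have bF: "fps_bounded_on ?S (\<lambda>(j, t). F k (R j) (\<xi> j, t))"
      unfolding fps_bounded_on_def by blast
    have bU: "fps_bounded_on ?S (\<lambda>(j, t). U (\<xi> j, t))" "fps_bounded_on ?S (\<lambda>(j, t). Ux (\<xi> j, t))"
    proof -
      have "(\<xi> j, t) \<in> {0<..1} \<times> {t1..t2}" if "t \<in> {t1..t2}" for j t using x(2,3)[of j] that by simp
      then show "fps_bounded_on ?S (\<lambda>(j, t). U (\<xi> j, t))" "fps_bounded_on ?S (\<lambda>(j, t). Ux (\<xi> j, t))"
        using U_bounded[OF t(1), of t2] unfolding fps_bounded_on_def by fast+
    qed
    have "fps_bounded_on ?S (\<lambda>s. T k (R (fst s)) (\<xi> (fst s), snd s))"
      unfolding hT using bF bU by (intro fps_bounded_on_riccati_rhs) (simp_all add: case_prod_unfold)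
    then obtain B where B: "\<forall>s\<in>?S. norm (T k (R (fst s)) (\<xi> (fst s), snd s) $ N) \<le> B"
      unfolding fps_bounded_on_def by blast
    have i: "(\<lambda>t. T k (R j) (\<xi> j, t) $ N) integrable_on {t1..t2}" for j
      by (rule integrable_continuous_real[OF cT])
    have b: "norm (T k (R j) (\<xi> j, t) $ N) \<le> B" if "t \<in> {t1..t2}" for j t
      using bspec[OF B, of "(j, t)"] that by simp
    have l: "(\<lambda>j. T k (R j) (\<xi> j, t) $ N) \<longlonglongrightarrow> ?h t" if "t \<in> {t1..t2}" for t
    proof -
      have tp: "0 < t" using that t by auto
      have "fps_tendsto (\<lambda>j. T k (R j) (\<xi> j, t)) (riccati_rhs lam k (G0 t) (G1 t) (\<Phi> k t) - fps_const (4 * \<i> * k\<^sup>2) * \<Phi> k t) sequentially"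
        unfolding hT by (intro fps_tendsto_riccati_rhs U_tendsto lim tp x)
      then show ?thesis unfolding fps_tendsto_def by (rule spec)
    qed
    show "?h integrable_on {t1..t2}" "(\<lambda>j. integral {t1..t2} (\<lambda>t. T k (R j) (\<xi> j, t) $ N)) \<longlonglongrightarrow> integral {t1..t2} ?h"
      by (rule dominated_convergence[OF i integrable_const_ivl[of B] b l]; assumption)+
  qed
  have eqj: "integral {t1..t2} (\<lambda>t. T k (R j) (\<xi> j, t) $ N) =
      (F k (R j) (\<xi> j, t2) $ N - F k (R j) (\<xi> j, t1) $ N) - integral {t1..t2} (\<lambda>t. P k (R j) (\<xi> j, t) $ N)" for j
  proof -
    have "((\<lambda>t. Ft k (R j) (\<xi> j, t) $ N) has_integral F k (R j) (\<xi> j, t2) $ N - F k (R j) (\<xi> j, t1) $ N) {t1..t2}"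
    proof (rule fundamental_theorem_of_calculus[OF t(2)])
      fix s assume "s \<in> {t1..t2}"
      then have "0 < s" using t by auto
      from F_t_deriv[OF Rp x(2) this, of k j j] show "((\<lambda>s. F k (R j) (\<xi> j, s) $ N) has_vector_derivative Ft k (R j) (\<xi> j, s) $ N) (at s within {t1..t2})"
        unfolding fps_deriv_at_def by (blast intro: has_vector_derivative_at_within)
    qed
    moreover have "(\<lambda>t. Ft k (R j) (\<xi> j, t) $ N) = (\<lambda>t. T k (R j) (\<xi> j, t) $ N + P k (R j) (\<xi> j, t) $ N)"
      by (rule ext) (simp add: P_def)
    ultimately have "integral {t1..t2} (\<lambda>t. T k (R j) (\<xi> j, t) $ N + P k (R j) (\<xi> j, t) $ N) = F k (R j) (\<xi> j, t2) $ N - F k (R j) (\<xi> j, t1) $ N"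
      by (simp add: integral_unique)
    moreover have "integral {t1..t2} (\<lambda>t. T k (R j) (\<xi> j, t) $ N + P k (R j) (\<xi> j, t) $ N) =
       integral {t1..t2} (\<lambda>t. T k (R j) (\<xi> j, t) $ N) + integral {t1..t2} (\<lambda>t. P k (R j) (\<xi> j, t) $ N)"
      by (intro integral_add integrable_continuous_real cT cP)
    ultimately show ?thesis by (simp add: algebra_simps)
  qed
  \<comment> \<open>Exponential decay in j against time integrals that are bounded independently of
    j by the choice of \<open>R j\<close>.\<close>
  have Plim: "(\<lambda>j. integral {t1..t2} (\<lambda>t. P k (R j) (\<xi> j, t) $ N)) \<longlonglongrightarrow> 0"
  proof (rule Lim_null_comparison)
    have "norm (integral {t1..t2} (\<lambda>t. P k (R j) (\<xi> j, t) $ N)) \<le> K * exp (- (2 * Im k)) ^ j * \<bar>C\<bar>" for j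
    proof -
      let ?A = "\<lambda>t. \<Sum>M\<in>{1..N}. norm (u M (R j, t)) + norm (Dx (u M) (R j, t))"
      have cA: "continuous_on {t1..t2} ?A"
        by (intro continuous_intros continuous_on_slice_t[OF has_x_derivD(1)[OF u_derivs(1)] Rp]
            continuous_on_slice_t[OF has_x_derivD(2)[OF u_derivs(1)] Rp]) (use t in auto)
      have ek: "exp (2 * Im k * (\<xi> j - R j)) \<le> exp (- (2 * Im k)) ^ j"
      proof -
        have "2 * Im k * (\<xi> j - R j) \<le> 2 * Im k * (- real j)"
          using k R(1)[of j] x(3)[of j] by (intro mult_left_mono) auto
        then show ?thesis by (simp add: exp_of_nat_mult[symmetric] mult_ac)
      qed
      have "norm (integral {t1..t2} (\<lambda>t. P k (R j) (\<xi> j, t) $ N)) \<le> integral {t1..t2} (\<lambda>t. K * exp (2 * Im k * (\<xi> j - R j)) * ?A t)"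
      proof (rule integral_norm_bound_integral)
        show "(\<lambda>t. P k (R j) (\<xi> j, t) $ N) integrable_on {t1..t2}" by (rule integrable_continuous_real[OF cP])
        show "(\<lambda>t. K * exp (2 * Im k * (\<xi> j - R j)) * ?A t) integrable_on {t1..t2}"
          by (intro integrable_continuous_real continuous_on_mult continuous_on_const cA)
        show "norm (P k (R j) (\<xi> j, s) $ N) \<le> K * exp (2 * Im k * (\<xi> j - R j)) * ?A s" if "s \<in> {t1..t2}" for s
          by (rule K[OF x(2) xR]) (use that t in auto)
      qed
      also have "\<dots> = K * exp (2 * Im k * (\<xi> j - R j)) * integral {t1..t2} ?A"
        by (rule integral_mult_right)
      also have "\<dots> \<le> K * exp (- (2 * Im k)) ^ j * \<bar>C\<bar>"
      proof (intro mult_mono mult_left_mono ek K0)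
        show "integral {t1..t2} ?A \<le> \<bar>C\<bar>" using R(2)[of j] by linarith
        show "0 \<le> integral {t1..t2} ?A"
          by (intro integral_nonneg integrable_continuous_real cA sum_nonneg add_nonneg_nonneg norm_ge_zero)
      qed (use K0 in auto)
      finally show ?thesis .
    qed
    then show "\<forall>\<^sub>F j in sequentially. norm (integral {t1..t2} (\<lambda>t. P k (R j) (\<xi> j, t) $ N)) \<le> K * exp (- (2 * Im k)) ^ j * \<bar>C\<bar>"
      by (intro always_eventually allI)
    have "(\<lambda>j. K * exp (- (2 * Im k)) ^ j * \<bar>C\<bar>) \<longlonglongrightarrow> K * 0 * \<bar>C\<bar>"
      by (intro tendsto_intros LIMSEQ_realpow_zero) (use k in auto)
    then show "(\<lambda>j. K * exp (- (2 * Im k)) ^ j * \<bar>C\<bar>) \<longlonglongrightarrow> 0" by simp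
  qed
  have "(\<lambda>j. integral {t1..t2} (\<lambda>t. T k (R j) (\<xi> j, t) $ N)) \<longlonglongrightarrow> (\<Phi> k t2 $ N - \<Phi> k t1 $ N) - 0"
    unfolding eqj
  proof (intro tendsto_diff Plim)
    show "(\<lambda>j. F k (R j) (\<xi> j, t2) $ N) \<longlonglongrightarrow> \<Phi> k t2 $ N" "(\<lambda>j. F k (R j) (\<xi> j, t1) $ N) \<longlonglongrightarrow> \<Phi> k t1 $ N"
      using lim[of t1] lim[of t2] t unfolding fps_tendsto_def by auto
  qed
  then have "integral {t1..t2} ?h = \<Phi> k t2 $ N - \<Phi> k t1 $ N"
    using LIMSEQ_unique[OF dc(2)] by simp
  with dc(1) show ?thesis by (simp add: has_integral_integral)
qed

text \<open>A bootstrap: by the integral equation \<Phi> is locally an indefinite integral, hence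
  continuous. Its integrand is then continuous too, which is what the differential equation
  needs.\<close>

lemma \<Phi>_continuous:
  assumes k: "0 < Im k"
  shows "fps_continuous_on {0<..} (\<Phi> k)"
  unfolding fps_continuous_on_def
proof
  fix N
  let ?h = "\<lambda>t. (riccati_rhs lam k (G0 t) (G1 t) (\<Phi> k t) - fps_const (4 * \<i> * k\<^sup>2) * \<Phi> k t) $ N"
  have "continuous (at t) (\<lambda>t. \<Phi> k t $ N)" if t: "0 < t" for t
  proof -
    have "continuous_on {t/2..2*t} (\<lambda>s. \<Phi> k (t/2) $ N + integral {t/2..s} ?h)"
      by (intro continuous_intros indefinite_integral_continuous_1 has_integral_integrable[OF \<Phi>_integral_equation[OF k]])
        (use t in auto)
    then have "continuous_on {t/2..2*t} (\<lambda>t. \<Phi> k t $ N)"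
    proof (rule continuous_on_eq)
      fix s assume "s \<in> {t/2..2*t}"
      then show "\<Phi> k (t/2) $ N + integral {t/2..s} ?h = \<Phi> k s $ N"
        using integral_unique[OF \<Phi>_integral_equation[OF k, of "t/2" s N]] t by simp
    qed
    then show ?thesis by (rule continuous_on_interior) (use t in auto)
  qed
  then show "continuous_on {0<..} (\<lambda>t. \<Phi> k t $ N)"
    by (intro continuous_at_imp_continuous_on) auto
qed

lemma \<Phi>_riccati:
  assumes k: "0 < Im k" and t: "0 < t"
  shows "fps_deriv_at (\<Phi> k) (riccati_rhs lam k (G0 t) (G1 t) (\<Phi> k t) - fps_const (4 * \<i> * k\<^sup>2) * \<Phi> k t) t"
  unfolding fps_deriv_at_def
proof
  fix N
  let ?h = "\<lambda>t. (riccati_rhs lam k (G0 t) (G1 t) (\<Phi> k t) - fps_const (4 * \<i> * k\<^sup>2) * \<Phi> k t) $ N"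
  have "fps_continuous_on {0<..} (\<lambda>t. riccati_rhs lam k (G0 t) (G1 t) (\<Phi> k t) - fps_const (4 * \<i> * k\<^sup>2) * \<Phi> k t)"
    by (intro fps_continuous_on_riccati_rhs G_continuous \<Phi>_continuous k)
  then have "continuous_on {0<..} ?h" unfolding fps_continuous_on_def by (rule spec)
  then have "continuous_on {t/2..2*t} ?h" by (rule continuous_on_subset) (use t in auto)
  then have "((\<lambda>s. integral {t/2..s} ?h) has_vector_derivative ?h t) (at t within {t/2..2*t})"
    by (rule integral_has_vector_derivative) (use t in auto)
  then have "((\<lambda>s. integral {t/2..s} ?h) has_vector_derivative ?h t) (at t)"
    using at_within_Icc_at[of "t/2" t "2*t"] t by simp
  from has_vector_derivative_add[OF has_vector_derivative_const[of "\<Phi> k (t/2) $ N"] this]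
  have "((\<lambda>s. \<Phi> k (t/2) $ N + integral {t/2..s} ?h) has_vector_derivative ?h t) (at t)" by simp
  then show "((\<lambda>t. \<Phi> k t $ N) has_vector_derivative ?h t) (at t)"
  proof (rule has_vector_derivative_transform_within_open[where S = "{t/2<..}"])
    fix s assume "s \<in> {t/2<..}"
    then show "\<Phi> k (t/2) $ N + integral {t/2..s} ?h = \<Phi> k s $ N"
      using integral_unique[OF \<Phi>_integral_equation[OF k, of "t/2" s N]] t by simp
  qed (use t in auto)
qed

end

section \<open>Absolutely convergent Fourier series\<close>

abbreviation l1 :: "(int \<Rightarrow> complex) \<Rightarrow> bool" where "l1 a \<equiv> (\<lambda>n. norm (a n)) summable_on UNIV"

definition osc :: "real \<Rightarrow> int \<Rightarrow> real \<Rightarrow> complex"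
  where "osc \<omega> n t = exp (\<i> * of_int n * of_real \<omega> * of_real t)"

lemma norm_osc [simp]: "norm (osc \<omega> n t) = 1"
  by (simp add: osc_def)

lemma osc_add: "osc \<omega> (m + n) t = osc \<omega> m t * osc \<omega> n t"
  by (simp add: osc_def exp_add[symmetric] algebra_simps)

lemma osc_diff: "osc \<omega> (m - n) t = osc \<omega> m t * cnj (osc \<omega> n t)"
  by (simp add: osc_def exp_cnj exp_add[symmetric] algebra_simps)

lemma osc_periodic:
  assumes "\<omega> > 0"
  shows "osc \<omega> n (t + of_nat j * (2 * pi / \<omega>)) = osc \<omega> n t"
proof -
  have "\<i> * of_int n * of_real \<omega> * of_real (t + of_nat j * (2 * pi / \<omega>)) =
      \<i> * of_int n * of_real \<omega> * of_real t + 2 * of_int (n * int j) * of_real pi * \<i>"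
    using assms by (simp add: field_simps)
  then show ?thesis
    unfolding osc_def using exp_integer_2pi[of "of_int (n * int j)"] by (simp add: exp_add)
qed

definition fser :: "real \<Rightarrow> (int \<Rightarrow> complex) \<Rightarrow> real \<Rightarrow> complex"
  where "fser \<omega> a t = (\<Sum>\<^sub>\<infinity>n. a n * osc \<omega> n t)"

lemma fser_has_sum:
  assumes "l1 a"
  shows "((\<lambda>n. a n * osc \<omega> n t) has_sum fser \<omega> a t) UNIV"
proof -
  have "(\<lambda>n. norm (a n * osc \<omega> n t)) summable_on UNIV" using assms by (simp add: norm_mult)
  then have "(\<lambda>n. a n * osc \<omega> n t) summable_on UNIV" by (rule abs_summable_summable)
  then show ?thesis unfolding fser_def by (rule has_sum_infsum)
qed

lemma norm_fser_le:
  assumes "l1 a"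
  shows "norm (fser \<omega> a t) \<le> (\<Sum>\<^sub>\<infinity>n. norm (a n))"
proof -
  have "(\<lambda>n. norm (a n * osc \<omega> n t)) summable_on UNIV" using assms by (simp add: norm_mult)
  then have "norm (fser \<omega> a t) \<le> (\<Sum>\<^sub>\<infinity>n. norm (a n * osc \<omega> n t))"
    unfolding fser_def by (rule norm_infsum_bound)
  then show ?thesis by (simp add: norm_mult)
qed

lemma fser_periodic: "\<omega> > 0 \<Longrightarrow> fser \<omega> a (t + of_nat j * (2 * pi / \<omega>)) = fser \<omega> a t"
  unfolding fser_def by (simp only: osc_periodic)

text \<open>At t = 0 the exponentials equal 1, and unconditional summability of complex numbers is
  absolute summability.\<close>

lemma l1_of_fourier_coefficients:
  assumes "fourier_coefficients \<omega> g a"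
  shows "l1 a" "fser \<omega> a t = g t"
proof -
  have h: "((\<lambda>n. a n * exp (\<i> * of_int n * of_real \<omega> * of_real t)) has_sum g t) UNIV" for t
    using assms unfolding fourier_coefficients_def by blast
  from h[of 0] have "a summable_on UNIV" by (simp add: summable_on_def) blast
  then show "l1 a" by (simp add: summable_on_iff_abs_summable_on_complex)
  show "fser \<omega> a t = g t" unfolding fser_def osc_def by (rule infsumI[OF h])
qed

lemma l1_add: "l1 a \<Longrightarrow> l1 b \<Longrightarrow> l1 (\<lambda>n. a n + b n)"
  by (rule summable_on_comparison_test[where f = "\<lambda>n. norm (a n) + norm (b n)"])
    (auto intro!: summable_on_add norm_triangle_ineq)

lemma l1_cmult: "l1 a \<Longrightarrow> l1 (\<lambda>n. c * a n)"
  by (simp add: norm_mult summable_on_cmult_right)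

lemma l1_sum: "(\<And>i. i \<in> I \<Longrightarrow> l1 (a i)) \<Longrightarrow> l1 (\<lambda>n. \<Sum>i\<in>I. a i n)"
  by (induction I rule: infinite_finite_induct) (simp_all add: l1_add)

lemma fser_add: "l1 a \<Longrightarrow> l1 b \<Longrightarrow> fser \<omega> (\<lambda>n. a n + b n) t = fser \<omega> a t + fser \<omega> b t"
  using infsumI[OF has_sum_add[OF fser_has_sum[of a \<omega> t] fser_has_sum[of b \<omega> t]]]
  by (simp add: fser_def[of \<omega> "\<lambda>n. a n + b n"] distrib_right)

lemma fser_cmult: "l1 a \<Longrightarrow> fser \<omega> (\<lambda>n. c * a n) t = c * fser \<omega> a t"
  using infsumI[OF has_sum_cmult_right[OF fser_has_sum[of a \<omega> t], of c]]
  by (simp add: fser_def[of \<omega> "\<lambda>n. c * a n"] mult.assoc)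

lemma fser_sum:
  assumes "finite I" "\<And>i. i \<in> I \<Longrightarrow> l1 (a i)"
  shows "fser \<omega> (\<lambda>n. \<Sum>i\<in>I. a i n) t = (\<Sum>i\<in>I. fser \<omega> (a i) t)"
  using assms
proof (induction I rule: finite_induct)
  case empty
  show ?case by (simp add: fser_def)
next
  case (insert i I)
  then show ?case using fser_add[of "a i" "\<lambda>n. \<Sum>i\<in>I. a i n"] by (simp add: l1_sum)
qed

lemma summable_on_product_nonneg:
  fixes A :: "'a \<Rightarrow> real" and B :: "'b \<Rightarrow> real"
  assumes "A summable_on UNIV" "B summable_on UNIV" "\<And>x. 0 \<le> A x" "\<And>y. 0 \<le> B y"
  shows "(\<lambda>(x, y). A x * B y) summable_on UNIV"
proof -
  have "(\<lambda>(x, y). A x * B y) summable_on (SIGMA x:UNIV. UNIV)"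
  proof (rule summable_on_SigmaI)
    fix x
    show "((\<lambda>y. case (x, y) of (x, y) \<Rightarrow> A x * B y) has_sum A x * infsum B UNIV) UNIV"
      using has_sum_cmult_right[OF has_sum_infsum[OF assms(2)]] by simp
  next
    show "(\<lambda>x. A x * infsum B UNIV) summable_on UNIV" by (intro summable_on_cmult_left assms)
  qed (use assms in auto)
  then show ?thesis by simp
qed

lemma has_sum_product:
  fixes f :: "'a \<Rightarrow> complex" and g :: "'b \<Rightarrow> complex"
  assumes "(f has_sum F) UNIV" "(g has_sum G) UNIV"
    and "(\<lambda>x. norm (f x)) summable_on UNIV" "(\<lambda>x. norm (g x)) summable_on UNIV"
  shows "((\<lambda>(x, y). f x * g y) has_sum F * G) UNIV"
proof -
  have "(\<lambda>(x, y). norm (f x) * norm (g y)) summable_on UNIV"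
    by (rule summable_on_product_nonneg) (use assms in auto)
  then have "(\<lambda>z. norm ((\<lambda>(x, y). f x * g y) z)) summable_on UNIV"
    by (simp add: case_prod_unfold norm_mult)
  then have s: "(\<lambda>(x, y). f x * g y) summable_on (SIGMA x:UNIV. UNIV)"
    using abs_summable_summable by fastforce
  have "((\<lambda>(x, y). f x * g y) has_sum F * G) (SIGMA x:UNIV. UNIV)"
  proof (rule has_sum_SigmaI[OF _ _ s])
    fix x show "((\<lambda>y. case (x, y) of (x, y) \<Rightarrow> f x * g y) has_sum f x * G) UNIV"
      using has_sum_cmult_right[OF assms(2)] by simp
  next
    show "((\<lambda>x. f x * G) has_sum F * G) UNIV" by (rule has_sum_cmult_left[OF assms(1)])
  qed
  then show ?thesis by simp
qed

text \<open>Fourier coefficient n of a product with its first factor conjugated: the conjugate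
  contributes the frequency -l, and -l + m + (n + l - m) = n.\<close>

definition conv3 :: "(int \<Rightarrow> complex) \<Rightarrow> (int \<Rightarrow> complex) \<Rightarrow> (int \<Rightarrow> complex) \<Rightarrow> int \<Rightarrow> complex"
  where "conv3 a b c n = (\<Sum>\<^sub>\<infinity>(l, m)\<in>UNIV. cnj (a l) * b m * c (n + l - m))"

lemma bij_conv3: "bij (\<lambda>(n::int, l::int, m::int). (l, m, n + l - m))"
  by (rule bij_betw_byWitness[where f' = "\<lambda>(l, m, j). (j - l + m, l, m)"]) auto

text \<open>Tonelli after the change of indices (n, l, m) -> (l, m, n + l - m). Stated for
  nonnegative real sequences so that it also covers majorants that are uniform in k.\<close>

lemma conv3_majorant:
  fixes A B C :: "int \<Rightarrow> real"
  assumes "A summable_on UNIV" "B summable_on UNIV" "C summable_on UNIV"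
    and "\<And>n. 0 \<le> A n" "\<And>n. 0 \<le> B n" "\<And>n. 0 \<le> C n"
  shows "(\<lambda>(l, m). A l * B m * C (n + l - m)) summable_on UNIV"
    "(\<lambda>n. \<Sum>\<^sub>\<infinity>(l, m)\<in>UNIV. A l * B m * C (n + l - m)) summable_on UNIV"
proof -
  have "(\<lambda>(l, z). A l * (\<lambda>(m, j). B m * C j) z) summable_on UNIV"
    by (intro summable_on_product_nonneg assms) (use assms in auto)
  then have "(\<lambda>(l, m, j). A l * B m * C j) summable_on UNIV"
    by (simp add: case_prod_unfold mult.assoc)
  then have "((\<lambda>(l, m, j). A l * B m * C j) \<circ> (\<lambda>(n, l, m). (l, m, n + l - m))) summable_on UNIV"
    using summable_on_reindex_bij_betw[OF bij_conv3, of "\<lambda>(l, m, j). A l * B m * C j"]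
    by (simp add: o_def)
  then have *: "(\<lambda>(n, z). (\<lambda>(l, m). A l * B m * C (n + l - m)) z) summable_on (SIGMA n:UNIV. UNIV)"
    by (simp add: o_def case_prod_unfold)
  show "(\<lambda>(l, m). A l * B m * C (n + l - m)) summable_on UNIV"
    using summable_on_SigmaD1[OF *, of n] by simp
  show "(\<lambda>n. \<Sum>\<^sub>\<infinity>(l, m)\<in>UNIV. A l * B m * C (n + l - m)) summable_on UNIV"
    using summable_on_Sigma_banach[OF *] by simp
qed

lemma conv3_summable:
  assumes "l1 a" "l1 b" "l1 c"
  shows "(\<lambda>(l, m). norm (cnj (a l) * b m * c (n + l - m))) summable_on UNIV"
    "(\<lambda>(l, m). cnj (a l) * b m * c (n + l - m)) summable_on UNIV"
proof -
  show s: "(\<lambda>(l, m). norm (cnj (a l) * b m * c (n + l - m))) summable_on UNIV"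
    using conv3_majorant(1)[OF assms, of n] by (simp add: norm_mult)
  show "(\<lambda>(l, m). cnj (a l) * b m * c (n + l - m)) summable_on UNIV"
    using abs_summable_summable[of "\<lambda>(l, m). cnj (a l) * b m * c (n + l - m)" UNIV] s
    by (simp add: case_prod_unfold)
qed

lemma norm_conv3_le:
  assumes "l1 a" "l1 b" "l1 c"
  shows "norm (conv3 a b c n) \<le> (\<Sum>\<^sub>\<infinity>(l, m)\<in>UNIV. norm (a l) * norm (b m) * norm (c (n + l - m)))"
  using norm_infsum_bound[of "\<lambda>(l, m). cnj (a l) * b m * c (n + l - m)" UNIV] conv3_summable(1)[OF assms, of n]
  unfolding conv3_def by (simp add: case_prod_unfold norm_mult)

lemma l1_conv3:
  assumes "l1 a" "l1 b" "l1 c"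
  shows "l1 (conv3 a b c)"
  by (rule summable_on_comparison_test[OF conv3_majorant(2)[OF assms]])
    (auto intro: norm_conv3_le[OF assms])

text \<open>Absolutely convergent series may be multiplied out and regrouped by total
  frequency.\<close>

lemma fser_conv3:
  assumes "l1 a" "l1 b" "l1 c"
  shows "fser \<omega> (conv3 a b c) t = cnj (fser \<omega> a t) * fser \<omega> b t * fser \<omega> c t"
proof -
  define a' where "a' l = cnj (a l * osc \<omega> l t)" for l
  define b' where "b' m = b m * osc \<omega> m t" for m
  define c' where "c' j = c j * osc \<omega> j t" for j
  have sum: "(a' has_sum cnj (fser \<omega> a t)) UNIV" "(b' has_sum fser \<omega> b t) UNIV" "(c' has_sum fser \<omega> c t) UNIV"
    unfolding a'_def b'_def c'_def
    by (intro has_sum_cnj_iff[THEN iffD2] fser_has_sum assms)+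
  have abs: "(\<lambda>l. norm (a' l)) summable_on UNIV" "(\<lambda>l. norm (b' l)) summable_on UNIV" "(\<lambda>l. norm (c' l)) summable_on UNIV"
    using assms by (simp_all add: a'_def b'_def c'_def norm_mult)
  have "((\<lambda>(l, z). a' l * (\<lambda>(m, j). b' m * c' j) z) has_sum cnj (fser \<omega> a t) * (fser \<omega> b t * fser \<omega> c t)) UNIV"
  proof (intro has_sum_product sum abs)
    show "(\<lambda>z. norm (case z of (m, j) \<Rightarrow> b' m * c' j)) summable_on UNIV"
      using summable_on_product_nonneg[OF abs(2,3)] by (simp add: case_prod_unfold norm_mult)
  qed
  then have "((\<lambda>(l, m, j). a' l * b' m * c' j) has_sum cnj (fser \<omega> a t) * fser \<omega> b t * fser \<omega> c t) UNIV"
    by (simp add: case_prod_unfold mult.assoc)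
  then have "((\<lambda>(n, l, m). a' l * b' m * c' (n + l - m)) has_sum cnj (fser \<omega> a t) * fser \<omega> b t * fser \<omega> c t) UNIV"
    using has_sum_reindex_bij_betw[OF bij_conv3, of "\<lambda>(l, m, j). a' l * b' m * c' j"]
    by (simp add: case_prod_unfold)
  then have "((\<lambda>(n, l, m). a' l * b' m * c' (n + l - m)) has_sum cnj (fser \<omega> a t) * fser \<omega> b t * fser \<omega> c t) (SIGMA n:UNIV. UNIV)"
    by simp
  then have "((\<lambda>n. conv3 a b c n * osc \<omega> n t) has_sum cnj (fser \<omega> a t) * fser \<omega> b t * fser \<omega> c t) UNIV"
  proof (rule has_sum_SigmaD)
    fix n :: int
    have "((\<lambda>(l, m). cnj (a l) * b m * c (n + l - m)) has_sum conv3 a b c n) UNIV"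
      unfolding conv3_def by (rule has_sum_infsum[OF conv3_summable(2)[OF assms]])
    from has_sum_cmult_left[OF this, of "osc \<omega> n t"]
    have "((\<lambda>z. (case z of (l, m) \<Rightarrow> cnj (a l) * b m * c (n + l - m)) * osc \<omega> n t) has_sum conv3 a b c n * osc \<omega> n t) UNIV" .
    moreover have "a' l * b' m * c' (n + l - m) = cnj (a l) * b m * c (n + l - m) * osc \<omega> n t" for l m
    proof -
      have "cnj (osc \<omega> l t) * osc \<omega> m t * osc \<omega> (n + l - m) t = osc \<omega> n t"
      proof -
        have "osc \<omega> n t = osc \<omega> ((n + l - m) + m - l) t" by simp
        also have "\<dots> = osc \<omega> (n + l - m) t * osc \<omega> m t * cnj (osc \<omega> l t)"
          unfolding osc_diff[of \<omega> "(n + l - m) + m" l] osc_add[of \<omega> "n + l - m" m] ..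
        finally show ?thesis by (simp add: mult_ac)
      qed
      then show ?thesis by (simp add: a'_def b'_def c'_def mult_ac)
    qed
    ultimately show "((\<lambda>y. case (n, y) of (n, l, m) \<Rightarrow> a' l * b' m * c' (n + l - m)) has_sum conv3 a b c n * osc \<omega> n t) UNIV"
      by (simp add: case_prod_unfold)
  qed
  then show ?thesis unfolding fser_def[of \<omega> "conv3 a b c"] by (rule infsumI)
qed

text \<open>Termwise differentiation, by the M-test for the differentiated series. The sum over the
  integers is enumerated through \<open>int_decode\<close> to become a series of partial
  sums.\<close>

lemma fser_deriv:
  assumes "l1 b" and "l1 (\<lambda>n. of_int n * b n)"
  shows "(fser \<omega> b has_vector_derivative fser \<omega> (\<lambda>n. \<i> * of_real \<omega> * (of_int n * b n)) t) (at t)"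
proof -
  let ?b' = "\<lambda>n. \<i> * of_real \<omega> * (of_int n * b n)"
  have l1': "l1 ?b'" by (rule l1_cmult[OF assms(2)])
  have ser: "(\<lambda>j. a (int_decode j) * osc \<omega> (int_decode j) t) sums fser \<omega> a t" if "l1 a" for a t
    using fser_has_sum[OF that, of \<omega> t] has_sum_reindex_bij_betw[OF bij_int_decode, of "\<lambda>n. a n * osc \<omega> n t"]
    by (intro has_sum_imp_sums) simp
  define f where "f j t = b (int_decode j) * osc \<omega> (int_decode j) t" for j t
  define f' where "f' j t = ?b' (int_decode j) * osc \<omega> (int_decode j) t" for j t
  have "(\<lambda>j. norm (?b' (int_decode j))) summable_on UNIV"
    using l1' summable_on_reindex_bij_betw[OF bij_int_decode, of "\<lambda>n. norm (?b' n)"] by simp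
  then have sb: "summable (\<lambda>j. norm (?b' (int_decode j)))"
    by (rule summable_on_imp_summable)
  have "uniform_limit UNIV (\<lambda>n t. \<Sum>j<n. f' j t) (\<lambda>t. suminf (\<lambda>j. f' j t)) sequentially"
    by (rule Weierstrass_m_test[OF _ sb]) (simp add: f'_def norm_mult)
  then have ul: "uniform_limit UNIV (\<lambda>n t. \<Sum>j<n. f' j t) (fser \<omega> ?b') sequentially"
  proof -
    have "(\<lambda>t. suminf (\<lambda>j. f' j t)) = fser \<omega> ?b'"
      unfolding f'_def by (rule ext) (rule sums_unique[OF ser[OF l1'], symmetric])
    then show ?thesis using \<open>uniform_limit UNIV (\<lambda>n t. \<Sum>j<n. f' j t) (\<lambda>t. suminf (\<lambda>j. f' j t)) sequentially\<close>
      by (simp only:)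
  qed
  have "\<exists>g. \<forall>t\<in>UNIV. (\<lambda>j. f j t) sums g t \<and> (g has_derivative (\<lambda>h. h *\<^sub>R fser \<omega> ?b' t)) (at t within UNIV)"
  proof (rule has_derivative_series)
    fix j and t :: real
    have "((\<lambda>t. osc \<omega> n t) has_vector_derivative (\<i> * of_int n * of_real \<omega>) * osc \<omega> n t) (at t)" for n
      unfolding osc_def by (rule has_vector_derivative_real_field) (auto intro!: derivative_eq_intros)
    from has_vector_derivative_mult_right[OF this, of "b (int_decode j)" "int_decode j"]
    have "(f j has_vector_derivative f' j t) (at t)" unfolding f_def f'_def by (simp add: mult_ac)
    then show "(f j has_derivative (\<lambda>h. h *\<^sub>R f' j t)) (at t within UNIV)"
      by (simp add: has_vector_derivative_def)
  next
    fix e :: real assume e: "0 < e"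
    from uniform_limitD[OF ul e]
    show "\<forall>\<^sub>F n in sequentially. \<forall>t\<in>UNIV. \<forall>h. norm ((\<Sum>j<n. h *\<^sub>R f' j t) - h *\<^sub>R fser \<omega> ?b' t) \<le> e * norm h"
    proof (rule eventually_mono, intro ballI allI)
      fix n t h assume "\<forall>t\<in>UNIV. dist (\<Sum>j<n. f' j t) (fser \<omega> ?b' t) < e"
      then have "norm ((\<Sum>j<n. f' j t) - fser \<omega> ?b' t) \<le> e" by (simp add: dist_norm less_imp_le)
      then have "\<bar>h\<bar> * norm ((\<Sum>j<n. f' j t) - fser \<omega> ?b' t) \<le> \<bar>h\<bar> * e" by (rule mult_left_mono) simp
      then show "norm ((\<Sum>j<n. h *\<^sub>R f' j t) - h *\<^sub>R fser \<omega> ?b' t) \<le> e * norm h"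
        by (simp add: scaleR_sum_right[symmetric] scaleR_diff_right[symmetric] mult.commute)
    qed
  next
    show "(\<lambda>j. f j 0) sums fser \<omega> b 0" unfolding f_def by (rule ser[OF assms(1)])
  qed auto
  then obtain g where g: "\<And>t. (\<lambda>j. f j t) sums g t" "\<And>t. (g has_derivative (\<lambda>h. h *\<^sub>R fser \<omega> ?b' t)) (at t)" by auto
  have "g = fser \<omega> b" using sums_unique2[OF g(1) ser[OF assms(1), folded f_def]] by blast
  with g(2) show ?thesis by (simp add: has_vector_derivative_def)
qed

text \<open>An antiderivative of \<open>fser \<omega> d t * cnj (osc \<omega> n t)\<close> is t * d
  n plus a periodic function. Over one period it changes by the period times \<open>d n\<close>, and
  the mean value inequality bounds that change.\<close>

lemma fourier_coefficient_bound:
  assumes "\<omega> > 0" and d: "l1 d" and bound: "\<And>t. norm (fser \<omega> d t) \<le> C"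
  shows "norm (d n) \<le> C"
proof -
  \<comment> \<open>Division by the frequency integrates the shifted series. The entry m = 0 is the
    mean \<open>d n\<close>, which goes into the linear term instead.\<close>
  define b where "b m = (if m = 0 then 0 else d (m + n) / (\<i> * of_real \<omega> * of_int m))" for m
  have bij: "bij (\<lambda>m::int. m + n)" by (rule bij_betw_byWitness[where f' = "\<lambda>m. m - n"]) auto
  have d': "l1 (\<lambda>m. d (m + n))"
    using d summable_on_reindex_bij_betw[OF bij, of "\<lambda>m. norm (d m)"] by simp
  have l1b': "l1 (\<lambda>m. of_int m * b m)"
  proof (rule summable_on_comparison_test[OF l1_cmult[OF d', of "1 / of_real \<omega>"]])
    fix m show "norm (of_int m * b m) \<le> norm (1 / of_real \<omega> * d (m + n))"
      using assms(1) by (cases "m = 0") (simp_all add: b_def norm_mult norm_divide)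
  qed auto
  have l1b: "l1 b"
  proof (rule summable_on_comparison_test[OF l1b'])
    fix m show "norm (b m) \<le> norm (of_int m * b m)"
    proof (cases "m = 0")
      case False
      then have "1 \<le> \<bar>real_of_int m\<bar>" by linarith
      then show ?thesis by (simp add: norm_mult mult_le_cancel_right1)
    qed (simp add: b_def)
  qed auto
  let ?\<Psi> = "\<lambda>t. of_real t * d n + fser \<omega> b t"
  have deriv: "(?\<Psi> has_vector_derivative fser \<omega> d t * cnj (osc \<omega> n t)) (at t)" for t
  proof -
    have e: "\<i> * of_real \<omega> * (of_int m * b m) = d (m + n) - (if m = 0 then d n else 0)" for m
      using assms(1) by (simp add: b_def)
    have "((\<lambda>m. d (m + n) * osc \<omega> (m + n) t) has_sum fser \<omega> d t) UNIV"
      using fser_has_sum[OF d, of \<omega> t] has_sum_reindex_bij_betw[OF bij, of "\<lambda>m. d m * osc \<omega> m t"] by simp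
    from has_sum_cmult_left[OF this, of "cnj (osc \<omega> n t)"]
    have "((\<lambda>m. d (m + n) * osc \<omega> m t) has_sum fser \<omega> d t * cnj (osc \<omega> n t)) UNIV"
    proof -
      have "osc \<omega> (m + n) t * cnj (osc \<omega> n t) = osc \<omega> m t" for m
        using osc_diff[of \<omega> "m + n" n t] by simp
      then have "d (m + n) * osc \<omega> (m + n) t * cnj (osc \<omega> n t) = d (m + n) * osc \<omega> m t" for m
        by (simp only: mult.assoc)
      then show ?thesis
        using \<open>((\<lambda>m. d (m + n) * osc \<omega> (m + n) t * cnj (osc \<omega> n t)) has_sum _) UNIV\<close> by (simp only:)
    qed
    from has_sum_cmult_right[OF this, of "1"] have A: "((\<lambda>m. d (m + n) * osc \<omega> m t) has_sum fser \<omega> d t * cnj (osc \<omega> n t)) UNIV" by simp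
    have B: "((\<lambda>m. (if m = 0 then d n else 0) * osc \<omega> m t) has_sum d n) UNIV"
    proof -
      have "((\<lambda>m. (if m = 0 then d n else 0) * osc \<omega> m t) has_sum (\<Sum>m\<in>{0}. (if m = 0 then d n else 0) * osc \<omega> m t)) {0}"
        by (rule has_sum_finite) simp
      then have "((\<lambda>m. (if m = 0 then d n else 0) * osc \<omega> m t) has_sum d n) {0}" by (simp add: osc_def)
      then show ?thesis
        by (subst has_sum_cong_neutral[where T = "{0}" and g = "\<lambda>m. (if m = 0 then d n else 0) * osc \<omega> m t"]) auto
    qed
    have "((\<lambda>m. d (m + n) * osc \<omega> m t - (if m = 0 then d n else 0) * osc \<omega> m t) has_sum fser \<omega> d t * cnj (osc \<omega> n t) - d n) UNIV"
      using has_sum_add[OF A has_sum_cmult_right[OF B, of "- 1"]] by simp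
    then have "fser \<omega> (\<lambda>m. \<i> * of_real \<omega> * (of_int m * b m)) t = fser \<omega> d t * cnj (osc \<omega> n t) - d n"
      unfolding e fser_def[of \<omega> "\<lambda>m. d (m + n) - (if m = 0 then d n else 0)"] left_diff_distrib by (rule infsumI)
    with fser_deriv[OF l1b l1b', of \<omega> t]
    have "(fser \<omega> b has_vector_derivative fser \<omega> d t * cnj (osc \<omega> n t) - d n) (at t)" by simp
    moreover have "((\<lambda>t. of_real t * d n) has_vector_derivative d n) (at t)"
      by (rule has_vector_derivative_real_field) (auto intro!: derivative_eq_intros)
    ultimately have "(?\<Psi> has_vector_derivative d n + (fser \<omega> d t * cnj (osc \<omega> n t) - d n)) (at t)"
      by (intro has_vector_derivative_add)
    then show ?thesis by simp
  qed
  let ?\<tau> = "2 * pi / \<omega>"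
  have tp: "0 < ?\<tau>" using assms(1) by simp
  have "norm (?\<Psi> ?\<tau> - ?\<Psi> 0) \<le> C * ?\<tau> - C * 0"
  proof (rule differentiable_bound_general[OF tp])
    show "continuous_on {0..?\<tau>} ?\<Psi>"
      by (intro continuous_at_imp_continuous_on ballI has_vector_derivative_continuous[OF deriv])
    show "(?\<Psi> has_vector_derivative fser \<omega> d t * cnj (osc \<omega> n t)) (at t)" for t by (rule deriv)
    show "((\<lambda>t. C * t) has_vector_derivative C) (at t)" for t
      by (auto intro!: derivative_eq_intros simp: has_real_derivative_iff_has_vector_derivative[symmetric])
    show "norm (fser \<omega> d t * cnj (osc \<omega> n t)) \<le> C" for t using bound by (simp add: norm_mult)
  qed (auto intro!: continuous_intros)
  moreover have "fser \<omega> b ?\<tau> = fser \<omega> b 0" using fser_periodic[OF assms(1), of b 0 1] by simp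
  ultimately have "norm (of_real ?\<tau> * d n) \<le> C * ?\<tau>" by simp
  then show ?thesis
    unfolding norm_mult norm_of_real abs_of_pos[OF tp] mult.commute[of C] mult_le_cancel_left_pos[OF tp] .
qed

text \<open>If the homogeneous solutions grow, a bounded solution is slaved to its forcing.\<close>

lemma bounded_solution_tendsto_zero:
  fixes h r :: "real \<Rightarrow> complex"
  assumes \<mu>: "Re \<mu> < 0" and deriv: "\<And>t. 0 < t \<Longrightarrow> (h has_vector_derivative - \<mu> * h t + r t) (at t)"
    and bound: "\<And>t. 0 < t \<Longrightarrow> norm (h t) \<le> B" and r: "(r \<longlongrightarrow> 0) at_top"
  shows "(h \<longlongrightarrow> 0) at_top"
proof (rule tendstoI)
  fix e :: real assume e: "0 < e"
  define \<rho> where "\<rho> = Re \<mu>"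
  have \<rho>: "\<rho> < 0" using \<mu> by (simp add: \<rho>_def)
  \<comment> \<open>Chosen so that \<open>\<delta> / (- \<rho>)\<close> equals e / 2.\<close>
  define \<delta> where "\<delta> = e * (- \<rho>) / 2"
  have \<delta>: "0 < \<delta>" using e \<rho> by (simp add: \<delta>_def mult_pos_neg)
  obtain T0 where T0: "\<And>t. T0 \<le> t \<Longrightarrow> norm (r t) < \<delta>"
    using tendstoD[OF r \<delta>] by (auto simp: eventually_at_top_linorder)
  \<comment> \<open>Compare with a later time s: the factor exp (\<rho> * (s - t)) in front of the
    bounded \<open>h s\<close> tends to 0 as s grows, and only the integrated forcing
    remains.\<close>
  have le: "norm (h t) \<le> \<delta> / (- \<rho>)" if t: "max T0 1 \<le> t" for t
  proof -
    have "norm (h t) \<le> exp (\<rho> * (s - t)) * B + \<delta> / (- \<rho>)" if s: "t < s" for s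
    proof -
      let ?\<phi> = "\<lambda>x. \<delta> / \<rho> * exp (\<rho> * x)"
      have d1: "((\<lambda>x. exp (\<mu> * of_real x) * h x) has_vector_derivative exp (\<mu> * of_real x) * r x) (at x)" if "0 < x" for x
      proof -
        have "((\<lambda>x. exp (\<mu> * of_real x)) has_vector_derivative \<mu> * exp (\<mu> * of_real x)) (at x)"
          by (rule has_vector_derivative_real_field) (auto intro!: derivative_eq_intros)
        from has_vector_derivative_mult[OF this deriv[OF that]] show ?thesis by (simp add: algebra_simps)
      qed
      have "norm (exp (\<mu> * of_real s) * h s - exp (\<mu> * of_real t) * h t) \<le> ?\<phi> s - ?\<phi> t"
      proof (rule differentiable_bound_general[OF s])
        show "continuous_on {t..s} (\<lambda>x. exp (\<mu> * of_real x) * h x)"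
          by (intro continuous_at_imp_continuous_on ballI has_vector_derivative_continuous[OF d1]) (use t in auto)
        show "continuous_on {t..s} ?\<phi>" by (intro continuous_intros) (use \<rho> in auto)
        fix x assume x: "t < x" "x < s"
        show "((\<lambda>x. exp (\<mu> * of_real x) * h x) has_vector_derivative exp (\<mu> * of_real x) * r x) (at x)"
          by (rule d1) (use x t in auto)
        show "(?\<phi> has_vector_derivative \<delta> * exp (\<rho> * x)) (at x)"
          using \<rho> by (auto intro!: derivative_eq_intros simp: has_real_derivative_iff_has_vector_derivative[symmetric])
        show "norm (exp (\<mu> * of_real x) * r x) \<le> \<delta> * exp (\<rho> * x)"
          using T0[of x] x t by (simp add: norm_mult \<rho>_def mult.commute mult_left_mono less_imp_le)
      qed
      also have "\<dots> \<le> \<delta> / (- \<rho>) * exp (\<rho> * t)"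
        using mult_nonpos_nonneg[OF less_imp_le[OF divide_pos_neg[OF \<delta> \<rho>]], of "exp (\<rho> * s)"] by simp
      finally have "norm (exp (\<mu> * of_real t) * h t) \<le> norm (exp (\<mu> * of_real s) * h s) + \<delta> / (- \<rho>) * exp (\<rho> * t)"
        using norm_triangle_ineq2[of "exp (\<mu> * of_real t) * h t" "exp (\<mu> * of_real s) * h s"]
        by (simp add: norm_minus_commute)
      then have "exp (\<rho> * t) * norm (h t) \<le> exp (\<rho> * s) * norm (h s) + \<delta> / (- \<rho>) * exp (\<rho> * t)"
        by (simp add: norm_mult \<rho>_def)
      also have "\<dots> \<le> exp (\<rho> * s) * B + \<delta> / (- \<rho>) * exp (\<rho> * t)"
        using bound[of s] s t by simp
      finally have "exp (- (\<rho> * t)) * (exp (\<rho> * t) * norm (h t)) \<le> exp (- (\<rho> * t)) * (exp (\<rho> * s) * B + \<delta> / (- \<rho>) * exp (\<rho> * t))"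
        by (rule mult_left_mono) simp
      then show ?thesis
        unfolding distrib_left mult.assoc[symmetric] mult.commute[of "exp (- (\<rho> * t))" "\<delta> / (- \<rho>)"]
        unfolding mult.assoc[of "\<delta> / (- \<rho>)"] exp_add[symmetric]
        by (simp add: right_diff_distrib)
    qed
    then have ev: "\<forall>\<^sub>F s in at_top. norm (h t) \<le> exp (\<rho> * (s - t)) * B + \<delta> / (- \<rho>)"
      using eventually_gt_at_top[of t] by (rule eventually_mono[rotated])
    have "((\<lambda>s. exp (\<rho> * (s - t)) * B + \<delta> / (- \<rho>)) \<longlongrightarrow> 0 * B + \<delta> / (- \<rho>)) at_top"
    proof (intro tendsto_intros)
      have "filterlim (\<lambda>s. s - t) at_top at_top"
        using filterlim_tendsto_add_at_top[OF tendsto_const[of "- t"] filterlim_ident[of at_top]] by simp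
      then have "filterlim (\<lambda>s. \<rho> * (s - t)) at_bot at_top"
        by (rule filterlim_tendsto_neg_mult_at_bot[OF tendsto_const \<rho>])
      then show "((\<lambda>s. exp (\<rho> * (s - t))) \<longlongrightarrow> 0) at_top"
        by (rule filterlim_compose[OF exp_at_bot])
    qed
    from tendsto_lowerbound[OF this ev] show ?thesis by simp
  qed
  have "\<delta> / (- \<rho>) < e" using e \<rho> by (simp add: \<delta>_def)
  with le have "\<forall>t\<ge>max T0 1. dist (h t) 0 < e" by (auto intro: order_le_less_trans)
  then show "\<forall>\<^sub>F t in at_top. dist (h t) 0 < e" unfolding eventually_at_top_linorder by blast
qed

section \<open>Holomorphic families of Fourier coefficients\<close>

text \<open>Holomorphic families of absolutely summable sequences, with summable majorants uniform
  on compact sets. On an open set this class is stable under sums, multiplication by holomorphic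
  functions and \<open>conv3\<close>, as the induction on the order demands.\<close>

definition wiener_family :: "complex set \<Rightarrow> (int \<Rightarrow> complex \<Rightarrow> complex) \<Rightarrow> bool"
  where "wiener_family H f \<longleftrightarrow> (\<forall>n. f n holomorphic_on H) \<and>
    (\<forall>K. compact K \<longrightarrow> K \<subseteq> H \<longrightarrow>
      (\<exists>b. b summable_on UNIV \<and> (\<forall>n. 0 \<le> b n) \<and> (\<forall>n. \<forall>k\<in>K. norm (f n k) \<le> (b n :: real))))"

lemma wiener_familyE:
  assumes "wiener_family H f" "compact K" "K \<subseteq> H"
  obtains b :: "int \<Rightarrow> real" where "b summable_on UNIV" "\<And>n. 0 \<le> b n" "\<And>n k. k \<in> K \<Longrightarrow> norm (f n k) \<le> b n"
proof -
  have "\<exists>b. b summable_on UNIV \<and> (\<forall>n. 0 \<le> b n) \<and> (\<forall>n. \<forall>k\<in>K. norm (f n k) \<le> (b n :: real))"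
    using assms unfolding wiener_family_def by blast
  then show ?thesis using that by blast
qed

lemma wiener_family_holomorphic: "wiener_family H f \<Longrightarrow> f n holomorphic_on H"
  by (simp add: wiener_family_def)

lemma wiener_family_l1:
  assumes "wiener_family H f" "k \<in> H"
  shows "l1 (\<lambda>n. f n k)"
proof -
  have K: "compact {k}" "{k} \<subseteq> H" using assms(2) by simp_all
  obtain b :: "int \<Rightarrow> real" where b: "b summable_on UNIV" "\<And>n. 0 \<le> b n" "\<And>n k'. k' \<in> {k} \<Longrightarrow> norm (f n k') \<le> b n"
    by (rule wiener_familyE[OF assms(1) K]) (rule that)
  show ?thesis by (rule summable_on_comparison_test[OF b(1)]) (simp_all add: b(3))
qed

lemma wiener_family_const:
  assumes "l1 a"
  shows "wiener_family H (\<lambda>n k. a n)"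
  unfolding wiener_family_def
proof (intro conjI allI impI)
  fix K :: "complex set"
  show "\<exists>b. b summable_on UNIV \<and> (\<forall>n. 0 \<le> b n) \<and> (\<forall>n. \<forall>k\<in>K. norm (a n) \<le> b n)"
    by (rule exI[of _ "\<lambda>n. norm (a n)"]) (simp add: assms)
qed simp

lemma wiener_family_add:
  assumes "wiener_family H f" "wiener_family H g"
  shows "wiener_family H (\<lambda>n k. f n k + g n k)"
  unfolding wiener_family_def
proof (intro conjI allI impI)
  show "(\<lambda>k. f n k + g n k) holomorphic_on H" for n
    by (intro holomorphic_intros wiener_family_holomorphic assms)
  fix K assume K: "compact K" "K \<subseteq> H"
  obtain b where b: "b summable_on UNIV" "\<And>n. 0 \<le> b n" "\<And>n k. k \<in> K \<Longrightarrow> norm (f n k) \<le> b n"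
    by (rule wiener_familyE[OF assms(1) K]) (rule that)
  obtain b' where b': "b' summable_on UNIV" "\<And>n. 0 \<le> b' n" "\<And>n k. k \<in> K \<Longrightarrow> norm (g n k) \<le> b' n"
    by (rule wiener_familyE[OF assms(2) K]) (rule that)
  show "\<exists>b. b summable_on UNIV \<and> (\<forall>n. 0 \<le> b n) \<and> (\<forall>n. \<forall>k\<in>K. norm (f n k + g n k) \<le> b n)"
    by (intro exI[of _ "\<lambda>n. b n + b' n"] conjI summable_on_add b(1) b'(1))
      (auto intro!: add_nonneg_nonneg b(2) b'(2) order_trans[OF norm_triangle_ineq] add_mono b(3) b'(3))
qed

lemma wiener_family_mult:
  assumes "wiener_family H f" "p holomorphic_on H"
  shows "wiener_family H (\<lambda>n k. p k * f n k)"
  unfolding wiener_family_def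
proof (intro conjI allI impI)
  show "(\<lambda>k. p k * f n k) holomorphic_on H" for n
    by (intro holomorphic_intros wiener_family_holomorphic assms)
  fix K assume K: "compact K" "K \<subseteq> H"
  obtain b where b: "b summable_on UNIV" "\<And>n. 0 \<le> b n" "\<And>n k. k \<in> K \<Longrightarrow> norm (f n k) \<le> b n"
    by (rule wiener_familyE[OF assms(1) K]) (rule that)
  have "bounded (p ` K)"
    by (intro compact_imp_bounded compact_continuous_image K continuous_on_subset[OF holomorphic_on_imp_continuous_on[OF assms(2)] K(2)])
  then obtain L where L: "0 < L" "\<And>k. k \<in> K \<Longrightarrow> norm (p k) \<le> L" by (auto simp: bounded_pos)
  show "\<exists>b. b summable_on UNIV \<and> (\<forall>n. 0 \<le> b n) \<and> (\<forall>n. \<forall>k\<in>K. norm (p k * f n k) \<le> b n)"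
    by (intro exI[of _ "\<lambda>n. L * b n"] conjI summable_on_cmult_right b(1))
      (auto simp: norm_mult intro!: mult_nonneg_nonneg b(2) mult_mono L(2) b(3) L(1)[THEN less_imp_le])
qed

lemma wiener_family_sum:
  "(\<And>i. i \<in> I \<Longrightarrow> wiener_family H (f i)) \<Longrightarrow> wiener_family H (\<lambda>n k. \<Sum>i\<in>I. f i n k)"
proof (induction I rule: infinite_finite_induct)
  case (insert i I)
  have "wiener_family H (\<lambda>n k. f i n k + (\<Sum>i\<in>I. f i n k))"
    by (rule wiener_family_add) (use insert in blast)+
  then show ?case unfolding sum.insert[OF insert.hyps] .
next
  case (infinite I)
  show ?case unfolding sum.infinite[OF infinite.hyps] by (rule wiener_family_const[of "\<lambda>n. 0"]) simp
next
  case empty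
  show ?case unfolding sum.empty by (rule wiener_family_const[of "\<lambda>n. 0"]) simp
qed

lemma holomorphic_on_locally:
  assumes "\<And>z. z \<in> H \<Longrightarrow> \<exists>r>0. f holomorphic_on ball z r"
  shows "f holomorphic_on H"
  unfolding holomorphic_on_def
proof
  fix z assume "z \<in> H"
  then obtain r where "0 < r" "f holomorphic_on ball z r" using assms by blast
  then have "f field_differentiable at z" by (auto intro!: holomorphic_on_imp_differentiable_at)
  then show "f field_differentiable at z within H" by (rule field_differentiable_at_within)
qed

text \<open>The conjugated sequence is taken independent of k, since conjugation would destroy
  holomorphy. Locally uniform convergence comes from the M-test over finite sets of index
  pairs.\<close>

lemma wiener_family_conv3:
  assumes H: "open H" and a: "l1 a" and f: "wiener_family H f" and g: "wiener_family H g"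
  shows "wiener_family H (\<lambda>n k. conv3 a (\<lambda>m. f m k) (\<lambda>m. g m k) n)"
  unfolding wiener_family_def
proof (intro conjI allI impI)
  fix n
  show "(\<lambda>k. conv3 a (\<lambda>m. f m k) (\<lambda>m. g m k) n) holomorphic_on H"
  proof (rule holomorphic_on_locally)
    fix z assume "z \<in> H"
    then obtain r where r: "0 < r" "cball z r \<subseteq> H" using H open_contains_cball by blast
    obtain b where b: "b summable_on UNIV" "\<And>n. 0 \<le> b n" "\<And>n k. k \<in> cball z r \<Longrightarrow> norm (f n k) \<le> b n"
      by (rule wiener_familyE[OF f compact_cball r(2)]) (rule that)
    obtain b' where b': "b' summable_on UNIV" "\<And>n. 0 \<le> b' n" "\<And>n k. k \<in> cball z r \<Longrightarrow> norm (g n k) \<le> b' n"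
      by (rule wiener_familyE[OF g compact_cball r(2)]) (rule that)
    let ?t = "\<lambda>x k. case x of (l, m) \<Rightarrow> cnj (a l) * f m k * g (n + l - m) k"
    have ul: "uniform_limit (cball z r) (\<lambda>X k. \<Sum>x\<in>X. ?t x k) (\<lambda>k. \<Sum>\<^sub>\<infinity>x\<in>UNIV. ?t x k) (finite_subsets_at_top UNIV)"
    proof (rule Weierstrass_m_test_general)
      show "(\<lambda>(l, m). norm (a l) * b m * b' (n + l - m)) summable_on UNIV"
        by (rule conv3_majorant(1)[OF a b(1) b'(1)]) (use b b' in auto)
      fix x k assume k: "k \<in> cball z r"
      show "norm (?t x k) \<le> (case x of (l, m) \<Rightarrow> norm (a l) * b m * b' (n + l - m))"
        by (cases x) (auto simp: norm_mult intro!: mult_mono mult_nonneg_nonneg b(2) b'(2) b(3)[OF k] b'(3)[OF k])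
    qed
    have ev: "\<forall>\<^sub>F X in finite_subsets_at_top UNIV. continuous_on (cball z r) (\<lambda>k. \<Sum>x\<in>X. ?t x k) \<and>
        (\<lambda>k. \<Sum>x\<in>X. ?t x k) holomorphic_on ball z r"
    proof (rule always_eventually, rule allI)
      fix X :: "(int \<times> int) set"
      have "(\<lambda>k. \<Sum>x\<in>X. ?t x k) holomorphic_on H"
        unfolding case_prod_unfold
        by (intro holomorphic_intros wiener_family_holomorphic[OF f] wiener_family_holomorphic[OF g])
      then show "continuous_on (cball z r) (\<lambda>k. \<Sum>x\<in>X. ?t x k) \<and> (\<lambda>k. \<Sum>x\<in>X. ?t x k) holomorphic_on ball z r"
        using r(2) ball_subset_cball[of z r]
        by (meson continuous_on_subset holomorphic_on_imp_continuous_on holomorphic_on_subset order_trans)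
    qed
    have "(\<lambda>k. \<Sum>\<^sub>\<infinity>x\<in>UNIV. ?t x k) holomorphic_on ball z r"
      by (rule holomorphic_uniform_limit[OF ev ul finite_subsets_at_top_neq_bot])
    then show "\<exists>r>0. (\<lambda>k. conv3 a (\<lambda>m. f m k) (\<lambda>m. g m k) n) holomorphic_on ball z r"
      unfolding conv3_def using r(1) by blast
  qed
next
  fix K assume K: "compact K" "K \<subseteq> H"
  obtain b where b: "b summable_on UNIV" "\<And>n. 0 \<le> b n" "\<And>n k. k \<in> K \<Longrightarrow> norm (f n k) \<le> b n"
    by (rule wiener_familyE[OF f K]) (rule that)
  obtain b' where b': "b' summable_on UNIV" "\<And>n. 0 \<le> b' n" "\<And>n k. k \<in> K \<Longrightarrow> norm (g n k) \<le> b' n"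
    by (rule wiener_familyE[OF g K]) (rule that)
  let ?b = "\<lambda>n. \<Sum>\<^sub>\<infinity>(l, m)\<in>UNIV. norm (a l) * b m * b' (n + l - m)"
  note maj = conv3_majorant[OF a b(1) b'(1) norm_ge_zero b(2) b'(2)]
  have "norm (conv3 a (\<lambda>m. f m k) (\<lambda>m. g m k) n) \<le> ?b n" if k: "k \<in> K" for n k
  proof -
    have l: "l1 (\<lambda>m. f m k)" "l1 (\<lambda>m. g m k)"
      using wiener_family_l1[OF f] wiener_family_l1[OF g] k K(2) by auto
    have "norm (conv3 a (\<lambda>m. f m k) (\<lambda>m. g m k) n) \<le> (\<Sum>\<^sub>\<infinity>(l, m)\<in>UNIV. norm (a l) * norm (f m k) * norm (g (n + l - m) k))"
      by (rule norm_conv3_le[OF a l])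
    also have "\<dots> \<le> ?b n"
    proof (rule infsum_mono)
      show "(\<lambda>(l, m). norm (a l) * norm (f m k) * norm (g (n + l - m) k)) summable_on UNIV"
        by (rule conv3_majorant(1)[OF a l]) auto
      show "(\<lambda>(l, m). norm (a l) * b m * b' (n + l - m)) summable_on UNIV" by (rule maj(1))
      show "(case x of (l, m) \<Rightarrow> norm (a l) * norm (f m k) * norm (g (n + l - m) k)) \<le> (case x of (l, m) \<Rightarrow> norm (a l) * b m * b' (n + l - m))" for x
        by (cases x) (auto intro!: mult_mono mult_nonneg_nonneg b(2) b'(2) b(3)[OF k] b'(3)[OF k])
    qed
    finally show ?thesis .
  qed
  moreover have "0 \<le> ?b n" for n
    by (rule infsum_nonneg) (auto intro!: mult_nonneg_nonneg b(2) b'(2))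
  ultimately show "\<exists>b. b summable_on UNIV \<and> (\<forall>n. 0 \<le> b n) \<and> (\<forall>n. \<forall>k\<in>K. norm (conv3 a (\<lambda>m. f m k) (\<lambda>m. g m k) n) \<le> b n)"
    using maj(2) by blast
qed

section \<open>Removing the zeros of the denominator\<close>

text \<open>A neighbourhood of the closed first quadrant that contains \<open>k1 \<omega> n\<close>, but not \<open>- k1 \<omega> n\<close> for \<open>n \<noteq> 0\<close>.\<close>

definition nbhd :: "real \<Rightarrow> complex set"
  where "nbhd \<omega> = {k. - (sqrt \<omega> / 2) < Re k} \<inter> {k. - (sqrt \<omega> / 2) < Im k}"

lemma open_nbhd: "open (nbhd \<omega>)"
  unfolding nbhd_def by (intro open_Int open_halfspace_Re_gt open_halfspace_Im_gt)

lemma nbhd_superset: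
  assumes "\<omega> > 0" "0 \<le> Re k" "0 \<le> Im k"
  shows "k \<in> nbhd \<omega>"
  unfolding nbhd_def Int_iff mem_Collect_eq
  using real_sqrt_gt_zero[OF assms(1)] assms(2,3) by (intro conjI) linarith+

lemma open_D1: "open D1"
  unfolding D1_def by (intro open_Int open_halfspace_Re_gt open_halfspace_Im_gt)

lemma D1_approx:
  assumes "0 \<le> Re k" "0 \<le> Im k"
  shows "(\<lambda>j. k + (1 + \<i>) * of_real (inverse (real (Suc j)))) \<longlonglongrightarrow> k"
    "k + (1 + \<i>) * of_real (inverse (real (Suc j))) \<in> D1"
proof -
  have "(\<lambda>j. k + (1 + \<i>) * of_real (inverse (real (Suc j)))) \<longlonglongrightarrow> k + (1 + \<i>) * of_real 0"
    by (intro tendsto_intros LIMSEQ_inverse_real_of_nat)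
  then show "(\<lambda>j. k + (1 + \<i>) * of_real (inverse (real (Suc j)))) \<longlonglongrightarrow> k" by simp
  have "0 < inverse (real (Suc j))" by simp
  then show "k + (1 + \<i>) * of_real (inverse (real (Suc j))) \<in> D1"
    using assms by (simp add: D1_def add_nonneg_pos del: of_real_inverse)
qed

lemma frontier_D1: "frontier D1 = {k. 0 \<le> Re k \<and> 0 \<le> Im k \<and> (Re k = 0 \<or> Im k = 0)}"
proof -
  have "closure D1 = {k. 0 \<le> Re k \<and> 0 \<le> Im k}"
  proof (rule antisym)
    have "closed ({k. 0 \<le> Re k} \<inter> {k. 0 \<le> Im k})"
      by (intro closed_Int closed_halfspace_Re_ge closed_halfspace_Im_ge)
    then show "closure D1 \<subseteq> {k. 0 \<le> Re k \<and> 0 \<le> Im k}"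
      by (intro closure_minimal) (auto simp: D1_def Collect_conj_eq)
    show "{k. 0 \<le> Re k \<and> 0 \<le> Im k} \<subseteq> closure D1"
    proof
      fix k assume "k \<in> {k. 0 \<le> Re k \<and> 0 \<le> Im k}"
      then have k: "0 \<le> Re k" "0 \<le> Im k" by auto
      show "k \<in> closure D1"
        unfolding closure_sequential
        by (rule exI[of _ "\<lambda>j. k + (1 + \<i>) * of_real (inverse (real (Suc j)))"])
          (intro conjI allI D1_approx[OF k])
    qed
  qed
  moreover have "interior D1 = D1" by (rule interior_open[OF open_D1])
  ultimately show ?thesis unfolding frontier_def by (auto simp: D1_def)
qed

lemma k1_Re_Im: "0 \<le> Re (k1 \<omega> n)" "0 \<le> Im (k1 \<omega> n)" if "\<omega> > 0"
  using that by (simp_all add: k1_def mult_nonpos_nonneg)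

lemma k1_frontier: "\<omega> > 0 \<Longrightarrow> k1 \<omega> n \<in> frontier D1"
  using k1_Re_Im[of \<omega> n] unfolding frontier_D1 by (simp add: k1_def)

lemma k1_square:
  assumes "\<omega> > 0"
  shows "4 * (k1 \<omega> n)\<^sup>2 = - (of_int n * of_real \<omega>)"
proof (cases "n \<ge> 0")
  case True
  then have "(complex_of_real (sqrt (of_int n * \<omega>)))\<^sup>2 = of_real (of_int n * \<omega>)"
    using assms by (simp add: of_real_power[symmetric] del: of_real_mult of_real_power)
  then show ?thesis using True by (simp add: k1_def power_mult_distrib power_divide)
next
  case False
  then have "(complex_of_real (sqrt (- of_int n * \<omega>)))\<^sup>2 = of_real (- of_int n * \<omega>)"
    using assms by (simp add: of_real_power[symmetric] mult_nonpos_nonneg del: of_real_mult of_real_power)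
  then show ?thesis using False by (simp add: k1_def power_mult_distrib power_divide)
qed

lemma denominator_factor:
  assumes "\<omega> > 0"
  shows "4 * \<i> * k\<^sup>2 + \<i> * of_int n * of_real \<omega> = 4 * \<i> * (k - k1 \<omega> n) * (k + k1 \<omega> n)"
proof -
  have "4 * \<i> * (k - k1 \<omega> n) * (k + k1 \<omega> n) = 4 * \<i> * k\<^sup>2 - \<i> * (4 * (k1 \<omega> n)\<^sup>2)"
    by (simp add: power2_eq_square algebra_simps)
  then show ?thesis unfolding k1_square[OF assms] by simp
qed

lemma minus_k1_notin_nbhd:
  assumes "\<omega> > 0" "n \<noteq> 0"
  shows "- k1 \<omega> n \<notin> nbhd \<omega>"
proof (cases "n \<ge> 0")
  case True
  then have "1 \<le> real_of_int n" using assms by linarith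
  then have "sqrt \<omega> \<le> sqrt (of_int n * \<omega>)" using assms by (simp add: mult_le_cancel_right1)
  then show ?thesis using True by (simp add: nbhd_def k1_def)
next
  case False
  then have "1 \<le> - real_of_int n" by linarith
  then have "1 * \<omega> \<le> - of_int n * \<omega>" using assms by (intro mult_right_mono) auto
  then have "sqrt \<omega> \<le> sqrt (- of_int n * \<omega>)" by simp
  then show ?thesis using False by (simp add: nbhd_def k1_def)
qed

text \<open>An estimate proved inside the quadrant reaches its closure along the diagonal sequences
  of \<open>D1_approx\<close>.\<close>

lemma limit_bound_on_D1:
  assumes "continuous_on S F" "continuous_on S Q" "open S" "k \<in> S" "0 \<le> Re k" "0 \<le> Im k"
    and "\<And>k. k \<in> D1 \<Longrightarrow> norm (F k :: complex) \<le> Q k"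
  shows "norm (F k) \<le> Q k"
proof -
  let ?x = "\<lambda>j. k + (1 + \<i>) * of_real (inverse (real (Suc j)))"
  have c: "isCont F k" "isCont Q k" using assms(1-4) by (auto simp: continuous_on_eq_continuous_at)
  have "(\<lambda>j. norm (F (?x j))) \<longlonglongrightarrow> norm (F k)" "(\<lambda>j. Q (?x j)) \<longlonglongrightarrow> Q k"
    by (intro tendsto_norm isCont_tendsto_compose[OF c(1) D1_approx(1)] isCont_tendsto_compose[OF c(2) D1_approx(1)] assms)+
  then show ?thesis
    by (rule LIMSEQ_le) (use assms(7) D1_approx(2)[OF assms(5,6)] in blast)
qed

text \<open>Letting k tend to \<open>k1 \<omega> n\<close> from inside the quadrant shows that F
  vanishes there, so a linear factor divides off. For n \<noteq> 0 the other zero of the denominator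
  lies outside \<open>nbhd \<omega>\<close>; for n = 0 the two zeros merge at 0 and a second
  division is needed.\<close>

lemma remove_denominator:
  assumes \<omega>: "\<omega> > 0" and F: "F holomorphic_on nbhd \<omega>"
    and bound: "\<And>k. k \<in> D1 \<Longrightarrow> norm (F k) \<le> C * norm (4 * \<i> * k\<^sup>2 + \<i> * of_int n * of_real \<omega>)"
  obtains r where "r holomorphic_on nbhd \<omega>"
    "\<And>k. k \<in> nbhd \<omega> \<Longrightarrow> (4 * \<i> * k\<^sup>2 + \<i> * of_int n * of_real \<omega>) * r k = F k"
proof -
  define \<kappa> where "\<kappa> = k1 \<omega> n"
  note den = denominator_factor[OF \<omega>, of _ n, folded \<kappa>_def]
  have \<kappa>: "\<kappa> \<in> nbhd \<omega>" "0 \<le> Re \<kappa>" "0 \<le> Im \<kappa>"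
    unfolding \<kappa>_def using k1_Re_Im[OF \<omega>] nbhd_superset[OF \<omega>] by auto
  have "norm (F \<kappa>) \<le> C * norm (4 * \<i> * \<kappa>\<^sup>2 + \<i> * of_int n * of_real \<omega>)"
    by (rule limit_bound_on_D1[OF holomorphic_on_imp_continuous_on[OF F] _ open_nbhd \<kappa> bound])
      (auto intro!: continuous_intros)
  then have F0: "F \<kappa> = 0" unfolding den by simp
  define q where "q z = (if z = \<kappa> then deriv F \<kappa> else (F z - F \<kappa>) / (z - \<kappa>))" for z
  have q: "q holomorphic_on nbhd \<omega>" unfolding q_def by (rule pole_lemma_open[OF F open_nbhd])
  have qF: "(z - \<kappa>) * q z = F z" for z by (simp add: q_def F0)
  show ?thesis
  proof (cases "n = 0")
    case False
    have nz: "z + \<kappa> \<noteq> 0" if "z \<in> nbhd \<omega>" for z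
      using minus_k1_notin_nbhd[OF \<omega> False, folded \<kappa>_def] that by (metis add_eq_0_iff2)
    show ?thesis
    proof (rule that)
      show "(\<lambda>z. q z / (4 * \<i> * (z + \<kappa>))) holomorphic_on nbhd \<omega>"
        by (intro holomorphic_intros q) (use nz in auto)
      fix k assume "k \<in> nbhd \<omega>"
      then show "(4 * \<i> * k\<^sup>2 + \<i> * of_int n * of_real \<omega>) * (q k / (4 * \<i> * (k + \<kappa>))) = F k"
      proof -
        have "4 * \<i> * (k - \<kappa>) * (k + \<kappa>) * (q k / (4 * \<i> * (k + \<kappa>))) = ((k - \<kappa>) * q k) * ((4 * \<i> * (k + \<kappa>)) / (4 * \<i> * (k + \<kappa>)))"
          by simp
        also have "\<dots> = F k" using nz[OF \<open>k \<in> nbhd \<omega>\<close>] qF[of k] by simp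
        finally show ?thesis unfolding den .
      qed
    qed
  next
    case True
    then have \<kappa>0: "\<kappa> = 0" by (simp add: \<kappa>_def k1_def)
    \<comment> \<open>After one division the bound still carries a factor \<open>norm k\<close>, so
      q vanishes at 0 and can be divided again.\<close>
    have "norm (q \<kappa>) \<le> 4 * C * norm \<kappa>"
    proof (rule limit_bound_on_D1[OF holomorphic_on_imp_continuous_on[OF q] _ open_nbhd \<kappa>])
      fix k assume k: "k \<in> D1"
      then have "k \<noteq> 0" by (auto simp: D1_def)
      have "norm (k * q k) \<le> C * (4 * norm k * norm k)"
        using bound[OF k] qF[of k] by (simp add: \<kappa>0 True norm_mult power2_eq_square)
      then have "norm k * norm (q k) \<le> norm k * (4 * C * norm k)" by (simp add: norm_mult mult_ac)
      then show "norm (q k) \<le> 4 * C * norm k" using \<open>k \<noteq> 0\<close> by simp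
    qed (auto intro!: continuous_intros)
    then have q0: "q 0 = 0" by (simp add: \<kappa>0)
    define q' where "q' z = (if z = 0 then deriv q 0 else (q z - q 0) / (z - 0))" for z
    have q': "q' holomorphic_on nbhd \<omega>" unfolding q'_def by (rule pole_lemma_open[OF q open_nbhd])
    have q'q: "z * q' z = q z" for z by (simp add: q'_def q0)
    show ?thesis
    proof (rule that)
      \<comment> \<open>\<open>- \<i> / 4\<close> is the inverse of \<open>4 * \<i>\<close>, the
        coefficient of k^2 in the denominator.\<close>
      show "(\<lambda>z. (- \<i> / 4) * q' z) holomorphic_on nbhd \<omega>" by (intro holomorphic_intros q') auto
      fix k
      have "4 * \<i> * k\<^sup>2 * ((- \<i> / 4) * q' k) = (4 * \<i> * (- \<i> / 4)) * (k * (k * q' k))"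
        by (simp only: power2_eq_square mult_ac)
      also have "4 * \<i> * (- \<i> / 4) = 1" by simp
      finally show "(4 * \<i> * k\<^sup>2 + \<i> * of_int n * of_real \<omega>) * ((- \<i> / 4) * q' k) = F k"
        using qF[of k] q'q[of k] by (simp add: \<kappa>0 True)
    qed
  qed
qed

section \<open>The asymptotic Fourier coefficients\<close>

definition asymptotic_to :: "real \<Rightarrow> (real \<Rightarrow> complex) \<Rightarrow> (int \<Rightarrow> complex) \<Rightarrow> bool"
  where "asymptotic_to \<omega> x \<alpha> \<longleftrightarrow> l1 \<alpha> \<and> ((\<lambda>t. x t - fser \<omega> \<alpha> t) \<longlongrightarrow> 0) at_top"

lemma asymptotic_to_add:
  assumes "asymptotic_to \<omega> x \<alpha>" "asymptotic_to \<omega> y \<beta>"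
  shows "asymptotic_to \<omega> (\<lambda>t. x t + y t) (\<lambda>n. \<alpha> n + \<beta> n)"
proof -
  have l: "l1 \<alpha>" "l1 \<beta>" using assms by (simp_all add: asymptotic_to_def)
  have "((\<lambda>t. (x t - fser \<omega> \<alpha> t) + (y t - fser \<omega> \<beta> t)) \<longlongrightarrow> 0 + 0) at_top"
    using assms unfolding asymptotic_to_def by (intro tendsto_add) blast+
  moreover have "(\<lambda>t. (x t - fser \<omega> \<alpha> t) + (y t - fser \<omega> \<beta> t)) = (\<lambda>t. x t + y t - fser \<omega> (\<lambda>n. \<alpha> n + \<beta> n) t)"
    by (simp add: fser_add[OF l] algebra_simps)
  ultimately show ?thesis unfolding asymptotic_to_def using l1_add[OF l] by simp
qed

lemma asymptotic_to_cmult: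
  assumes "asymptotic_to \<omega> x \<alpha>"
  shows "asymptotic_to \<omega> (\<lambda>t. b * x t) (\<lambda>n. b * \<alpha> n)"
proof -
  have l: "l1 \<alpha>" using assms by (simp add: asymptotic_to_def)
  have "((\<lambda>t. b * (x t - fser \<omega> \<alpha> t)) \<longlongrightarrow> b * 0) at_top"
    using assms unfolding asymptotic_to_def by (intro tendsto_mult tendsto_const) blast
  moreover have "(\<lambda>t. b * (x t - fser \<omega> \<alpha> t)) = (\<lambda>t. b * x t - fser \<omega> (\<lambda>n. b * \<alpha> n) t)"
    by (simp add: fser_cmult[OF l] algebra_simps)
  ultimately show ?thesis unfolding asymptotic_to_def using l1_cmult[OF l] by simp
qed

lemma asymptotic_to_sum:
  assumes "finite I" "\<And>i. i \<in> I \<Longrightarrow> asymptotic_to \<omega> (x i) (\<alpha> i)"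
  shows "asymptotic_to \<omega> (\<lambda>t. \<Sum>i\<in>I. x i t) (\<lambda>n. \<Sum>i\<in>I. \<alpha> i n)"
proof -
  have l: "l1 (\<alpha> i)" if "i \<in> I" for i using assms(2)[OF that] by (simp add: asymptotic_to_def)
  have "((\<lambda>t. \<Sum>i\<in>I. x i t - fser \<omega> (\<alpha> i) t) \<longlongrightarrow> (\<Sum>i\<in>I. 0)) at_top"
    using assms(2) unfolding asymptotic_to_def by (intro tendsto_sum) blast
  moreover have "(\<lambda>t. \<Sum>i\<in>I. x i t - fser \<omega> (\<alpha> i) t) = (\<lambda>t. (\<Sum>i\<in>I. x i t) - fser \<omega> (\<lambda>n. \<Sum>i\<in>I. \<alpha> i n) t)"
    by (simp add: fser_sum[OF assms(1) l] sum_subtractf)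
  ultimately show ?thesis unfolding asymptotic_to_def using l1_sum[of I \<alpha>] l by simp
qed

lemma tendsto_zero_mult_bounded:
  fixes x y :: "real \<Rightarrow> complex"
  assumes "(x \<longlongrightarrow> 0) at_top" "\<And>t. norm (y t) \<le> B"
  shows "((\<lambda>t. x t * y t) \<longlongrightarrow> 0) at_top"
proof (rule Lim_null_comparison)
  show "\<forall>\<^sub>F t in at_top. norm (x t * y t) \<le> norm (x t) * B"
    by (rule always_eventually) (simp add: norm_mult mult_left_mono assms(2))
  have "((\<lambda>t. norm (x t) * B) \<longlongrightarrow> norm (0::complex) * B) at_top"
    by (intro tendsto_intros assms(1))
  then show "((\<lambda>t. norm (x t) * B) \<longlongrightarrow> 0) at_top" by simp
qed

text \<open>Bounds on the periodic parts x' and y' suffice: the product of the two errors tends to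
  0, and each single error meets a bounded factor.\<close>

lemma asymptotic_mult:
  fixes x y x' y' :: "real \<Rightarrow> complex"
  assumes "((\<lambda>t. x t - x' t) \<longlongrightarrow> 0) at_top" "((\<lambda>t. y t - y' t) \<longlongrightarrow> 0) at_top"
    and "\<And>t. norm (x' t) \<le> B" "\<And>t. norm (y' t) \<le> B'"
  shows "((\<lambda>t. x t * y t - x' t * y' t) \<longlongrightarrow> 0) at_top"
proof -
  have "((\<lambda>t. (x t - x' t) * (y t - y' t) + (x t - x' t) * y' t + (y t - y' t) * x' t) \<longlongrightarrow> 0 * 0 + 0 + 0) at_top"
    by (intro tendsto_add tendsto_mult[OF assms(1,2)] tendsto_zero_mult_bounded[OF assms(1,4)] tendsto_zero_mult_bounded[OF assms(2,3)])
  moreover have "(\<lambda>t. (x t - x' t) * (y t - y' t) + (x t - x' t) * y' t + (y t - y' t) * x' t) = (\<lambda>t. x t * y t - x' t * y' t)"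
    by (simp add: algebra_simps)
  ultimately show ?thesis by simp
qed

lemma asymptotic_to_conv3:
  assumes "asymptotic_to \<omega> x \<alpha>" "asymptotic_to \<omega> y \<beta>" "asymptotic_to \<omega> z \<gamma>"
  shows "asymptotic_to \<omega> (\<lambda>t. cnj (x t) * y t * z t) (conv3 \<alpha> \<beta> \<gamma>)"
proof -
  have l: "l1 \<alpha>" "l1 \<beta>" "l1 \<gamma>" using assms by (simp_all add: asymptotic_to_def)
  have t: "((\<lambda>t. x t - fser \<omega> \<alpha> t) \<longlongrightarrow> 0) at_top" "((\<lambda>t. y t - fser \<omega> \<beta> t) \<longlongrightarrow> 0) at_top"
    "((\<lambda>t. z t - fser \<omega> \<gamma> t) \<longlongrightarrow> 0) at_top" using assms by (simp_all add: asymptotic_to_def)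
  have c: "((\<lambda>t. cnj (x t) - cnj (fser \<omega> \<alpha> t)) \<longlongrightarrow> 0) at_top"
    using tendsto_cnj[OF t(1)] by simp
  have "((\<lambda>t. cnj (x t) * y t * z t - cnj (fser \<omega> \<alpha> t) * fser \<omega> \<beta> t * fser \<omega> \<gamma> t) \<longlongrightarrow> 0) at_top"
  proof (rule asymptotic_mult[OF asymptotic_mult[OF c t(2)] t(3)])
    show "norm (cnj (fser \<omega> \<alpha> t)) \<le> (\<Sum>\<^sub>\<infinity>n. norm (\<alpha> n))" for t using norm_fser_le[OF l(1)] by simp
    show "norm (fser \<omega> \<beta> t) \<le> (\<Sum>\<^sub>\<infinity>n. norm (\<beta> n))" for t by (rule norm_fser_le[OF l(2)])
    show "norm (fser \<omega> \<gamma> t) \<le> (\<Sum>\<^sub>\<infinity>n. norm (\<gamma> n))" for t by (rule norm_fser_le[OF l(3)])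
    show "norm (cnj (fser \<omega> \<alpha> t) * fser \<omega> \<beta> t) \<le> (\<Sum>\<^sub>\<infinity>n. norm (\<alpha> n)) * (\<Sum>\<^sub>\<infinity>n. norm (\<beta> n))" for t
      unfolding norm_mult complex_mod_cnj
      by (intro mult_mono norm_fser_le l norm_ge_zero order_trans[OF norm_ge_zero norm_fser_le[OF l(1)]])
  qed
  then show ?thesis unfolding asymptotic_to_def fser_conv3[OF l] using l1_conv3[OF l] by simp
qed

section \<open>Riccati equations driven by asymptotically periodic data\<close>

text \<open>The n-th Fourier coefficient of the periodic limit of \<open>riccati_rhs\<close> at
  order N. It reads d only at orders below N.\<close>

definition rhs_coeff :: "real \<Rightarrow> (nat \<Rightarrow> int \<Rightarrow> complex) \<Rightarrow> (nat \<Rightarrow> int \<Rightarrow> complex) \<Rightarrow>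
    (nat \<Rightarrow> int \<Rightarrow> complex \<Rightarrow> complex) \<Rightarrow> nat \<Rightarrow> int \<Rightarrow> complex \<Rightarrow> complex"
  where "rhs_coeff lam a c d N n k =
      (- 2 * of_real lam * k) * (\<Sum>(p, q, r)\<in>triples N. conv3 (a p) (\<lambda>m. d q m k) (\<lambda>m. d r m k) n)
    + (of_real lam * \<i>) * (\<Sum>(p, q, r)\<in>triples N. conv3 (c p) (\<lambda>m. d q m k) (\<lambda>m. d r m k) n)
    + (- (2 * \<i> * of_real lam)) * (\<Sum>(p, q, r)\<in>triples N. conv3 (a p) (a q) (\<lambda>m. d r m k) n)
    + (2 * k) * a N n + \<i> * c N n"

lemma riccati_rhs_nth:
  assumes "g $ 0 = 0" "h $ 0 = 0" "f $ 0 = 0"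
  shows "riccati_rhs lam k g h f $ N =
      (- 2 * of_real lam * k) * (\<Sum>(p, q, r)\<in>triples N. cnj (g $ p) * f $ q * f $ r)
    + (of_real lam * \<i>) * (\<Sum>(p, q, r)\<in>triples N. cnj (h $ p) * f $ q * f $ r)
    + (- (2 * \<i> * of_real lam)) * (\<Sum>(p, q, r)\<in>triples N. cnj (g $ p) * g $ q * f $ r)
    + (2 * k) * g $ N + \<i> * h $ N"
proof -
  have z: "fps_cnj g $ 0 = 0" "fps_cnj h $ 0 = 0" using assms by simp_all
  show ?thesis
    unfolding riccati_rhs_def fps_add_nth fps_sub_nth fps_mult_left_const_nth
      fps_triple_mult_nth[OF z(1) assms(3,3)] fps_triple_mult_nth[OF z(2) assms(3,3)]
      fps_triple_mult_nth[OF z(1) assms(1,3)] fps_cnj_nth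
    by simp
qed

text \<open>All that the asymptotic analysis retains of the quarter plane: boundary data, a solution
  of the Riccati equation in time, and a bound \<open>C N\<close> uniform in t and in k. Uniformity
  in k is what survives the limit to the boundary of the quadrant.\<close>

locale riccati_asymptotics =
  fixes lam \<omega> :: real and a c :: "nat \<Rightarrow> int \<Rightarrow> complex" and g h :: "real \<Rightarrow> complex fps"
    and \<phi> :: "complex \<Rightarrow> real \<Rightarrow> complex fps" and C :: "nat \<Rightarrow> real"
  assumes omega: "0 < \<omega>"
    and zero: "\<And>t. g t $ 0 = 0" "\<And>t. h t $ 0 = 0" "\<And>k t. \<phi> k t $ 0 = 0"
    and ga: "\<And>N. 1 \<le> N \<Longrightarrow> asymptotic_to \<omega> (\<lambda>t. g t $ N) (a N)"
    and hc: "\<And>N. 1 \<le> N \<Longrightarrow> asymptotic_to \<omega> (\<lambda>t. h t $ N) (c N)"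
    and bounded: "\<And>k t N. k \<in> D1 \<Longrightarrow> 0 < t \<Longrightarrow> norm (\<phi> k t $ N) \<le> C N"
    and ode: "\<And>k t. k \<in> D1 \<Longrightarrow> 0 < t \<Longrightarrow>
      fps_deriv_at (\<phi> k) (riccati_rhs lam k (g t) (h t) (\<phi> k t) - fps_const (4 * \<i> * k\<^sup>2) * \<phi> k t) t"
begin

abbreviation den :: "int \<Rightarrow> complex \<Rightarrow> complex" where "den n k \<equiv> 4 * \<i> * k\<^sup>2 + \<i> * of_int n * of_real \<omega>"

text \<open>The induction statement for order N. The identity with the denominator holds on the
  whole neighbourhood, zeros included, whereas the asymptotics are claimed inside the quadrant only.
  The candidate r is kept apart from d so that the orders can be chosen one after another.\<close>

definition good :: "(nat \<Rightarrow> int \<Rightarrow> complex \<Rightarrow> complex) \<Rightarrow> nat \<Rightarrow> (int \<Rightarrow> complex \<Rightarrow> complex) \<Rightarrow> bool"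
  where "good d N r \<longleftrightarrow> (1 \<le> N \<longrightarrow> wiener_family (nbhd \<omega>) r \<and>
    (\<forall>n. \<forall>k\<in>nbhd \<omega>. den n k * r n k = rhs_coeff lam a c d N n k) \<and>
    (\<forall>k\<in>D1. asymptotic_to \<omega> (\<lambda>t. \<phi> k t $ N) (\<lambda>n. r n k)))"

lemma l1_ac: "1 \<le> N \<Longrightarrow> l1 (a N)" "1 \<le> N \<Longrightarrow> l1 (c N)"
  using ga[of N] hc[of N] unfolding asymptotic_to_def by blast+

lemma D1_nbhd: "k \<in> D1 \<Longrightarrow> k \<in> nbhd \<omega>"
  by (rule nbhd_superset[OF omega]) (auto simp: D1_def)

text \<open>The real part is -8 Re k Im k.\<close>

lemma Re_D1: "k \<in> D1 \<Longrightarrow> Re (4 * \<i> * k\<^sup>2) < 0"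
  by (simp add: D1_def power2_eq_square)

context
  fixes d :: "nat \<Rightarrow> int \<Rightarrow> complex \<Rightarrow> complex" and N :: nat
  assumes IH: "\<And>M. M < N \<Longrightarrow> good d M (d M)" and N: "1 \<le> N"
begin

lemma IH_wiener: "1 \<le> M \<Longrightarrow> M < N \<Longrightarrow> wiener_family (nbhd \<omega>) (d M)"
  and IH_asym: "1 \<le> M \<Longrightarrow> M < N \<Longrightarrow> k \<in> D1 \<Longrightarrow> asymptotic_to \<omega> (\<lambda>t. \<phi> k t $ M) (\<lambda>n. d M n k)"
  using IH[of M] unfolding good_def by blast+

lemma wiener_rhs: "wiener_family (nbhd \<omega>) (rhs_coeff lam a c d N)"
proof -
  have 1: "wiener_family (nbhd \<omega>) (\<lambda>n k. \<Sum>(p, q, r)\<in>triples N. conv3 (b p) (\<lambda>m. d q m k) (\<lambda>m. d r m k) n)"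
    if b: "\<And>p. 1 \<le> p \<Longrightarrow> l1 (b p)" for b
  proof (rule wiener_family_sum)
    fix z assume z: "z \<in> triples N"
    obtain p q r where [simp]: "z = (p, q, r)" by (cases z)
    note tr = triples_less[OF z[simplified]]
    have "wiener_family (nbhd \<omega>) (\<lambda>n k. conv3 (b p) (\<lambda>m. d q m k) (\<lambda>m. d r m k) n)"
      by (rule wiener_family_conv3[OF open_nbhd b[OF tr(1)] IH_wiener[OF tr(2,5)] IH_wiener[OF tr(3,6)]])
    then show "wiener_family (nbhd \<omega>) (\<lambda>n k. case z of (p, q, r) \<Rightarrow> conv3 (b p) (\<lambda>m. d q m k) (\<lambda>m. d r m k) n)"
      by simp
  qed
  have 2: "wiener_family (nbhd \<omega>) (\<lambda>n k. \<Sum>(p, q, r)\<in>triples N. conv3 (a p) (a q) (\<lambda>m. d r m k) n)"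
  proof (rule wiener_family_sum)
    fix z assume z: "z \<in> triples N"
    obtain p q r where [simp]: "z = (p, q, r)" by (cases z)
    note tr = triples_less[OF z[simplified]]
    have "wiener_family (nbhd \<omega>) (\<lambda>n k. conv3 (a p) (\<lambda>m. a q m) (\<lambda>m. d r m k) n)"
      by (rule wiener_family_conv3[OF open_nbhd l1_ac(1)[OF tr(1)] wiener_family_const[OF l1_ac(1)[OF tr(2)]] IH_wiener[OF tr(3,6)]])
    then show "wiener_family (nbhd \<omega>) (\<lambda>n k. case z of (p, q, r) \<Rightarrow> conv3 (a p) (a q) (\<lambda>m. d r m k) n)"
      by simp
  qed
  show ?thesis
    unfolding rhs_coeff_def[abs_def]
    by (intro wiener_family_add wiener_family_mult 1 2 wiener_family_const l1_ac N holomorphic_intros)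
qed

lemma rhs_asymptotic:
  assumes k: "k \<in> D1"
  shows "asymptotic_to \<omega> (\<lambda>t. riccati_rhs lam k (g t) (h t) (\<phi> k t) $ N) (\<lambda>n. rhs_coeff lam a c d N n k)"
  unfolding riccati_rhs_nth[OF zero] rhs_coeff_def
proof (intro asymptotic_to_add asymptotic_to_cmult asymptotic_to_sum finite_triples ga hc N)
  fix z assume z: "z \<in> triples N"
  obtain p q r where [simp]: "z = (p, q, r)" by (cases z)
  note tr = triples_less[OF z[simplified]]
  note as = IH_asym[OF tr(2,5) k] IH_asym[OF tr(3,6) k]
  show "asymptotic_to \<omega> (\<lambda>t. case z of (p, q, r) \<Rightarrow> cnj (g t $ p) * \<phi> k t $ q * \<phi> k t $ r)
      (\<lambda>n. case z of (p, q, r) \<Rightarrow> conv3 (a p) (\<lambda>m. d q m k) (\<lambda>m. d r m k) n)"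
    using asymptotic_to_conv3[OF ga[OF tr(1)] as] by simp
  show "asymptotic_to \<omega> (\<lambda>t. case z of (p, q, r) \<Rightarrow> cnj (h t $ p) * \<phi> k t $ q * \<phi> k t $ r)
      (\<lambda>n. case z of (p, q, r) \<Rightarrow> conv3 (c p) (\<lambda>m. d q m k) (\<lambda>m. d r m k) n)"
    using asymptotic_to_conv3[OF hc[OF tr(1)] as] by simp
  show "asymptotic_to \<omega> (\<lambda>t. case z of (p, q, r) \<Rightarrow> cnj (g t $ p) * g t $ q * \<phi> k t $ r)
      (\<lambda>n. case z of (p, q, r) \<Rightarrow> conv3 (a p) (a q) (\<lambda>m. d r m k) n)"
    using asymptotic_to_conv3[OF ga[OF tr(1)] ga[OF tr(2)] as(2)] by simp
qed

text \<open>The frequency term is purely imaginary, so the real part of 4ik^2 bounds the denominator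
  away from zero uniformly in n.\<close>

lemma den_nonzero: "k \<in> D1 \<Longrightarrow> - Re (4 * \<i> * k\<^sup>2) \<le> norm (den n k)"
proof -
  have "Re (den n k) = Re (4 * \<i> * k\<^sup>2)" by simp
  then show "- Re (4 * \<i> * k\<^sup>2) \<le> norm (den n k)" using abs_Re_le_cmod[of "den n k"] by linarith
qed

text \<open>Since \<open>\<phi>\<close> is bounded uniformly in \<open>t\<close> and \<open>k\<close>, so are the Fourier coefficients of its
  periodic limit. Hence the right-hand sides vanish wherever the denominators do.\<close>

lemma periodic_limit:
  assumes k: "k \<in> D1"
  defines "D \<equiv> \<lambda>n. rhs_coeff lam a c d N n k / den n k"
  shows "asymptotic_to \<omega> (\<lambda>t. \<phi> k t $ N) D" "norm (D n) \<le> C N"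
proof -
  let ?F = "\<lambda>n. rhs_coeff lam a c d N n k" and ?\<mu> = "4 * \<i> * k\<^sup>2"
  note ra = rhs_asymptotic[OF k]
  have lF: "l1 ?F" using ra by (simp add: asymptotic_to_def)
  have m: "0 < - Re ?\<mu>" using Re_D1[OF k] by simp
  have dn: "den n k \<noteq> 0" for n using den_nonzero[OF k, of n] m by auto
  have lD: "l1 D"
  proof (rule summable_on_comparison_test[OF l1_cmult[OF lF, of "1 / of_real (- Re ?\<mu>)"]])
    fix n
    have "norm (?F n) / norm (den n k) \<le> norm (?F n) / (- Re ?\<mu>)"
    proof (rule divide_left_mono[OF den_nonzero[OF k] norm_ge_zero mult_pos_pos[OF _ m]])
      show "0 < norm (den n k)" using den_nonzero[OF k, of n] m by linarith
    qed
    moreover have "norm (1 / complex_of_real (- Re ?\<mu>) * ?F n) = norm (?F n) / (- Re ?\<mu>)"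
      unfolding norm_mult norm_divide norm_of_real norm_one abs_of_pos[OF m] by simp
    ultimately show "norm (D n) \<le> norm (1 / complex_of_real (- Re ?\<mu>) * ?F n)"
      unfolding D_def norm_divide by (simp only:)
  qed simp
  \<comment> \<open>The defining equation of D expresses n * D n through absolutely summable
    sequences; this makes the series with coefficients D differentiable.\<close>
  have nD: "\<i> * of_real \<omega> * (of_int n * D n) = ?F n + (- ?\<mu>) * D n" for n
  proof -
    have "den n k * D n = ?F n" using dn[of n] by (simp add: D_def)
    then show ?thesis by (simp add: algebra_simps)
  qed
  have lm: "l1 (\<lambda>n. (- ?\<mu>) * D n)" by (rule l1_cmult[OF lD])
  have lnD: "l1 (\<lambda>n. of_int n * D n)"
  proof -
    have "l1 (\<lambda>n. (1 / (\<i> * of_real \<omega>)) * (?F n + (- ?\<mu>) * D n))" by (intro l1_cmult l1_add lF lm)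
    moreover have "(1 / (\<i> * of_real \<omega>)) * (?F n + (- ?\<mu>) * D n) = of_int n * D n" for n
      unfolding nD[symmetric] using omega by simp
    ultimately show ?thesis by (simp only:)
  qed
  define hh where "hh t = \<phi> k t $ N - fser \<omega> D t" for t
  have lim: "(hh \<longlongrightarrow> 0) at_top"
  proof (rule bounded_solution_tendsto_zero[OF Re_D1[OF k]])
    show "((\<lambda>t. riccati_rhs lam k (g t) (h t) (\<phi> k t) $ N - fser \<omega> ?F t) \<longlongrightarrow> 0) at_top"
      using ra by (simp add: asymptotic_to_def)
    fix t :: real assume t: "0 < t"
    have "(fser \<omega> D has_vector_derivative fser \<omega> (\<lambda>n. ?F n + (- ?\<mu>) * D n) t) (at t)"
      using fser_deriv[OF lD lnD, of \<omega> t] unfolding nD .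
    moreover have "fser \<omega> (\<lambda>n. ?F n + (- ?\<mu>) * D n) t = fser \<omega> ?F t + (- ?\<mu>) * fser \<omega> D t"
      unfolding fser_add[OF lF lm] fser_cmult[OF lD] ..
    moreover have "((\<lambda>t. \<phi> k t $ N) has_vector_derivative riccati_rhs lam k (g t) (h t) (\<phi> k t) $ N - ?\<mu> * \<phi> k t $ N) (at t)"
      using ode[OF k t] unfolding fps_deriv_at_def by simp
    ultimately have "(hh has_vector_derivative (riccati_rhs lam k (g t) (h t) (\<phi> k t) $ N - ?\<mu> * \<phi> k t $ N) -
        (fser \<omega> ?F t + (- ?\<mu>) * fser \<omega> D t)) (at t)"
      unfolding hh_def by (intro has_vector_derivative_diff) simp_all
    moreover have "(riccati_rhs lam k (g t) (h t) (\<phi> k t) $ N - ?\<mu> * \<phi> k t $ N) - (fser \<omega> ?F t + (- ?\<mu>) * fser \<omega> D t)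
        = - ?\<mu> * hh t + (riccati_rhs lam k (g t) (h t) (\<phi> k t) $ N - fser \<omega> ?F t)"
      by (simp add: hh_def algebra_simps)
    ultimately show "(hh has_vector_derivative - ?\<mu> * hh t + (riccati_rhs lam k (g t) (h t) (\<phi> k t) $ N - fser \<omega> ?F t)) (at t)"
      by (simp only:)
    show "norm (hh t) \<le> C N + (\<Sum>\<^sub>\<infinity>n. norm (D n))"
      unfolding hh_def by (intro order_trans[OF norm_triangle_ineq4] add_mono bounded k t norm_fser_le lD)
  qed
  show "asymptotic_to \<omega> (\<lambda>t. \<phi> k t $ N) D"
    using lD lim unfolding asymptotic_to_def hh_def by blast
  \<comment> \<open>Sampling at t plus multiples of the period leaves the periodic function
    unchanged while its distance to \<phi> tends to 0, so it inherits the bound of \<phi>.\<close>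
  have "norm (fser \<omega> D t) \<le> C N" for t
  proof -
    let ?\<tau> = "2 * pi / \<omega>"
    have \<tau>: "0 < ?\<tau>" using omega by simp
    have fl: "filterlim (\<lambda>j. t + of_nat j * ?\<tau>) at_top sequentially"
      by (rule filterlim_tendsto_add_at_top[OF tendsto_const]
          filterlim_at_top_mult_tendsto_pos[OF tendsto_const \<tau> filterlim_real_sequentially])+
    have "(\<lambda>j. C N + norm (hh (t + of_nat j * ?\<tau>))) \<longlonglongrightarrow> C N + norm (0::complex)"
      by (intro tendsto_intros filterlim_compose[OF lim fl])
    moreover have "\<forall>\<^sub>F j in sequentially. norm (fser \<omega> D t) \<le> C N + norm (hh (t + of_nat j * ?\<tau>))"
      using filterlim_at_top_dense[THEN iffD1, OF fl, rule_format, of 0]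
    proof eventually_elim
      case (elim j)
      have "fser \<omega> D t = \<phi> k (t + of_nat j * ?\<tau>) $ N - hh (t + of_nat j * ?\<tau>)"
        unfolding hh_def fser_periodic[OF omega] by simp
      then have "norm (fser \<omega> D t) \<le> norm (\<phi> k (t + of_nat j * ?\<tau>) $ N) + norm (hh (t + of_nat j * ?\<tau>))"
        by (simp add: norm_triangle_ineq4)
      then show ?case using bounded[OF k elim, of N] by linarith
    qed
    ultimately show ?thesis using tendsto_lowerbound[of _ "C N + norm (0::complex)" sequentially "norm (fser \<omega> D t)"] by simp
  qed
  then show "norm (D n) \<le> C N" by (rule fourier_coefficient_bound[OF omega lD])
qed

text \<open>For large |n| the denominator has modulus at least 1 on a compact set, so the majorant
  of F serves for r; the finitely many remaining n are bounded by compactness.\<close>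

lemma wiener_quotient:
  assumes F: "wiener_family (nbhd \<omega>) F" and r: "\<And>n. r n holomorphic_on nbhd \<omega>"
    and eq: "\<And>n k. k \<in> nbhd \<omega> \<Longrightarrow> den n k * r n k = F n k"
  shows "wiener_family (nbhd \<omega>) r"
  unfolding wiener_family_def
proof (intro conjI allI impI r)
  fix K assume K: "compact K" "K \<subseteq> nbhd \<omega>"
  obtain b where b: "b summable_on UNIV" "\<And>n. 0 \<le> b n" "\<And>n k. k \<in> K \<Longrightarrow> norm (F n k) \<le> b n"
    by (rule wiener_familyE[OF F K]) (rule that)
  obtain L where L: "\<And>k. k \<in> K \<Longrightarrow> norm k \<le> L" using compact_imp_bounded[OF K(1)] by (auto simp: bounded_iff)
  \<comment> \<open>Beyond n0 the frequency |n| \<omega> exceeds 4 |k|^2 by at least 1, where L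
    bounds |k| on K.\<close>
  define n0 where "n0 = \<lceil>(1 + 4 * L\<^sup>2) / \<omega>\<rceil>"
  have "\<exists>B\<ge>0. \<forall>k\<in>K. norm (r n k) \<le> B" for n
  proof -
    have "bounded (r n ` K)"
      by (intro compact_imp_bounded compact_continuous_image K continuous_on_subset[OF holomorphic_on_imp_continuous_on[OF r] K(2)])
    then obtain B where "0 < B" "\<forall>k\<in>K. norm (r n k) \<le> B" by (auto simp: bounded_pos)
    then show ?thesis by (intro exI[of _ B]) simp
  qed
  then obtain B where B: "\<And>n. 0 \<le> B n" "\<And>n k. k \<in> K \<Longrightarrow> norm (r n k) \<le> B n" by metis
  let ?b = "\<lambda>n. b n + (if n \<in> {- n0..n0} then B n else 0)"
  have "(\<lambda>n. if n \<in> {- n0..n0} then B n else 0) summable_on UNIV"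
    by (rule summable_on_cong_neutral[THEN iffD1, OF _ _ _ summable_on_finite[of "{- n0..n0}" B]]) auto
  then have "?b summable_on UNIV" by (intro summable_on_add b(1))
  moreover have "0 \<le> ?b n" for n using b(2)[of n] B(1)[of n] by simp
  moreover have "norm (r n k) \<le> ?b n" if k: "k \<in> K" for n k
  proof (cases "n \<in> {- n0..n0}")
    case True
    then show ?thesis using B(2)[OF k, of n] b(2)[of n] by simp
  next
    case False
    then have "real_of_int n0 \<le> \<bar>real_of_int n\<bar>" by (auto simp: abs_if)
    then have "(1 + 4 * L\<^sup>2) / \<omega> \<le> \<bar>real_of_int n\<bar>" unfolding n0_def by linarith
    then have nw: "1 + 4 * L\<^sup>2 \<le> \<bar>real_of_int n\<bar> * \<omega>" using omega by (simp add: field_simps)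
    have "norm (\<i> * of_int n * complex_of_real \<omega>) = \<bar>real_of_int n\<bar> * \<omega>" using omega by (simp add: norm_mult)
    moreover have "norm (4 * \<i> * k\<^sup>2) \<le> 4 * L\<^sup>2"
      using power_mono[OF L[OF k] norm_ge_zero, of 2] by (simp add: norm_mult norm_power)
    moreover have "norm (\<i> * of_int n * complex_of_real \<omega>) \<le> norm (den n k) + norm (4 * \<i> * k\<^sup>2)"
      using norm_triangle_ineq4[of "den n k" "4 * \<i> * k\<^sup>2"] by simp
    ultimately have "1 \<le> norm (den n k)" using nw by linarith
    then have "1 * norm (r n k) \<le> norm (den n k) * norm (r n k)" by (rule mult_right_mono) simp
    also have "\<dots> = norm (F n k)" using eq[of k n] k K(2) by (simp add: norm_mult[symmetric] subsetD)
    also have "\<dots> \<le> b n" by (rule b(3)[OF k])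
    finally show ?thesis unfolding if_not_P[OF False] by simp
  qed
  ultimately show "\<exists>b. b summable_on UNIV \<and> (\<forall>n. 0 \<le> b n) \<and> (\<forall>n. \<forall>k\<in>K. norm (r n k) \<le> b n)" by blast
qed

lemma good_step: "\<exists>r. good d N r"
proof -
  have "\<exists>r. r holomorphic_on nbhd \<omega> \<and> (\<forall>k\<in>nbhd \<omega>. den n k * r k = rhs_coeff lam a c d N n k)" for n
  proof -
    have "norm (rhs_coeff lam a c d N n k) \<le> C N * norm (den n k)" if k: "k \<in> D1" for k
    proof -
      have "0 < norm (den n k)" using den_nonzero[OF k, of n] Re_D1[OF k] by linarith
      then show ?thesis using periodic_limit(2)[OF k, of n] by (simp add: norm_divide pos_divide_le_eq del: zero_less_norm_iff)
    qed
    then obtain s where "s holomorphic_on nbhd \<omega>"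
      "\<And>k. k \<in> nbhd \<omega> \<Longrightarrow> den n k * s k = rhs_coeff lam a c d N n k"
      by (rule remove_denominator[OF omega wiener_family_holomorphic[OF wiener_rhs]]) (assumption, rule that)
    then show ?thesis by blast
  qed
  then obtain r where r: "\<And>n. r n holomorphic_on nbhd \<omega>"
    "\<And>n k. k \<in> nbhd \<omega> \<Longrightarrow> den n k * r n k = rhs_coeff lam a c d N n k" by metis
  have "asymptotic_to \<omega> (\<lambda>t. \<phi> k t $ N) (\<lambda>n. r n k)" if k: "k \<in> D1" for k
  proof -
    have "r n k = rhs_coeff lam a c d N n k / den n k" for n
    proof -
      have "0 < norm (den n k)" using den_nonzero[OF k, of n] Re_D1[OF k] by linarith
      then have "den n k \<noteq> 0" unfolding zero_less_norm_iff .
      then show ?thesis unfolding r(2)[OF D1_nbhd[OF k], symmetric] by (rule nonzero_mult_div_cancel_left[symmetric])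
    qed
    then show ?thesis using periodic_limit(1)[OF k] by (simp only:)
  qed
  then have "good d N r"
    unfolding good_def using wiener_quotient[OF wiener_rhs r] r(2) by blast
  then show ?thesis by (rule exI[of _ r])
qed

end

text \<open>Dependent choice along N is legitimate because the condition on order N sees d only
  through orders below N; the first half of the proof checks this.\<close>

lemma exists_coefficients: "\<exists>d. \<forall>N. good d N (d N)"
proof (rule dependent_wf_choice[OF wf_less_than])
  fix f f' :: "nat \<Rightarrow> int \<Rightarrow> complex \<Rightarrow> complex" and N r
  assume "\<And>z. (z, N) \<in> less_than \<Longrightarrow> f z = f' z"
  then have e: "f M = f' M" if "M < N" for M using that by simp
  have s: "(\<Sum>(p, q, r)\<in>triples N. G p q r f) = (\<Sum>(p, q, r)\<in>triples N. G p q r f')"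
    if "\<And>p q r. q < N \<Longrightarrow> r < N \<Longrightarrow> G p q r f = G p q r f'"
    for G :: "nat \<Rightarrow> nat \<Rightarrow> nat \<Rightarrow> (nat \<Rightarrow> int \<Rightarrow> complex \<Rightarrow> complex) \<Rightarrow> complex"
  proof (rule sum.cong[OF refl])
    fix z assume z: "z \<in> triples N"
    obtain p q r where [simp]: "z = (p, q, r)" by (cases z)
    show "(case z of (p, q, r) \<Rightarrow> G p q r f) = (case z of (p, q, r) \<Rightarrow> G p q r f')"
      using that[OF triples_less(5,6)[OF z[simplified]]] by simp
  qed
  have "rhs_coeff lam a c f N n k = rhs_coeff lam a c f' N n k" for n k
    unfolding rhs_coeff_def
    using s[of "\<lambda>p q r f. conv3 (a p) (\<lambda>m. f q m k) (\<lambda>m. f r m k) n"]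
      s[of "\<lambda>p q r f. conv3 (c p) (\<lambda>m. f q m k) (\<lambda>m. f r m k) n"]
      s[of "\<lambda>p q r f. conv3 (a p) (a q) (\<lambda>m. f r m k) n"]
    by (simp add: e)
  then show "good f N r = good f' N r" unfolding good_def by (simp only:)
next
  fix N f assume "\<And>M. (M, N) \<in> less_than \<Longrightarrow> good f M (f M)"
  then have IH: "good f M (f M)" if "M < N" for M using that by simp
  show "\<exists>r. good f N r"
  proof (cases "1 \<le> N")
    case True
    show ?thesis by (rule good_step[OF IH True])
  qed (simp add: good_def)
qed

end

section \<open>The recursion\<close>

lemma has_sum_sum:
  fixes f :: "'i \<Rightarrow> 'x \<Rightarrow> complex"
  assumes "\<And>i. i \<in> I \<Longrightarrow> (f i has_sum s i) A"
  shows "((\<lambda>x. \<Sum>i\<in>I. f i x) has_sum (\<Sum>i\<in>I. s i)) A"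
  using assms
proof (induction I rule: infinite_finite_induct)
  case (insert i I)
  then show ?case by (simp add: has_sum_add)
qed (simp_all add: has_sum_0)

lemma cubic_term_nth:
  "(fps_cnj (eps_series (\<lambda>N. \<alpha> N l)) * eps_series (\<lambda>N. \<beta> N m) * eps_series (\<lambda>N. \<gamma> N j)) $ N =
    (\<Sum>(p, q, r)\<in>triples N. cnj (\<alpha> p l) * \<beta> q m * \<gamma> r j)"
proof -
  have "(fps_cnj (eps_series (\<lambda>N. \<alpha> N l)) * eps_series (\<lambda>N. \<beta> N m) * eps_series (\<lambda>N. \<gamma> N j)) $ N =
    (\<Sum>(p, q, r)\<in>triples N. fps_cnj (eps_series (\<lambda>N. \<alpha> N l)) $ p * eps_series (\<lambda>N. \<beta> N m) $ q * eps_series (\<lambda>N. \<gamma> N j) $ r)"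
    by (rule fps_triple_mult_nth) (simp_all add: eps_series_nth)
  also have "\<dots> = (\<Sum>(p, q, r)\<in>triples N. cnj (\<alpha> p l) * \<beta> q m * \<gamma> r j)"
  proof (rule sum.cong[OF refl])
    fix z assume z: "z \<in> triples N"
    obtain p q r where [simp]: "z = (p, q, r)" by (cases z)
    show "(case z of (p, q, r) \<Rightarrow> fps_cnj (eps_series (\<lambda>N. \<alpha> N l)) $ p * eps_series (\<lambda>N. \<beta> N m) $ q * eps_series (\<lambda>N. \<gamma> N j) $ r)
      = (case z of (p, q, r) \<Rightarrow> cnj (\<alpha> p l) * \<beta> q m * \<gamma> r j)"
      using triples_less(1-3)[OF z[simplified]] by (simp add: eps_series_nth)
  qed
  finally show ?thesis .
qed

lemma cubic_has_sum:
  assumes "\<And>N. 1 \<le> N \<Longrightarrow> l1 (\<alpha> N)" "\<And>N. 1 \<le> N \<Longrightarrow> l1 (\<beta> N)" "\<And>N. 1 \<le> N \<Longrightarrow> l1 (\<gamma> N)"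
  shows "((\<lambda>(l, m). (fps_cnj (eps_series (\<lambda>N. \<alpha> N l)) * eps_series (\<lambda>N. \<beta> N m) * eps_series (\<lambda>N. \<gamma> N (n + l - m))) $ N)
    has_sum (\<Sum>(p, q, r)\<in>triples N. conv3 (\<alpha> p) (\<beta> q) (\<gamma> r) n)) UNIV"
proof -
  have "((\<lambda>x. \<Sum>z\<in>triples N. case z of (p, q, r) \<Rightarrow> case x of (l, m) \<Rightarrow> cnj (\<alpha> p l) * \<beta> q m * \<gamma> r (n + l - m))
    has_sum (\<Sum>z\<in>triples N. case z of (p, q, r) \<Rightarrow> conv3 (\<alpha> p) (\<beta> q) (\<gamma> r) n)) UNIV"
  proof (rule has_sum_sum)
    fix z assume z: "z \<in> triples N"
    obtain p q r where [simp]: "z = (p, q, r)" by (cases z)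
    note tr = triples_less[OF z[simplified]]
    have "((\<lambda>(l, m). cnj (\<alpha> p l) * \<beta> q m * \<gamma> r (n + l - m)) has_sum conv3 (\<alpha> p) (\<beta> q) (\<gamma> r) n) UNIV"
      unfolding conv3_def by (rule has_sum_infsum[OF conv3_summable(2)]) (rule assms tr)+
    then show "((\<lambda>x. case z of (p, q, r) \<Rightarrow> case x of (l, m) \<Rightarrow> cnj (\<alpha> p l) * \<beta> q m * \<gamma> r (n + l - m))
      has_sum (case z of (p, q, r) \<Rightarrow> conv3 (\<alpha> p) (\<beta> q) (\<gamma> r) n)) UNIV" by simp
  qed
  then show ?thesis unfolding cubic_term_nth by (simp add: case_prod_unfold)
qed

lemma cubic_summable_eps:
  assumes "\<And>N. 1 \<le> N \<Longrightarrow> l1 (\<alpha> N)" "\<And>N. 1 \<le> N \<Longrightarrow> l1 (\<beta> N)" "\<And>N. 1 \<le> N \<Longrightarrow> l1 (\<gamma> N)"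
  shows "cubic_summable (\<lambda>n. eps_series (\<lambda>N. \<alpha> N n)) (\<lambda>n. eps_series (\<lambda>N. \<beta> N n)) (\<lambda>n. eps_series (\<lambda>N. \<gamma> N n)) n"
    "cubic_sum (\<lambda>n. eps_series (\<lambda>N. \<alpha> N n)) (\<lambda>n. eps_series (\<lambda>N. \<beta> N n)) (\<lambda>n. eps_series (\<lambda>N. \<gamma> N n)) n $ N
      = (\<Sum>(p, q, r)\<in>triples N. conv3 (\<alpha> p) (\<beta> q) (\<gamma> r) n)"
proof -
  note hs = cubic_has_sum[where \<alpha> = \<alpha> and \<beta> = \<beta> and \<gamma> = \<gamma> and n = n]
  show "cubic_summable (\<lambda>n. eps_series (\<lambda>N. \<alpha> N n)) (\<lambda>n. eps_series (\<lambda>N. \<beta> N n)) (\<lambda>n. eps_series (\<lambda>N. \<gamma> N n)) n"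
    unfolding cubic_summable_def by (intro allI has_sum_imp_summable[OF hs] assms)
  show "cubic_sum (\<lambda>n. eps_series (\<lambda>N. \<alpha> N n)) (\<lambda>n. eps_series (\<lambda>N. \<beta> N n)) (\<lambda>n. eps_series (\<lambda>N. \<gamma> N n)) n $ N
      = (\<Sum>(p, q, r)\<in>triples N. conv3 (\<alpha> p) (\<beta> q) (\<gamma> r) n)"
    unfolding cubic_sum_def fps_nth_Abs_fps by (intro infsumI[OF hs] assms)
qed

text \<open>The index sums agree term by term at order N, so the equality holds whether or not they
  converge.\<close>

lemma cubic_sum_nth_cong:
  assumes "\<And>M. 1 \<le> M \<Longrightarrow> M < N \<Longrightarrow> \<alpha> M = \<alpha>' M" "\<And>M. 1 \<le> M \<Longrightarrow> M < N \<Longrightarrow> \<beta> M = \<beta>' M"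
    "\<And>M. 1 \<le> M \<Longrightarrow> M < N \<Longrightarrow> \<gamma> M = \<gamma>' M"
  shows "cubic_sum (\<lambda>n. eps_series (\<lambda>N. \<alpha> N n)) (\<lambda>n. eps_series (\<lambda>N. \<beta> N n)) (\<lambda>n. eps_series (\<lambda>N. \<gamma> N n)) n $ N =
    cubic_sum (\<lambda>n. eps_series (\<lambda>N. \<alpha>' N n)) (\<lambda>n. eps_series (\<lambda>N. \<beta>' N n)) (\<lambda>n. eps_series (\<lambda>N. \<gamma>' N n)) n $ N"
proof -
  have "(\<Sum>(p, q, r)\<in>triples N. cnj (\<alpha> p l) * \<beta> q m * \<gamma> r j) = (\<Sum>(p, q, r)\<in>triples N. cnj (\<alpha>' p l) * \<beta>' q m * \<gamma>' r j)" for l m j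
  proof (rule sum.cong[OF refl])
    fix z assume z: "z \<in> triples N"
    obtain p q r where [simp]: "z = (p, q, r)" by (cases z)
    note tr = triples_less[OF z[simplified]]
    show "(case z of (p, q, r) \<Rightarrow> cnj (\<alpha> p l) * \<beta> q m * \<gamma> r j) = (case z of (p, q, r) \<Rightarrow> cnj (\<alpha>' p l) * \<beta>' q m * \<gamma>' r j)"
      using assms(1)[OF tr(1,4)] assms(2)[OF tr(2,5)] assms(3)[OF tr(3,6)] by simp
  qed
  then show ?thesis unfolding cubic_sum_def fps_nth_Abs_fps cubic_term_nth by (simp only:)
qed

text \<open>The right-hand sides at order N involve lower orders and, in the formula for d, also
  \<open>c N n\<close>. Hence c is settled first, then d away from the removable point, and finally
  d there by continuity.\<close>

lemma recursion_unique:
  assumes \<omega>: "0 < \<omega>"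
    and R: "neumann_recursion lam \<omega> a c d" and R': "neumann_recursion lam \<omega> a c' d'"
    and N: "1 \<le> N"
  shows "c' N n = c N n \<and> (\<forall>k\<in>frontier D1. d' N n k = d N n k)"
  using N
proof (induction N arbitrary: n rule: less_induct)
  case (less N)
  let ?e = "\<lambda>f n. eps_series (\<lambda>N. f N n)" and ?d = "\<lambda>f k n. eps_series (\<lambda>N. f N n k)"
  have cN: "c N n = c_rhs lam (k1 \<omega> n) (?e a) (?e c) (?d d (k1 \<omega> n)) n $ N"
    and dN: "\<And>k. k \<in> frontier D1 - {k1 \<omega> n} \<Longrightarrow> d N n k = 1 / (4 * \<i> * k\<^sup>2 + \<i> * of_int n * of_real \<omega>) * d_rhs lam k (?e a) (?e c) (?d d k) n $ N"
    and cont: "continuous_on (frontier D1) (d N n)" for n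
    using R less.prems unfolding neumann_recursion_def Let_def by blast+
  have cN': "c' N n = c_rhs lam (k1 \<omega> n) (?e a) (?e c') (?d d' (k1 \<omega> n)) n $ N"
    and dN': "\<And>k. k \<in> frontier D1 - {k1 \<omega> n} \<Longrightarrow> d' N n k = 1 / (4 * \<i> * k\<^sup>2 + \<i> * of_int n * of_real \<omega>) * d_rhs lam k (?e a) (?e c') (?d d' k) n $ N"
    and cont': "continuous_on (frontier D1) (d' N n)" for n
    using R' less.prems unfolding neumann_recursion_def Let_def by blast+
  have ec: "c M = c' M" if "1 \<le> M" "M < N" for M using less.IH[OF that(2,1)] by (intro ext) simp
  have ed: "(\<lambda>m. d M m k) = (\<lambda>m. d' M m k)" if "1 \<le> M" "M < N" "k \<in> frontier D1" for M k
    using less.IH[OF that(2,1)] that(3) by (intro ext) simp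
  have S: "cubic_sum (?e a) (?d d k) (?d d k) n $ N = cubic_sum (?e a) (?d d' k) (?d d' k) n $ N"
    "cubic_sum (?e c) (?d d k) (?d d k) n $ N = cubic_sum (?e c') (?d d' k) (?d d' k) n $ N"
    "cubic_sum (?e a) (?e a) (?d d k) n $ N = cubic_sum (?e a) (?e a) (?d d' k) n $ N"
    if k: "k \<in> frontier D1" for k n
  proof -
    note ed' = ed[OF _ _ k]
    show "cubic_sum (?e a) (?d d k) (?d d k) n $ N = cubic_sum (?e a) (?d d' k) (?d d' k) n $ N"
      by (rule cubic_sum_nth_cong[where \<alpha> = a and \<alpha>' = a and \<beta> = "\<lambda>N n. d N n k" and \<gamma> = "\<lambda>N n. d N n k"
          and \<beta>' = "\<lambda>N n. d' N n k" and \<gamma>' = "\<lambda>N n. d' N n k"]) (rule refl | erule (1) ed')+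
    show "cubic_sum (?e c) (?d d k) (?d d k) n $ N = cubic_sum (?e c') (?d d' k) (?d d' k) n $ N"
      by (rule cubic_sum_nth_cong[where \<alpha> = c and \<alpha>' = c' and \<beta> = "\<lambda>N n. d N n k" and \<gamma> = "\<lambda>N n. d N n k"
          and \<beta>' = "\<lambda>N n. d' N n k" and \<gamma>' = "\<lambda>N n. d' N n k"]) (erule (1) ec | erule (1) ed')+
    show "cubic_sum (?e a) (?e a) (?d d k) n $ N = cubic_sum (?e a) (?e a) (?d d' k) n $ N"
      by (rule cubic_sum_nth_cong[where \<alpha> = a and \<alpha>' = a and \<beta> = a and \<gamma> = "\<lambda>N n. d N n k"
          and \<beta>' = a and \<gamma>' = "\<lambda>N n. d' N n k"]) (rule refl | erule (1) ed')+
  qed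
  have c: "c' N n = c N n" for n
    unfolding cN[of n] cN'[of n] c_rhs_def fps_add_nth fps_sub_nth fps_mult_left_const_nth S[OF k1_frontier[OF \<omega>]] ..
  have off: "d' N n k = d N n k" if k: "k \<in> frontier D1" "k \<noteq> k1 \<omega> n" for k
  proof -
    have "k \<in> frontier D1 - {k1 \<omega> n}" using k by simp
    note this[THEN dN] this[THEN dN']
    moreover have "?e c' n $ N = ?e c n $ N" using c[of n] less.prems by (simp add: eps_series_nth)
    ultimately show ?thesis
      unfolding d_rhs_def fps_add_nth fps_sub_nth fps_mult_left_const_nth S[OF k(1)] by (simp only:)
  qed
  have "d' N n k = d N n k" if k: "k \<in> frontier D1" for k
  proof (cases "k = k1 \<omega> n")
    case True
    obtain x :: "nat \<Rightarrow> complex" where x: "\<And>j. x j \<in> frontier D1" "\<And>j. x j \<noteq> k" "x \<longlonglongrightarrow> k"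
    proof -
      \<comment> \<open>The direction of the axis that carries \<open>k1 \<omega> n\<close>:
        imaginary for n >= 0, real for n < 0. Moving away from 0 along it stays on the
        frontier.\<close>
      define v where "v = (if n \<ge> 0 then \<i> else 1)"
      let ?x = "\<lambda>j. k + v * of_real (inverse (real (Suc j)))"
      have "?x \<longlonglongrightarrow> k + v * of_real 0" by (intro tendsto_intros LIMSEQ_inverse_real_of_nat)
      then have lim: "?x \<longlonglongrightarrow> k" by simp
      have ne: "?x j \<noteq> k" for j by (simp add: v_def del: of_nat_Suc)
      have fr: "?x j \<in> frontier D1" for j
      proof -
        have i: "0 < inverse (real (Suc j))" by simp
        have "(0 \<le> n \<longrightarrow> Re k = 0) \<and> (n < 0 \<longrightarrow> Im k = 0)" unfolding True by (simp add: k1_def)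
        then show ?thesis using k i unfolding frontier_D1 v_def
          by (cases "0 \<le> n") (simp_all add: add_nonneg_nonneg less_imp_le del: of_real_inverse)
      qed
      show ?thesis by (rule that[of ?x, OF fr ne lim])
    qed
    have "(\<lambda>j. d N n (x j)) \<longlonglongrightarrow> d N n k" "(\<lambda>j. d' N n (x j)) \<longlonglongrightarrow> d' N n k"
      by (rule continuous_on_tendsto_compose[OF cont x(3) k] continuous_on_tendsto_compose[OF cont' x(3) k];
        simp add: x(1))+
    moreover have "(\<lambda>j. d' N n (x j)) = (\<lambda>j. d N n (x j))" using off[OF x(1)] x(2) True by blast
    ultimately show ?thesis by (simp only: LIMSEQ_unique)
  qed (rule off[OF k])
  with c show ?case by blast
qed

context riccati_asymptotics
begin

text \<open>Both formulas are one identity,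
  \<open>den n k * d N n k = rhs_coeff lam a c d N n k\<close>: at the zero
  \<open>k1 \<omega> n\<close> it makes the right side vanish, which is the formula for c, and
  elsewhere it is divided by the denominator.\<close>

lemma exists_recursion: "\<exists>d. neumann_recursion lam \<omega> a c d"
proof -
  obtain d where good: "\<And>N. good d N (d N)" using exists_coefficients by blast
  have W: "wiener_family (nbhd \<omega>) (d N)"
    and eq: "\<And>n k. k \<in> nbhd \<omega> \<Longrightarrow> den n k * d N n k = rhs_coeff lam a c d N n k" if "1 \<le> N" for N
    using good[of N] that unfolding good_def by blast+
  have sub: "frontier D1 \<subseteq> nbhd \<omega>" unfolding frontier_D1 using nbhd_superset[OF omega] by blast
  let ?A = "\<lambda>n. eps_series (\<lambda>N. a N n)" and ?C = "\<lambda>n. eps_series (\<lambda>N. c N n)" and ?D = "\<lambda>k n. eps_series (\<lambda>N. d N n k)"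
  have l1d: "l1 (\<lambda>m. d N m k)" if "1 \<le> N" "k \<in> frontier D1" for N k
    using wiener_family_l1[OF W[OF that(1)]] that(2) sub by blast
  have cs: "cubic_summable ?A (?D k) (?D k) n" "cubic_summable ?C (?D k) (?D k) n" "cubic_summable ?A ?A (?D k) n"
    and cn: "cubic_sum ?A (?D k) (?D k) n $ N = (\<Sum>(p, q, r)\<in>triples N. conv3 (a p) (\<lambda>m. d q m k) (\<lambda>m. d r m k) n)"
    "cubic_sum ?C (?D k) (?D k) n $ N = (\<Sum>(p, q, r)\<in>triples N. conv3 (c p) (\<lambda>m. d q m k) (\<lambda>m. d r m k) n)"
    "cubic_sum ?A ?A (?D k) n $ N = (\<Sum>(p, q, r)\<in>triples N. conv3 (a p) (a q) (\<lambda>m. d r m k) n)"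
    if k: "k \<in> frontier D1" for k n N
    by (rule cubic_summable_eps; (rule l1_ac l1d[OF _ k], assumption))+
  have dr: "d_rhs lam k ?A ?C (?D k) n $ N = rhs_coeff lam a c d N n k" if "k \<in> frontier D1" "1 \<le> N" for k n N
    unfolding d_rhs_def rhs_coeff_def fps_add_nth fps_sub_nth fps_mult_left_const_nth cn[OF that(1)]
    using that(2) by (simp add: eps_series_nth)
  \<comment> \<open>Multiplying by i turns the term i c into -c; hence the vanishing of
    \<open>rhs_coeff\<close> is the same as the equation for c.\<close>
  have cr: "c_rhs lam k ?A ?C (?D k) n $ N = \<i> * rhs_coeff lam a c d N n k + c N n" if "k \<in> frontier D1" "1 \<le> N" for k n N
    unfolding c_rhs_def rhs_coeff_def fps_add_nth fps_sub_nth fps_mult_left_const_nth cn[OF that(1)]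
    using that(2) by (simp add: eps_series_nth algebra_simps)
  have "neumann_recursion lam \<omega> a c d"
    unfolding neumann_recursion_def Let_def
  proof (intro conjI allI impI ballI cs)
    fix N :: nat and n assume N: "1 \<le> N"
    show "continuous_on (frontier D1) (d N n)"
      by (rule continuous_on_subset[OF holomorphic_on_imp_continuous_on[OF wiener_family_holomorphic[OF W[OF N]]] sub])
    have "den n (k1 \<omega> n) = 0" unfolding denominator_factor[OF omega] by simp
    then have "rhs_coeff lam a c d N n (k1 \<omega> n) = 0"
      using eq[OF N, of "k1 \<omega> n" n] sub k1_frontier[OF omega, of n] by (metis mult_zero_left subsetD)
    then show "c N n = c_rhs lam (k1 \<omega> n) ?A ?C (?D (k1 \<omega> n)) n $ N"
      unfolding cr[OF k1_frontier[OF omega] N] by simp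
    fix k assume k: "k \<in> frontier D1 - {k1 \<omega> n}"
    \<comment> \<open>The second zero of the denominator is off the frontier, except for n = 0,
      where it coincides with the excluded point \<open>k1 \<omega> 0\<close>, which is 0.\<close>
    have "k \<noteq> - k1 \<omega> n"
    proof
      assume "k = - k1 \<omega> n"
      then have "- k1 \<omega> n \<in> nbhd \<omega>" using k sub by blast
      then have "n = 0" using minus_k1_notin_nbhd[OF omega] by blast
      then show False using k \<open>k = - k1 \<omega> n\<close> by (simp add: k1_def)
    qed
    then have nz: "den n k \<noteq> 0"
      unfolding denominator_factor[OF omega] using k by (simp add: add_eq_0_iff2)
    have kf: "k \<in> frontier D1" and kn: "k \<in> nbhd \<omega>" using k sub by auto
    show "d N n k = 1 / den n k * d_rhs lam k ?A ?C (?D k) n $ N"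
      unfolding dr[OF kf N] eq[OF N kn, symmetric] using nz by simp
  qed
  then show ?thesis by (rule exI[of _ d])
qed

end

theorem theorem3p2:
  fixes lam \<omega> \<tau> :: real
    and g0b g1b :: "nat \<Rightarrow> real \<Rightarrow> complex"
    and u :: "nat \<Rightarrow> real \<times> real \<Rightarrow> complex"
    and a c :: "nat \<Rightarrow> int \<Rightarrow> complex"
  assumes "lam \<in> {1, -1}"
    and "\<omega> > 0"
    and "\<tau> = 2 * pi / \<omega>"
    and "\<And>N. N \<ge> 1 \<Longrightarrow> smooth_periodic \<tau> (g0b N)"
    and "\<And>N. N \<ge> 1 \<Longrightarrow> smooth_periodic \<tau> (g1b N)"
    and "perturbative_solution lam u"
    and "\<And>N. N \<ge> 1 \<Longrightarrow>
           (\<lambda>t. norm (ext (u N) (0, t) - g0b N t)) \<in> O[at_top](\<lambda>t. t powr (- 7 / 2))"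
    and "\<And>N. N \<ge> 1 \<Longrightarrow>
           (\<lambda>t. norm (ext (Dx (u N)) (0, t) - g1b N t)) \<in> O[at_top](\<lambda>t. t powr (- 7 / 2))"
    and "\<And>N. N \<ge> 1 \<Longrightarrow> bounded_in_L1 (u N)"
    and "\<And>N. N \<ge> 1 \<Longrightarrow> fourier_coefficients \<omega> (g0b N) (a N)"
    and "\<And>N. N \<ge> 1 \<Longrightarrow> fourier_coefficients \<omega> (g1b N) (c N)"
  shows "\<exists>d. neumann_recursion lam \<omega> a c d \<and>
           (\<forall>c' d'. neumann_recursion lam \<omega> a c' d' \<longrightarrow>
              (\<forall>N\<ge>1. \<forall>n. c' N n = c N n \<and> (\<forall>k\<in>frontier D1. d' N n k = d N n k)))"
proof -
  interpret nls_perturbation lam u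
    by (rule nls_perturbation.intro[OF assms(1,6,9)])
  obtain C where C: "\<And>k t N. 0 < Im k \<Longrightarrow> 0 < t \<Longrightarrow> norm (\<Phi> k t $ N) \<le> C N"
    by (rule \<Phi>_bounded) (rule that)
  have null: "(x \<longlongrightarrow> 0) at_top"
    if bo: "(\<lambda>t. norm (x t)) \<in> O[at_top](\<lambda>t. t powr (- 7 / 2))" for x :: "real \<Rightarrow> complex"
  proof -
    have p: "((\<lambda>t::real. t powr (- 7 / 2)) \<longlongrightarrow> 0) at_top" by (rule tendsto_neg_powr[OF _ filterlim_ident]) simp
    obtain B where "\<forall>\<^sub>F t in at_top. norm (norm (x t)) \<le> B * norm (t powr (- 7 / 2))"
      by (rule landau_o.bigE[OF bo]) (rule that)
    then have "\<forall>\<^sub>F t in at_top. norm (x t) \<le> B * norm (t powr (- 7 / 2))" by simp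
    then show ?thesis
      by (rule Lim_null_comparison) (rule tendsto_mult_right_zero[OF tendsto_norm_zero[OF p]])
  qed
  have asym: "asymptotic_to \<omega> x \<alpha>"
    if "fourier_coefficients \<omega> f \<alpha>" "(\<lambda>t. norm (x t - f t)) \<in> O[at_top](\<lambda>t. t powr (- 7 / 2))" for x f \<alpha>
    using l1_of_fourier_coefficients[OF that(1)] null[OF that(2)] by (simp add: asymptotic_to_def)
  have "riccati_asymptotics lam \<omega> a c G0 G1 \<Phi> C"
  proof
    show "asymptotic_to \<omega> (\<lambda>t. G0 t $ N) (a N)" "asymptotic_to \<omega> (\<lambda>t. G1 t $ N) (c N)" if "1 \<le> N" for N
      using asym[OF assms(10)[OF that] assms(7)[OF that]] asym[OF assms(11)[OF that] assms(8)[OF that]] that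
      by (simp_all add: G0_def G1_def eps_series_nth)
    show "norm (\<Phi> k t $ N) \<le> C N" if "k \<in> D1" "0 < t" for k t N
      by (rule C) (use that in \<open>auto simp: D1_def\<close>)
    show "fps_deriv_at (\<Phi> k) (riccati_rhs lam k (G0 t) (G1 t) (\<Phi> k t) - fps_const (4 * \<i> * k\<^sup>2) * \<Phi> k t) t"
      if "k \<in> D1" "0 < t" for k t
      by (rule \<Phi>_riccati) (use that in \<open>auto simp: D1_def\<close>)
  qed (simp_all add: assms(2) G0_def G1_def \<Phi>_def eps_series_nth)
  then obtain d where d: "neumann_recursion lam \<omega> a c d"
    using riccati_asymptotics.exists_recursion by blast
  show ?thesis
    using recursion_unique[OF assms(2) d] d by blast
qed

end
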